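(* Let $\mathcal X$ be a projective, geometrically irreducible, nonsingular curve of genus $g$ over $\mathbf F_q$. Let $D=P_1+\dots+P_n$ be a sum of $n$ pairwise distinct $\mathbf F_q$-rational points of $\mathcal X$, and let $G$ be an $\mathbf F_q$-rational divisor with $P_i\notin\operatorname{supp}(G)$ for all $i$. Let $\mathcal C=\mathcal C(\mathcal X,D,G)$, with dimension $k$, and put $m:=\deg(G)$. Assume $2k\le n$, $n>2g$, and $2m-n\ge -1$. Then $\Delta[\mathcal C]\le R(2m-n)$, and hence $s[\mathcal C]\ge w(\mathcal C)-R(2m-n)$.
   Context: For an $\mathbf F_q$-rational divisor $F$, $\mathcal L(F)$ is the space of rational functions $f$ over $\mathbf F_q$ with $f=0$ or $F+\operatorname{div}(f)\succeq 0$, and $\ell(F)=\dim_{\mathbf F_q}\mathcal L(F)$. The AG code $\mathcal C(\mathcal X,D,G)$ is the image of the map $\mathcal L(G)\to\mathbf F_q^n$, $f\mapsto(f(P_1),\dots,f(P_n))$. State complexity. For a linear $[n,k]$ code $\mathcal C$ with a fixed coordinate order, define the past and future subcodes: $\mathcal P_0=\mathcal F_n=0$, $\mathcal P_n=\mathcal F_0=\mathcal C$, and for $1\le i\le n-1$, $\mathcal P_i=\{(c_1,\dots,c_i):(c_1,\dots,c_i,0,\dots,0)\in\mathcal C\}$ and $\mathcal F_i=\{(c_{i+1},\dots,c_n):(0,\dots,0,c_{i+1},\dots,c_n)\in\mathcal C\}$. Put $\Delta_i=\dim\mathcal P_i+\dim\mathcal F_i$ and $\Delta(\mathcal C)=\min_{0\le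 i\le n}\Delta_i$. The state complexity of $\mathcal C$, i.e. the maximal $\log_q$ of the number of vertices at a level of its minimal trellis, equals $s(\mathcal C)=k-\Delta(\mathcal C)$. Let $[\mathcal C]$ be the set of codes obtained from $\mathcal C$ by permuting coordinates. Put $s[\mathcal C]=\min\{s(\mathcal C'):\mathcal C'\in[\mathcal C]\}$, $\Delta[\mathcal C]=\max\{\Delta(\mathcal C'):\mathcal C'\in[\mathcal C]\}$, and $w(\mathcal C)=\min\{k,n-k\}$. Gonality sequence. For $i\ge1$, $\gamma_i=\min\{\deg A: A\ \mathbf F_q\text{-rational divisor},\ \ell(A)\ge i\}$, and $GS(\mathcal X)=\{\gamma_i:i\ge1\}$. Let $\mathbf N'=\{-1,0,1,2,\dots\}$. Define $\tilde\ell:\mathbf N'\to\mathbf N_0$ by $\tilde\ell(-1)=0$ and $\tilde\ell(a)=\max\{i\ge1:\gamma_i\le a\}$ for $a\ge0$. Define $R$ on the integers $N$ with $-1\le N\le 2g-2$ by $R(N)=\min\{\tilde\ell(a)+\tilde\ell(b): a,b\in\mathbf N',\ a+b=N\}$. *)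

theory Defs
  imports Main "HOL-Computational_Algebra.Polynomial"
begin

text \<open>The curve X over F_q is represented by its function field: the type 'K is the
function field F_q(X), and Fq :: 'K set is the (finite) constant field F_q.\<close>

definition subfield :: "'K::field set \<Rightarrow> bool" where
  "subfield F \<longleftrightarrow> 0 \<in> F \<and> 1 \<in> F \<and> (\<forall>a\<in>F. \<forall>b\<in>F. a + b \<in> F \<and> a - b \<in> F \<and> a * b \<in> F)
     \<and> (\<forall>a\<in>F. inverse a \<in> F)"

definition poly_over :: "'K::field set \<Rightarrow> 'K poly \<Rightarrow> bool" where
  "poly_over F p \<longleftrightarrow> (\<forall>i. coeff p i \<in> F)"

definition algebraic_over :: "'K::field set \<Rightarrow> 'K \<Rightarrow> bool" where
  "algebraic_over F y \<longleftrightarrow> (\<exists>p. poly_over F p \<and> p \<noteq> 0 \<and> poly p y = 0)"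

definition rat_fun_field :: "'K::field set \<Rightarrow> 'K \<Rightarrow> 'K set" where
  "rat_fun_field F x = {poly p x / poly r x | p r. poly_over F p \<and> poly_over F r \<and> poly r x \<noteq> 0}"

definition finite_dim_over :: "'K::field set \<Rightarrow> bool" where
  "finite_dim_over L \<longleftrightarrow> (\<exists>bs :: 'K list. \<forall>y. \<exists>cs. length cs = length bs \<and> set cs \<subseteq> L \<and>
      y = sum_list (map2 (*) cs bs))"

text \<open>'K is an algebraic function field of one variable over the finite field Fq with
full constant field Fq (i.e. the function field of a projective, nonsingular,
geometrically irreducible curve over Fq).\<close>
definition function_field :: "'K::field set \<Rightarrow> bool" where
  "function_field Fq \<longleftrightarrow> subfield Fq \<and> finite Fq \<and>
     (\<exists>x. \<not> algebraic_over Fq x \<and> finite_dim_over (rat_fun_field Fq x)) \<and>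
     (\<forall>y. algebraic_over Fq y \<longrightarrow> y \<in> Fq)"

text \<open>Places (closed points of X) are represented by their normalized discrete valuations
(with the convention v 0 = 0).\<close>
definition is_place :: "'K::field set \<Rightarrow> ('K \<Rightarrow> int) \<Rightarrow> bool" where
  "is_place Fq v \<longleftrightarrow> v 0 = 0 \<and>
     (\<forall>x y. x \<noteq> 0 \<longrightarrow> y \<noteq> 0 \<longrightarrow> v (x * y) = v x + v y) \<and>
     (\<forall>x y. x \<noteq> 0 \<longrightarrow> y \<noteq> 0 \<longrightarrow> x + y \<noteq> 0 \<longrightarrow> v (x + y) \<ge> min (v x) (v y)) \<and>
     (\<forall>n. \<exists>x. x \<noteq> 0 \<and> v x = n) \<and>
     (\<forall>c\<in>Fq. c \<noteq> 0 \<longrightarrow> v c = 0)"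

definition val_ring :: "('K::field \<Rightarrow> int) \<Rightarrow> 'K set" where
  "val_ring v = {x. x = 0 \<or> v x \<ge> 0}"

definition res_rel :: "('K::field \<Rightarrow> int) \<Rightarrow> ('K \<times> 'K) set" where
  "res_rel v = {(a, b). a \<in> val_ring v \<and> b \<in> val_ring v \<and> (a - b = 0 \<or> v (a - b) > 0)}"

text \<open>Degree of a place: dimension of its residue field over Fq.\<close>
definition deg_place :: "'K::field set \<Rightarrow> ('K \<Rightarrow> int) \<Rightarrow> nat" where
  "deg_place Fq v = (THE d. card (val_ring v // res_rel v) = card Fq ^ d)"

definition rational_place :: "'K::field set \<Rightarrow> ('K \<Rightarrow> int) \<Rightarrow> bool" where
  "rational_place Fq v \<longleftrightarrow> is_place Fq v \<and> deg_place Fq v = 1"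

definition eval_at :: "'K::field set \<Rightarrow> ('K \<Rightarrow> int) \<Rightarrow> 'K \<Rightarrow> 'K" where
  "eval_at Fq v f = (THE c. c \<in> Fq \<and> (f - c = 0 \<or> v (f - c) > 0))"

type_synonym 'K divisor = "('K \<Rightarrow> int) \<Rightarrow> int"

definition is_divisor :: "'K::field set \<Rightarrow> 'K divisor \<Rightarrow> bool" where
  "is_divisor Fq A \<longleftrightarrow> finite {P. A P \<noteq> 0} \<and> (\<forall>P. A P \<noteq> 0 \<longrightarrow> is_place Fq P)"

definition deg_div :: "'K::field set \<Rightarrow> 'K divisor \<Rightarrow> int" where
  "deg_div Fq A = (\<Sum>P\<in>{P. A P \<noteq> 0}. A P * int (deg_place Fq P))"

definition LL :: "'K::field set \<Rightarrow> 'K divisor \<Rightarrow> 'K set" where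
  "LL Fq A = {f. f = 0 \<or> (\<forall>P. is_place Fq P \<longrightarrow> P f + A P \<ge> 0)}"

text \<open>Dimension over Fq of a finite Fq-vector space S (via card S = q^dim).\<close>
definition fdim :: "'K set \<Rightarrow> 'b set \<Rightarrow> nat" where
  "fdim Fq S = (THE d. card S = card Fq ^ d)"

definition ell :: "'K::field set \<Rightarrow> 'K divisor \<Rightarrow> nat" where
  "ell Fq A = fdim Fq (LL Fq A)"

definition genus :: "'K::field set \<Rightarrow> int" where
  "genus Fq = (SUP A\<in>{A. is_divisor Fq A}. deg_div Fq A - int (ell Fq A) + 1)"

definition gonality :: "'K::field set \<Rightarrow> nat \<Rightarrow> int" where
  "gonality Fq i = (INF A\<in>{A. is_divisor Fq A \<and> ell Fq A \<ge> i}. deg_div Fq A)"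

definition ell_tilde :: "'K::field set \<Rightarrow> int \<Rightarrow> nat" where
  "ell_tilde Fq a = (if a = -1 then 0 else Sup {i. i \<ge> 1 \<and> gonality Fq i \<le> a})"

definition RR :: "'K::field set \<Rightarrow> int \<Rightarrow> nat" where
  "RR Fq N = Min {ell_tilde Fq a + ell_tilde Fq b | a b. a \<ge> -1 \<and> b \<ge> -1 \<and> a + b = N}"

text \<open>AG code C(X, D, G) with D = P_1 + ... + P_n given by the list ps.\<close>
definition AG_code :: "'K::field set \<Rightarrow> ('K \<Rightarrow> int) list \<Rightarrow> 'K divisor \<Rightarrow> 'K list set" where
  "AG_code Fq ps G = {map (\<lambda>P. eval_at Fq P f) ps | f. f \<in> LL Fq G}"

definition past :: "'a::zero list set \<Rightarrow> nat \<Rightarrow> 'a list set" where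
  "past C i = {take i c | c. c \<in> C \<and> (\<forall>x\<in>set (drop i c). x = 0)}"

definition future :: "'a::zero list set \<Rightarrow> nat \<Rightarrow> 'a list set" where
  "future C i = {drop i c | c. c \<in> C \<and> (\<forall>x\<in>set (take i c). x = 0)}"

definition Delta :: "'a::zero set \<Rightarrow> nat \<Rightarrow> 'a list set \<Rightarrow> nat" where
  "Delta Fq n C = Min {fdim Fq (past C i) + fdim Fq (future C i) | i. i \<le> n}"

definition state_complexity :: "'a::zero set \<Rightarrow> nat \<Rightarrow> 'a list set \<Rightarrow> int" where
  "state_complexity Fq n C = int (fdim Fq C) - int (Delta Fq n C)"

definition permute_code :: "nat \<Rightarrow> (nat \<Rightarrow> nat) \<Rightarrow> 'a list set \<Rightarrow> 'a list set" where
  "permute_code n \<sigma> C = {map (\<lambda>j. c ! \<sigma> j) [0..<n] | c. c \<in> C}"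

definition perm_class :: "nat \<Rightarrow> 'a list set \<Rightarrow> 'a list set set" where
  "perm_class n C = {permute_code n \<sigma> C | \<sigma>. bij_betw \<sigma> {..<n} {..<n}}"

definition Delta_perm :: "'a::zero set \<Rightarrow> nat \<Rightarrow> 'a list set \<Rightarrow> nat" where
  "Delta_perm Fq n C = Max (Delta Fq n ` perm_class n C)"

definition sc_perm :: "'a::zero set \<Rightarrow> nat \<Rightarrow> 'a list set \<Rightarrow> int" where
  "sc_perm Fq n C = Min (state_complexity Fq n ` perm_class n C)"

definition wC :: "'a set \<Rightarrow> nat \<Rightarrow> 'a list set \<Rightarrow> nat" where
  "wC Fq n C = min (fdim Fq C) (n - fdim Fq C)"

end

theory Submission
  imports Defs "HOL-Library.FuncSet"
begin

text \<open>
  Order the \<open>n\<close> points as \<open>Q\<^sub>1, \<dots>, Q\<^sub>n\<close> and write \<open>m = deg G\<close>. If \<open>m < n\<close>, a function in \<open>L(G)\<close>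
  is determined by its values at the points, so the past and future subcodes at time \<open>i\<close> are
  copies of \<open>L(G - Q\<^bsub>i+1\<^esub> - \<dots> - Q\<^sub>n)\<close> and \<open>L(G - Q\<^sub>1 - \<dots> - Q\<^sub>i)\<close>. These divisors have
  degrees \<open>m - n + i\<close> and \<open>m - i\<close> with sum \<open>2m - n\<close>, and the dimension of \<open>L(A)\<close> is at most
  the value of \<open>ell_tilde\<close> at \<open>deg A\<close>; choosing \<open>i\<close> from a pair \<open>(a, b)\<close> that attains the minimum
  in \<open>R(2m - n)\<close> gives the bound for every ordering. The case \<open>m \<ge> n\<close> cannot occur: Riemann's
  inequality and \<open>ell (G - D) \<le> m - n + 1\<close> would give \<open>k \<ge> n - g > n / 2\<close>.

  The facts about the function field that this needs (\<open>deg A < 0\<close> implies \<open>L(A) = 0\<close>, and \<open>genus\<close>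
  is a finite supremum) follow from two estimates for a nonconstant \<open>x\<close>. Let \<open>d\<close> be the maximal
  number of elements that are linearly independent over \<open>Fq[x]\<close>; it is finite by a pigeonhole
  count over the finite field. Reducing modulo \<open>1/x\<close> the semilocal ring of any finite set of poles of
  \<open>x\<close> shows that the pole divisor \<open>B\<close> of \<open>x\<close> has degree at most \<open>d\<close>, and an integral basis shows
  \<open>ell (r B + C) \<ge> d (r + 1)\<close> for a fixed \<open>C\<close> and all \<open>r\<close>.
\<close>

text \<open>Dimensions and residue degrees are defined through cardinalities
  (\<open>THE d. card S = q ^ d\<close>), and genus and gonality through SUP and INF, so they mean
  something only once the sets are known to be finite, bounded and nonempty. Hence the basic theory
  is rebuilt by counting: quotients are replaced by sets of representatives, kernels by fibres,
  ranks by exponents of \<open>q\<close>. One mechanism is used three times. If a subspace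
  \<open>V\<close> is stable under multiplication by 1/x, then V/(1/x)V has dimension at most the
  number of elements independent over Fq[x]. Taken for a valuation ring, it makes residue fields
  finite; for a semilocal ring, it bounds the pole degree; for a valuation ring obtained from Zorn's
  lemma, it bounds chains of principal ideals and so makes the valuation discrete. The last case is
  unavoidable: L(0) = Fq requires a nonconstant function to have a pole, and places here are
  discrete valuations by definition. The two estimates for the pole divisor are then played against
  each other as r grows, which gives deg B = d exactly. Since \<open>x\<close> and 1/x have the same
  d, principal divisors have degree 0.\<close>

text \<open>Places carry the convention v 0 = 0, under which \<open>n \<le> v x\<close> fails for x
  = 0 and positive n. Giving 0 infinite order makes each set {x. vge v x n} closed under
  addition.\<close>

definition vge :: "('K::field \<Rightarrow> int) \<Rightarrow> 'K \<Rightarrow> int \<Rightarrow> bool" where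
  "vge v x n \<longleftrightarrow> x = 0 \<or> n \<le> v x"

lemma vge_0 [simp]: "vge v 0 n" by (simp add: vge_def)

lemma vge_mono: "vge v x n \<Longrightarrow> m \<le> n \<Longrightarrow> vge v x m" by (auto simp: vge_def)

lemma vge_self: "vge v x (v x)" by (simp add: vge_def)

section \<open>The constant field and polynomials over it\<close>

locale curve =
  fixes Fq :: "'K::field set"
  assumes ff: "function_field Fq"
begin

abbreviation q :: nat where "q \<equiv> card Fq"

lemma subfield_Fq: "subfield Fq" and finite_Fq [simp]: "finite Fq"
  using ff by (auto simp: function_field_def)

lemma Fq_0 [simp]: "0 \<in> Fq" and Fq_1 [simp]: "1 \<in> Fq"
  and Fq_add: "a \<in> Fq \<Longrightarrow> b \<in> Fq \<Longrightarrow> a + b \<in> Fq"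
  and Fq_diff: "a \<in> Fq \<Longrightarrow> b \<in> Fq \<Longrightarrow> a - b \<in> Fq"
  and Fq_mult: "a \<in> Fq \<Longrightarrow> b \<in> Fq \<Longrightarrow> a * b \<in> Fq"
  and Fq_inverse: "a \<in> Fq \<Longrightarrow> inverse a \<in> Fq"
  using subfield_Fq by (auto simp: subfield_def)

lemma Fq_uminus: "a \<in> Fq \<Longrightarrow> - a \<in> Fq"
  using Fq_diff[of 0 a] by simp

lemma Fq_sum: "(\<And>i. i \<in> I \<Longrightarrow> f i \<in> Fq) \<Longrightarrow> sum f I \<in> Fq"
  by (induction I rule: infinite_finite_induct) (auto intro: Fq_add)

lemma q_ge_2: "q \<ge> 2"
proof -
  have "card {0, 1 :: 'K} \<le> q" by (rule card_mono) auto
  thus ?thesis by simp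
qed

lemma fdim_eqI: "card S = q ^ d \<Longrightarrow> fdim Fq S = d"
  unfolding fdim_def using q_ge_2 by (auto intro!: the_equality)

lemma poly_over_0 [simp]: "poly_over Fq 0" and poly_over_1 [simp]: "poly_over Fq 1"
  by (auto simp: poly_over_def coeff_1)

lemma poly_over_diff: "poly_over Fq p \<Longrightarrow> poly_over Fq r \<Longrightarrow> poly_over Fq (p - r)"
  by (auto simp: poly_over_def Fq_diff)

lemma poly_over_add: "poly_over Fq p \<Longrightarrow> poly_over Fq r \<Longrightarrow> poly_over Fq (p + r)"
  by (auto simp: poly_over_def Fq_add)

lemma poly_over_mult: "poly_over Fq p \<Longrightarrow> poly_over Fq r \<Longrightarrow> poly_over Fq (p * r)"
  by (auto simp: poly_over_def coeff_mult intro!: Fq_sum Fq_mult)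

lemma poly_over_monom: "c \<in> Fq \<Longrightarrow> poly_over Fq (monom c n)"
  by (auto simp: poly_over_def)

lemma poly_over_pCons: "poly_over Fq (pCons a p) \<longleftrightarrow> a \<in> Fq \<and> poly_over Fq p"
  by (auto simp: poly_over_def coeff_pCons split: nat.splits)

lemma transcendental:
  assumes "x \<notin> Fq" "poly_over Fq p" "p \<noteq> 0"
  shows "poly p x \<noteq> 0"
  using assms ff by (auto simp: function_field_def algebraic_over_def)

subsection \<open>Subspaces over the constant field\<close>

definition lsub :: "'K set \<Rightarrow> bool" where
  "lsub S \<longleftrightarrow> 0 \<in> S \<and> (\<forall>a\<in>S. \<forall>b\<in>S. a + b \<in> S) \<and> (\<forall>c\<in>Fq. \<forall>a\<in>S. c * a \<in> S)"

lemma lsub_0: "lsub S \<Longrightarrow> 0 \<in> S"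
  and lsub_add: "lsub S \<Longrightarrow> a \<in> S \<Longrightarrow> b \<in> S \<Longrightarrow> a + b \<in> S"
  and lsub_scale: "lsub S \<Longrightarrow> c \<in> Fq \<Longrightarrow> a \<in> S \<Longrightarrow> c * a \<in> S"
  by (auto simp: lsub_def)

lemma lsub_uminus: "lsub S \<Longrightarrow> a \<in> S \<Longrightarrow> - a \<in> S"
  using lsub_scale[of S "-1" a] Fq_uminus[of 1] by simp

lemma lsub_diff: "lsub S \<Longrightarrow> a \<in> S \<Longrightarrow> b \<in> S \<Longrightarrow> a - b \<in> S"
  using lsub_add[of S a "- b"] lsub_uminus[of S b] by simp

lemma lsub_sum: "lsub S \<Longrightarrow> (\<And>i. i \<in> I \<Longrightarrow> f i \<in> S) \<Longrightarrow> sum f I \<in> S"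
  by (induction I rule: infinite_finite_induct) (auto intro: lsub_add lsub_0)

text \<open>Linear independence in the quotient by \<open>N\<close>, without a quotient type;
  \<open>N = {0}\<close> gives ordinary independence.\<close>

definition indep_mod :: "'K set \<Rightarrow> (nat \<Rightarrow> 'K) \<Rightarrow> nat \<Rightarrow> bool" where
  "indep_mod N w d \<longleftrightarrow> (\<forall>c. (\<forall>i<d. c i \<in> Fq) \<longrightarrow> (\<Sum>i<d. c i * w i) \<in> N \<longrightarrow> (\<forall>i<d. c i = 0))"

lemma indep_modD:
  "indep_mod N w d \<Longrightarrow> (\<And>i. i < d \<Longrightarrow> c i \<in> Fq) \<Longrightarrow> (\<Sum>i<d. c i * w i) \<in> N \<Longrightarrow> i < d \<Longrightarrow> c i = 0"
  by (auto simp: indep_mod_def)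

lemma indep_mod_inj:
  assumes "indep_mod N w d" and c: "c \<in> PiE {..<d} (\<lambda>_. Fq)" and c': "c' \<in> PiE {..<d} (\<lambda>_. Fq)"
    and "(\<Sum>i<d. c i * w i) - (\<Sum>i<d. c' i * w i) \<in> N"
  shows "c = c'"
proof (rule PiE_ext[OF c c'])
  fix i assume "i \<in> {..<d}"
  have "(\<Sum>i<d. (c i - c' i) * w i) \<in> N"
    using assms(4) by (simp add: algebra_simps sum_subtractf)
  moreover have "\<And>i. i < d \<Longrightarrow> c i - c' i \<in> Fq" using c c' by (auto intro!: Fq_diff)
  ultimately have "c i - c' i = 0"
    using indep_modD[OF assms(1), of "\<lambda>i. c i - c' i" i] \<open>i \<in> {..<d}\<close> by simp
  thus "c i = c' i" by simp
qed

text \<open>For the least length at which no family is independent modulo \<open>N\<close>, a family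
  one shorter can be independent; adding any further \<open>v\<close> makes it dependent, and the
  coefficient of \<open>v\<close> cannot vanish, so \<open>v\<close> can be solved for.\<close>

lemma ex_basis_mod:
  assumes V: "lsub V" and N: "lsub N"
    and bound: "\<And>w. (\<And>i. i < M \<Longrightarrow> w i \<in> V) \<Longrightarrow> \<not> indep_mod N w M"
  obtains d w where "d < M" "\<And>i. i < d \<Longrightarrow> w i \<in> V" "indep_mod N w d"
    "\<And>v. v \<in> V \<Longrightarrow> \<exists>c. (\<forall>i<d. c i \<in> Fq) \<and> v - (\<Sum>i<d. c i * w i) \<in> N"
proof -
  define Q where "Q M \<longleftrightarrow> (\<forall>w. (\<forall>i<M. w i \<in> V) \<longrightarrow> \<not> indep_mod N w M)" for M
  define M' where "M' = (LEAST M. Q M)"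
  have QM: "Q M" using bound by (auto simp: Q_def)
  have Q': "Q M'" unfolding M'_def by (rule LeastI) (rule QM)
  have le: "M' \<le> M" unfolding M'_def by (rule Least_le) (rule QM)
  have "\<not> Q 0" by (auto simp: Q_def indep_mod_def)
  then obtain d where d: "M' = Suc d" using Q' by (cases M') auto
  have "\<not> Q d" using not_less_Least[of d Q] d by (auto simp: M'_def)
  then obtain w where w: "\<forall>i<d. w i \<in> V" "indep_mod N w d" by (auto simp: Q_def)
  have "\<exists>c. (\<forall>i<d. c i \<in> Fq) \<and> v - (\<Sum>i<d. c i * w i) \<in> N" if v: "v \<in> V" for v
  proof -
    have "\<not> indep_mod N (w(d := v)) (Suc d)"
      using Q' d w v by (auto simp: Q_def less_Suc_eq)
    then obtain c where c: "\<forall>i<Suc d. c i \<in> Fq" "(\<Sum>i<Suc d. c i * (w(d := v)) i) \<in> N"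
        "\<not> (\<forall>i<Suc d. c i = 0)"
      unfolding indep_mod_def by blast
    have eq: "(\<Sum>i<Suc d. c i * (w(d := v)) i) = (\<Sum>i<d. c i * w i) + c d * v" by simp
    have cd: "c d \<noteq> 0"
    proof
      assume "c d = 0"
      with eq c have "(\<Sum>i<d. c i * w i) \<in> N" by simp
      hence "\<forall>i<d. c i = 0" using w(2) c(1) by (auto simp: indep_mod_def)
      thus False using c(3) \<open>c d = 0\<close> by (auto simp: less_Suc_eq)
    qed
    define e where "e i = - (inverse (c d) * c i)" for i
    have "inverse (c d) * ((\<Sum>i<d. c i * w i) + c d * v) \<in> N"
      using lsub_scale[OF N Fq_inverse c(2)] c(1) eq by simp
    also have "inverse (c d) * ((\<Sum>i<d. c i * w i) + c d * v) = v - (\<Sum>i<d. e i * w i)"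
      using cd by (simp add: e_def algebra_simps sum_negf sum_distrib_left)
    finally show ?thesis using c(1)
      by (intro exI[of _ e]) (auto simp: e_def intro!: Fq_uminus Fq_mult Fq_inverse)
  qed
  thus ?thesis using that[of d w] w d le by auto
qed

text \<open>A transversal of \<open>V\<close> modulo \<open>N\<close>. Its cardinality stands for
  the order of the quotient.\<close>

definition rep_set :: "'K set \<Rightarrow> 'K set \<Rightarrow> 'K set \<Rightarrow> bool" where
  "rep_set V N R \<longleftrightarrow> R \<subseteq> V \<and> finite R \<and> (\<forall>r\<in>R. \<forall>r'\<in>R. r - r' \<in> N \<longrightarrow> r = r') \<and>
     (\<forall>v\<in>V. \<exists>r\<in>R. v - r \<in> N)"

lemma ex_rep_set:
  assumes V: "lsub V" and N: "lsub N"
    and bound: "\<And>w. (\<And>i. i < M \<Longrightarrow> w i \<in> V) \<Longrightarrow> \<not> indep_mod N w M"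
  shows "\<exists>d<M. \<exists>R. rep_set V N R \<and> card R = q ^ d"
proof -
  obtain d w where dw: "d < M" "\<And>i. i < d \<Longrightarrow> w i \<in> V" "indep_mod N w d"
    "\<And>v. v \<in> V \<Longrightarrow> \<exists>c. (\<forall>i<d. c i \<in> Fq) \<and> v - (\<Sum>i<d. c i * w i) \<in> N"
    using ex_basis_mod[OF V N bound] by metis
  define F where "F c = (\<Sum>i<d. c i * w i)" for c :: "nat \<Rightarrow> 'K"
  let ?C = "PiE {..<d} (\<lambda>_. Fq)"
  have inc: "c = c'" if "c \<in> ?C" "c' \<in> ?C" "F c - F c' \<in> N" for c c'
    using indep_mod_inj[OF dw(3) that(1,2)] that(3) by (simp add: F_def)
  have inj: "inj_on F ?C" by (rule inj_onI) (use inc lsub_0[OF N] in auto)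
  have "rep_set V N (F ` ?C)" unfolding rep_set_def
  proof (intro conjI ballI impI)
    show "F ` ?C \<subseteq> V" using dw(2) by (auto simp: F_def intro!: lsub_sum[OF V] lsub_scale[OF V])
    show "finite (F ` ?C)" by (auto intro!: finite_PiE)
    show "r = r'" if "r \<in> F ` ?C" "r' \<in> F ` ?C" "r - r' \<in> N" for r r'
      using that inc by blast
    show "\<exists>r\<in>F ` ?C. v - r \<in> N" if v: "v \<in> V" for v
    proof -
      obtain c where c: "\<forall>i<d. c i \<in> Fq" "v - F c \<in> N" using dw(4)[OF v] by (auto simp: F_def)
      have "F (restrict c {..<d}) = F c" by (auto simp: F_def)
      moreover have "restrict c {..<d} \<in> ?C" using c by auto
      ultimately show ?thesis using c(2) by (metis imageI)
    qed
  qed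
  moreover have "card (F ` ?C) = q ^ d" by (simp add: card_image[OF inj] card_PiE)
  ultimately show ?thesis using dw(1) by blast
qed

lemma rep_set_card_le:
  assumes N: "lsub N" and R: "rep_set V N R" and "Z \<subseteq> V"
    and inc: "\<And>z z'. z \<in> Z \<Longrightarrow> z' \<in> Z \<Longrightarrow> z - z' \<in> N \<Longrightarrow> z = z'"
  shows "finite Z" "card Z \<le> card R"
proof -
  have "\<forall>z\<in>Z. \<exists>r\<in>R. z - r \<in> N" using R \<open>Z \<subseteq> V\<close> by (auto simp: rep_set_def)
  then obtain f where f: "\<And>z. z \<in> Z \<Longrightarrow> f z \<in> R" "\<And>z. z \<in> Z \<Longrightarrow> z - f z \<in> N" by metis
  have inj: "inj_on f Z"
  proof (rule inj_onI)
    fix z z' assume "z \<in> Z" "z' \<in> Z" "f z = f z'"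
    thus "z = z'" using inc lsub_diff[OF N f(2)[of z] f(2)[of z']] by simp
  qed
  have fin: "finite R" and sub: "f ` Z \<subseteq> R" using R f by (auto simp: rep_set_def)
  show "finite Z" using inj_on_finite[OF inj sub fin] .
  show "card Z \<le> card R" using card_inj_on_le[OF inj sub fin] .
qed

text \<open>An independent family of length |S| would yield q^|S| > |S| elements of S. This supplies
  the exponent that \<open>fdim\<close> describes.\<close>

lemma finite_lsub_card:
  assumes S: "lsub S" and fin: "finite S"
  obtains d where "card S = q ^ d"
proof -
  have N: "lsub {0}" by (auto simp: lsub_def)
  have "\<not> indep_mod {0} w (card S)" if w: "\<And>i. i < card S \<Longrightarrow> w i \<in> S" for w
  proof
    assume ind: "indep_mod {0} w (card S)"
    let ?n = "card S"
    let ?C = "PiE {..<?n} (\<lambda>_. Fq)"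
    define F where "F c = (\<Sum>i<?n. c i * w i)" for c :: "nat \<Rightarrow> 'K"
    have "inj_on F ?C"
      by (rule inj_onI, rule indep_mod_inj[OF ind]) (simp_all add: F_def)
    moreover have "F ` ?C \<subseteq> S" using w by (auto simp: F_def intro!: lsub_sum[OF S] lsub_scale[OF S])
    ultimately have "card ?C \<le> ?n" using card_inj_on_le fin by blast
    hence "q ^ ?n \<le> ?n" by (simp add: card_PiE)
    moreover have "?n < 2 ^ ?n" by simp
    moreover have "(2::nat) ^ ?n \<le> q ^ ?n" using q_ge_2 by (intro power_mono) auto
    ultimately show False by linarith
  qed
  then obtain d R where R: "rep_set S {0} R" "card R = q ^ d"
    using ex_rep_set[OF S N] by metis
  have "R = S" using R(1) by (fastforce simp: rep_set_def)
  thus ?thesis using that R by blast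
qed

subsection \<open>Linear dependence over polynomial rings\<close>

lemma poly_altdef_le: "degree p \<le> r \<Longrightarrow> poly p (t :: 'K) = (\<Sum>i\<le>r. coeff p i * t ^ i)"
  unfolding poly_altdef by (rule sum.mono_neutral_left) (auto simp: coeff_eq_0)

text \<open>Degree less than \<open>s\<close>, phrased by coefficients so that the zero polynomial
  and s = 0 need no exception and the cardinality is exactly q^s.\<close>

definition polys_lt :: "nat \<Rightarrow> 'K poly set" where
  "polys_lt s = {p. poly_over Fq p \<and> (\<forall>i\<ge>s. coeff p i = 0)}"

lemma polys_lt_Suc: "polys_lt (Suc s) = (\<lambda>(a, p). pCons a p) ` (Fq \<times> polys_lt s)"
proof (intro equalityI subsetI)
  fix p assume p: "p \<in> polys_lt (Suc s)"
  obtain a r where ar: "p = pCons a r" by (cases p)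
  have "coeff r i = 0" if "i \<ge> s" for i
    using p that coeff_pCons_Suc[of a r i] by (auto simp: polys_lt_def ar)
  thus "p \<in> (\<lambda>(a, p). pCons a p) ` (Fq \<times> polys_lt s)"
    using p by (auto simp: ar polys_lt_def poly_over_pCons)
qed (auto simp: polys_lt_def poly_over_pCons coeff_pCons split: nat.splits)

lemma card_polys_lt: "finite (polys_lt s) \<and> card (polys_lt s) = q ^ s"
proof (induction s)
  case 0
  have "polys_lt 0 = {0}" by (auto simp: polys_lt_def poly_eq_iff)
  thus ?case by simp
next
  case (Suc s)
  have "inj_on (\<lambda>(a, p). pCons a p) (Fq \<times> polys_lt s)" by (auto simp: inj_on_def)
  thus ?case using Suc by (simp add: polys_lt_Suc card_image card_cartesian_product)
qed

lemma polys_lt_mono: "s \<le> s' \<Longrightarrow> polys_lt s \<subseteq> polys_lt s'"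
  by (auto simp: polys_lt_def)

lemma polys_lt_mult:
  assumes "p \<in> polys_lt s" "r \<in> polys_lt (Suc d)"
  shows "p * r \<in> polys_lt (s + d)"
proof -
  have "coeff p j * coeff r (i - j) = 0" if "i \<ge> s + d" "j \<le> i" for i j
    using assms that by (cases "j \<ge> s") (auto simp: polys_lt_def)
  thus ?thesis using assms
    by (auto simp: polys_lt_def poly_over_mult coeff_mult intro!: sum.neutral)
qed

lemma poly_over_polys_lt: "poly_over Fq p \<Longrightarrow> p \<in> polys_lt (Suc (degree p))"
  by (auto simp: polys_lt_def coeff_eq_0)

text \<open>The finite target of the pigeonhole argument: the Fq-span of x^i b_j with i < s, which
  grows by at most a factor q^n when s increases by one.\<close>

definition polyspan :: "'K \<Rightarrow> (nat \<Rightarrow> 'K) \<Rightarrow> nat \<Rightarrow> nat \<Rightarrow> 'K set" where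
  "polyspan x b n s = {(\<Sum>j<n. poly (p j) x * b j) | p. \<forall>j<n. p j \<in> polys_lt s}"

lemma polyspanI:
  "(\<And>j. j < n \<Longrightarrow> p j \<in> polys_lt s) \<Longrightarrow> (\<Sum>j<n. poly (p j) x * b j) \<in> polyspan x b n s"
  by (auto simp: polyspan_def)

lemma polyspan_card: "finite (polyspan x b n s)" "card (polyspan x b n s) \<le> q ^ (n * s)"
proof -
  let ?C = "PiE {..<n} (\<lambda>_. polys_lt s)"
  let ?F = "\<lambda>p. \<Sum>j<n. poly (p j) x * b j"
  have sub: "polyspan x b n s \<subseteq> ?F ` ?C"
  proof
    fix w assume "w \<in> polyspan x b n s"
    then obtain p where p: "w = ?F p" "\<forall>j<n. p j \<in> polys_lt s" by (auto simp: polyspan_def)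
    have "w = ?F (restrict p {..<n})" using p by simp
    moreover have "restrict p {..<n} \<in> ?C" using p by auto
    ultimately show "w \<in> ?F ` ?C" by blast
  qed
  have fin: "finite ?C" using card_polys_lt by (auto intro!: finite_PiE)
  show "finite (polyspan x b n s)" using finite_subset[OF sub] fin by blast
  have "card (polyspan x b n s) \<le> card (?F ` ?C)" using sub fin by (intro card_mono) auto
  also have "\<dots> \<le> card ?C" using fin by (rule card_image_le)
  also have "\<dots> = q ^ (n * s)" using card_polys_lt by (simp add: card_PiE mult.commute flip: power_mult)
  finally show "card (polyspan x b n s) \<le> q ^ (n * s)" .
qed

lemma polyspan_mono: "s \<le> s' \<Longrightarrow> polyspan x b n s \<subseteq> polyspan x b n s'"
  using polys_lt_mono[of s s'] by (fastforce simp: polyspan_def)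

lemma polyspan_lsub: "lsub (polyspan x b n s)"
  unfolding lsub_def
proof (intro conjI ballI)
  show "0 \<in> polyspan x b n s"
    using polyspanI[of n "\<lambda>_. 0" s x b] by (simp add: polys_lt_def)
next
  fix v w assume "v \<in> polyspan x b n s" "w \<in> polyspan x b n s"
  then obtain p r where pr: "v = (\<Sum>j<n. poly (p j) x * b j)" "w = (\<Sum>j<n. poly (r j) x * b j)"
    "\<forall>j<n. p j \<in> polys_lt s" "\<forall>j<n. r j \<in> polys_lt s" by (auto simp: polyspan_def)
  have "v + w = (\<Sum>j<n. poly (p j + r j) x * b j)"
    by (simp add: pr algebra_simps sum.distrib)
  also have "\<dots> \<in> polyspan x b n s"
    using pr by (intro polyspanI) (auto simp: polys_lt_def poly_over_add)
  finally show "v + w \<in> polyspan x b n s" .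
next
  fix c v assume "c \<in> Fq" "v \<in> polyspan x b n s"
  then obtain p where p: "v = (\<Sum>j<n. poly (p j) x * b j)" "\<forall>j<n. p j \<in> polys_lt s"
    by (auto simp: polyspan_def)
  have "c * v = (\<Sum>j<n. poly (smult c (p j)) x * b j)"
    by (simp add: p sum_distrib_left mult_ac)
  also have "\<dots> \<in> polyspan x b n s"
    using p \<open>c \<in> Fq\<close> by (intro polyspanI) (auto simp: polys_lt_def poly_over_def Fq_mult)
  finally show "c * v \<in> polyspan x b n s" .
qed

lemma polyspan_mult:
  assumes "w \<in> polyspan x b n s" "r \<in> polys_lt (Suc d)"
  shows "poly r x * w \<in> polyspan x b n (s + d)"
proof -
  obtain p where p: "w = (\<Sum>j<n. poly (p j) x * b j)" "\<forall>j<n. p j \<in> polys_lt s"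
    using assms by (auto simp: polyspan_def)
  have "poly r x * w = (\<Sum>j<n. poly (p j * r) x * b j)"
    by (simp add: p sum_distrib_left mult_ac)
  also have "\<dots> \<in> polyspan x b n (s + d)"
    using p assms by (intro polyspanI polys_lt_mult) auto
  finally show ?thesis .
qed

lemma clear_denominators:
  assumes "set cs \<subseteq> rat_fun_field Fq x"
  shows "\<exists>D. poly_over Fq D \<and> poly D x \<noteq> 0 \<and> (\<forall>c\<in>set cs. \<exists>p. poly_over Fq p \<and> poly D x * c = poly p x)"
  using assms
proof (induction cs)
  case Nil
  show ?case by (intro exI[of _ 1]) auto
next
  case (Cons c cs)
  then obtain D where D: "poly_over Fq D" "poly D x \<noteq> 0"
    "\<forall>c\<in>set cs. \<exists>p. poly_over Fq p \<and> poly D x * c = poly p x" by auto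
  obtain p r where pr: "poly_over Fq p" "poly_over Fq r" "poly r x \<noteq> 0" "c = poly p x / poly r x"
    using Cons.prems by (auto simp: rat_fun_field_def)
  have "\<exists>p'. poly_over Fq p' \<and> poly (D * r) x * c' = poly p' x" if c': "c' \<in> set (c # cs)" for c'
  proof (cases "c' = c")
    case True
    thus ?thesis using pr D by (intro exI[of _ "D * p"]) (auto intro: poly_over_mult)
  next
    case False
    then obtain p' where "poly_over Fq p'" "poly D x * c' = poly p' x" using D c' by auto
    thus ?thesis using pr by (intro exI[of _ "r * p'"]) (auto intro: poly_over_mult)
  qed
  thus ?case using D pr by (intro exI[of _ "D * r"]) (auto intro: poly_over_mult)
qed

lemma ex_generators:
  obtains x b n where
    "\<forall>y. \<exists>D s. poly_over Fq D \<and> poly D x \<noteq> 0 \<and> poly D x * y \<in> polyspan x b n s"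
proof -
  obtain x bs where bs: "\<And>y. \<exists>cs. length cs = length bs \<and> set cs \<subseteq> rat_fun_field Fq x \<and>
      y = sum_list (map2 (*) cs bs)"
    using ff unfolding function_field_def finite_dim_over_def by blast
  have "\<exists>D s. poly_over Fq D \<and> poly D x \<noteq> 0 \<and> poly D x * y \<in> polyspan x ((!) bs) (length bs) s" for y
  proof -
    obtain cs where cs: "length cs = length bs" "set cs \<subseteq> rat_fun_field Fq x"
      "y = sum_list (map2 (*) cs bs)" using bs by blast
    obtain D where D: "poly_over Fq D" "poly D x \<noteq> 0"
      "\<forall>c\<in>set cs. \<exists>p. poly_over Fq p \<and> poly D x * c = poly p x"
      using clear_denominators[OF cs(2)] by blast
    have "\<forall>j<length bs. \<exists>p. poly_over Fq p \<and> poly D x * (cs ! j) = poly p x"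
      using D(3) cs(1) by auto
    then obtain p where p: "\<forall>j<length bs. poly_over Fq (p j) \<and> poly D x * (cs ! j) = poly (p j) x"
      by metis
    define s where "s = Suc (\<Sum>j<length bs. degree (p j))"
    have "p j \<in> polys_lt s" if "j < length bs" for j
    proof -
      have "degree (p j) \<le> (\<Sum>j<length bs. degree (p j))"
        using that by (intro member_le_sum) auto
      thus ?thesis using poly_over_polys_lt[of "p j"] p that polys_lt_mono[of "Suc (degree (p j))" s]
        by (auto simp: s_def)
    qed
    hence "(\<Sum>j<length bs. poly (p j) x * bs ! j) \<in> polyspan x ((!) bs) (length bs) s"
      by (rule polyspanI)
    moreover have "y = (\<Sum>j<length bs. cs ! j * bs ! j)"
      using cs(1) by (simp add: cs(3) sum_list_sum_nth atLeast0LessThan)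
    hence "poly D x * y = (\<Sum>j<length bs. poly D x * (cs ! j) * bs ! j)"
      by (simp add: sum_distrib_left mult.assoc)
    hence "poly D x * y = (\<Sum>j<length bs. poly (p j) x * bs ! j)"
      using p by simp
    ultimately show ?thesis using D by metis
  qed
  thus ?thesis using that[of x "(!) bs" "length bs"] by blast
qed

lemma common_denominator:
  fixes u :: "nat \<Rightarrow> 'K"
  assumes gen: "\<And>y. \<exists>D s. poly_over Fq D \<and> poly D x \<noteq> 0 \<and> poly D x * y \<in> polyspan x b n s"
  shows "\<exists>D s. poly_over Fq D \<and> poly D x \<noteq> 0 \<and> (\<forall>j<M. poly D x * u j \<in> polyspan x b n s)"
proof (induction M)
  case 0
  show ?case by (intro exI[of _ "1 :: 'K poly"]) simp
next
  case (Suc M)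
  then obtain D s where D: "poly_over Fq D" "poly D x \<noteq> 0" "\<forall>j<M. poly D x * u j \<in> polyspan x b n s"
    by blast
  obtain E s' where E: "poly_over Fq E" "poly E x \<noteq> 0" "poly E x * u M \<in> polyspan x b n s'"
    using gen by blast
  let ?s = "s + degree E + (s' + degree D)"
  have "poly (D * E) x * u j \<in> polyspan x b n ?s" if "j < Suc M" for j
  proof (cases "j = M")
    case True
    have "poly D x * (poly E x * u M) \<in> polyspan x b n (s' + degree D)"
      using E D by (intro polyspan_mult poly_over_polys_lt)
    from subsetD[OF polyspan_mono this, of ?s] show ?thesis by (simp add: True mult_ac)
  next
    case False
    hence "poly E x * (poly D x * u j) \<in> polyspan x b n (s + degree E)"
      using E D that by (intro polyspan_mult poly_over_polys_lt) auto
    from subsetD[OF polyspan_mono this, of ?s] show ?thesis by (simp add: mult_ac)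
  qed
  moreover have "poly_over Fq (D * E)" "poly (D * E) x \<noteq> 0" using D E by (auto intro: poly_over_mult)
  ultimately show ?case by blast
qed

text \<open>For \<open>t\<close> outside \<open>Fq\<close> this says that the function field has
  degree less than \<open>M\<close> over the rational subfield generated by \<open>t\<close>.
  Polynomial coefficients avoid denominators and can be counted.\<close>

definition Dep :: "'K \<Rightarrow> nat \<Rightarrow> bool" where
  "Dep t M \<longleftrightarrow> (\<forall>u. \<exists>p. (\<forall>j<M. poly_over Fq (p j)) \<and> (\<exists>j<M. p j \<noteq> 0) \<and>
      (\<Sum>j<M. poly (p j) t * u j) = 0)"

text \<open>With D a common denominator for the products t b_j, multiplication by D(x) t raises the
  degree bound of \<open>polyspan\<close> by a constant \<open>c\<close>. Hence, up to one fixed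
  factor, all sums of p_j(t) u_j with deg p_j at most r lie in a span of at most q^(n(s + cr))
  elements, while there are q^((r+1)M) tuples p. Once M > nc, large r forces a collision, whose
  difference is a relation.\<close>

lemma ex_Dep: "\<exists>M. Dep t M"
proof -
  obtain x b n where "\<forall>y. \<exists>D s. poly_over Fq D \<and> poly D x \<noteq> 0 \<and> poly D x * y \<in> polyspan x b n s"
    by (rule ex_generators)
  hence gen: "\<And>y. \<exists>D s. poly_over Fq D \<and> poly D x \<noteq> 0 \<and> poly D x * y \<in> polyspan x b n s"
    by blast
  let ?W = "polyspan x b n"
  obtain D c0 where D: "poly_over Fq D" "poly D x \<noteq> 0" "\<forall>j<n. poly D x * (t * b j) \<in> ?W c0"
    using common_denominator[OF gen, of n "\<lambda>j. t * b j"] by blast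
  define c where "c = c0 + degree D"
  let ?d = "poly D x"
  have stepD: "?d * w \<in> ?W (s + c)" if "w \<in> ?W s" for w s
    by (rule subsetD[OF polyspan_mono polyspan_mult[OF that poly_over_polys_lt[OF D(1)]]])
      (simp add: c_def)
  have stept: "?d * (t * w) \<in> ?W (s + c)" if w: "w \<in> ?W s" for w s
  proof -
    obtain p where p: "w = (\<Sum>j<n. poly (p j) x * b j)" "\<forall>j<n. p j \<in> polys_lt s"
      using w by (auto simp: polyspan_def)
    have "?d * (t * w) = (\<Sum>j<n. poly (p j) x * (?d * (t * b j)))"
      by (simp add: p sum_distrib_left mult_ac)
    also have "\<dots> \<in> ?W (c0 + s)"
    proof (rule lsub_sum[OF polyspan_lsub])
      fix j assume "j \<in> {..<n}"
      thus "poly (p j) x * (?d * (t * b j)) \<in> ?W (c0 + s)"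
        using D p polys_lt_mono[of s "Suc s"] by (intro polyspan_mult) auto
    qed
    also have "\<dots> \<subseteq> ?W (s + c)" by (rule polyspan_mono) (simp add: c_def)
    finally show ?thesis .
  qed
  have powD: "?d ^ r * w \<in> ?W (s + c * r)" if "w \<in> ?W s" for w s r
    using that
  proof (induction r)
    case (Suc r)
    show ?case using stepD[OF Suc.IH[OF Suc.prems]] by (simp add: mult_ac add_ac)
  qed simp
  have powt: "?d ^ r * (t ^ i * w) \<in> ?W (s + c * r)" if "w \<in> ?W s" "i \<le> r" for w s r i
    using that
  proof (induction r arbitrary: i)
    case (Suc r)
    show ?case
    proof (cases i)
      case 0
      thus ?thesis using powD[OF Suc.prems(1), of "Suc r"] by simp
    next
      case (Suc i')
      thus ?thesis using stept[OF Suc.IH[of i']] Suc.prems by (simp add: mult_ac add_ac)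
    qed
  qed simp
  \<comment> \<open>\<open>M\<close> depends only on \<open>t\<close> and the generators, not on the
    family \<open>u\<close>; the latter enters only through \<open>s\<close>, which \<open>r\<close>
    below absorbs.\<close>
  define M where "M = n * c + 1"
  have "\<exists>p. (\<forall>j<M. poly_over Fq (p j)) \<and> (\<exists>j<M. p j \<noteq> 0) \<and> (\<Sum>j<M. poly (p j) t * u j) = 0" for u
  proof -
    obtain E s where E: "poly_over Fq E" "poly E x \<noteq> 0" "\<forall>j<M. poly E x * u j \<in> ?W s"
      using common_denominator[OF gen] by blast
    \<comment> \<open>With this choice (r + 1)(nc + 1) exceeds n(s + cr) by nc + 1.\<close>
    define r where "r = n * s"
    let ?C = "PiE {..<M} (\<lambda>_. polys_lt (Suc r))"
    let ?F = "\<lambda>p. ?d ^ r * poly E x * (\<Sum>j<M. poly (p j) t * u j)"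
    have fin: "finite ?C" using card_polys_lt by (auto intro!: finite_PiE)
    have "?F p \<in> ?W (s + c * r)" if p: "p \<in> ?C" for p
    proof -
      have "poly (p j) t = (\<Sum>i\<le>r. coeff (p j) i * t ^ i)" if "j < M" for j
      proof -
        have "degree (p j) \<le> r"
        proof (rule degree_le, intro allI impI)
          fix i assume "r < i"
          thus "coeff (p j) i = 0" using p that by (auto simp: polys_lt_def PiE_def Pi_def)
        qed
        thus ?thesis by (rule poly_altdef_le)
      qed
      hence "?F p = (\<Sum>j<M. \<Sum>i\<le>r. coeff (p j) i * (?d ^ r * (t ^ i * (poly E x * u j))))"
        by (simp add: sum_distrib_left sum_distrib_right mult_ac)
      also have "\<dots> \<in> ?W (s + c * r)"
      proof (intro lsub_sum[OF polyspan_lsub])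
        fix j i assume ij: "j \<in> {..<M}" "i \<in> {..r}"
        have "?d ^ r * (t ^ i * (poly E x * u j)) \<in> ?W (s + c * r)" using E ij by (intro powt) auto
        moreover have "coeff (p j) i \<in> Fq"
          using p ij by (auto simp: polys_lt_def poly_over_def PiE_def Pi_def)
        ultimately show "coeff (p j) i * (?d ^ r * (t ^ i * (poly E x * u j))) \<in> ?W (s + c * r)"
          by (rule lsub_scale[OF polyspan_lsub, rotated])
      qed
      finally show ?thesis .
    qed
    hence "card (?F ` ?C) \<le> card (?W (s + c * r))" by (intro card_mono polyspan_card) auto
    also have "\<dots> \<le> q ^ (n * (s + c * r))" by (rule polyspan_card)
    also have "\<dots> < q ^ (Suc r * M)"
      using q_ge_2 by (intro power_strict_increasing) (auto simp: M_def r_def algebra_simps)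
    also have "\<dots> = card ?C"
      using card_polys_lt[of "Suc r"] by (simp add: card_PiE power_mult del: power_Suc mult_Suc)
    finally have "\<not> inj_on ?F ?C" using card_image by fastforce
    then obtain p p' where pp: "p \<in> ?C" "p' \<in> ?C" "p \<noteq> p'" "?F p = ?F p'"
      unfolding inj_on_def by blast
    have "(\<Sum>j<M. poly (p j) t * u j) = (\<Sum>j<M. poly (p' j) t * u j)"
      using pp(4) D(2) E(2) by simp
    hence "(\<Sum>j<M. poly (p j - p' j) t * u j) = 0"
      by (simp add: algebra_simps sum_subtractf)
    moreover have "\<exists>j<M. p j - p' j \<noteq> 0"
      using pp PiE_ext[OF pp(1,2)] by auto
    moreover have "\<forall>j<M. poly_over Fq (p j - p' j)"
      using pp by (auto simp: polys_lt_def PiE_def Pi_def intro!: poly_over_diff)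
    ultimately show ?thesis by (intro exI[of _ "\<lambda>j. p j - p' j"]) auto
  qed
  thus ?thesis by (auto simp: Dep_def)
qed

subsection \<open>Places and weak approximation\<close>

context
  fixes v :: "'K \<Rightarrow> int"
  assumes v: "is_place Fq v"
begin

lemma place_mult: "x \<noteq> 0 \<Longrightarrow> y \<noteq> 0 \<Longrightarrow> v (x * y) = v x + v y"
  using v by (auto simp: is_place_def)

lemma place_Fq: "c \<in> Fq \<Longrightarrow> v c = 0"
  using v by (cases "c = 0") (auto simp: is_place_def)

lemma place_power: "x \<noteq> 0 \<Longrightarrow> v (x ^ n) = int n * v x"
  by (induction n) (auto simp: place_Fq place_mult algebra_simps)

lemma place_uminus: "v (- x) = v x"
  using place_mult[of "-1" x] place_Fq[of "-1"] Fq_uminus[of 1] by (cases "x = 0") auto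

lemma place_inverse: "v (inverse x) = - v x"
  using place_mult[of x "inverse x"] place_Fq[of 1] place_Fq[of 0] by (cases "x = 0") auto

lemma place_surj: "\<exists>x. x \<noteq> 0 \<and> v x = n"
  using v by (auto simp: is_place_def)

lemma vge_add: "vge v x n \<Longrightarrow> vge v y n \<Longrightarrow> vge v (x + y) n"
proof -
  have "x \<noteq> 0 \<Longrightarrow> y \<noteq> 0 \<Longrightarrow> x + y \<noteq> 0 \<Longrightarrow> v (x + y) \<ge> min (v x) (v y)"
    using v by (auto simp: is_place_def)
  thus "vge v x n \<Longrightarrow> vge v y n \<Longrightarrow> vge v (x + y) n" by (fastforce simp: vge_def)
qed

lemma vge_mult: "vge v x m \<Longrightarrow> vge v y n \<Longrightarrow> vge v (x * y) (m + n)"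
  by (cases "x = 0 \<or> y = 0") (auto simp: vge_def place_mult)

lemma vge_uminus: "vge v x n \<Longrightarrow> vge v (- x) n"
  by (simp add: vge_def place_uminus)

lemma vge_diff: "vge v x n \<Longrightarrow> vge v y n \<Longrightarrow> vge v (x - y) n"
  using vge_add[of x n "- y"] vge_uminus[of y n] by simp

lemma vge_sum: "(\<And>i. i \<in> I \<Longrightarrow> vge v (f i) n) \<Longrightarrow> vge v (sum f I) n"
  by (induction I rule: infinite_finite_induct) (auto intro: vge_add)

lemma vge_Fq: "c \<in> Fq \<Longrightarrow> vge v c 0"
  by (simp add: vge_def place_Fq)

lemma vge_scale: "c \<in> Fq \<Longrightarrow> vge v x n \<Longrightarrow> vge v (c * x) n"
  using vge_mult[OF vge_Fq] by fastforce

lemma vge_power: "vge v x 0 \<Longrightarrow> vge v (x ^ n) 0"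
  by (induction n) (auto intro: vge_Fq dest: vge_mult)

lemma vge_poly: "poly_over Fq p \<Longrightarrow> vge v x 0 \<Longrightarrow> vge v (poly p x) 0"
  unfolding poly_altdef by (intro vge_sum vge_scale vge_power) (auto simp: poly_over_def)

lemma place_add_strict:
  assumes "x \<noteq> 0" "vge v y (v x + 1)"
  shows "x + y \<noteq> 0" "v (x + y) = v x"
proof -
  show nz: "x + y \<noteq> 0"
  proof
    assume "x + y = 0"
    hence "y = - x" by (simp add: eq_neg_iff_add_eq_0 add.commute)
    thus False using assms place_uminus[of x] by (auto simp: vge_def)
  qed
  have "vge v (x + y) (v x)"
    using assms by (intro vge_add vge_self) (auto intro: vge_mono)
  moreover have "\<not> vge v (x + y) (v x + 1)"
    using vge_diff[of "x + y" "v x + 1" y] assms by (auto simp: vge_def)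
  ultimately show "v (x + y) = v x" using nz by (auto simp: vge_def)
qed

lemma lsub_vge: "lsub {x. vge v x n}"
  by (auto simp: lsub_def intro: vge_add vge_scale)

end

text \<open>If nonnegative order at P implied nonnegative order at Q, elements of order 0 at P would
  have order 0 at Q. Dividing by powers of a uniformizer \<open>t\<close> of P gives Q = Q(t) P, and
  surjectivity of Q forces Q(t) = 1, so P = Q.\<close>

lemma place_separate:
  assumes P: "is_place Fq P" and Q: "is_place Fq Q" and "P \<noteq> Q"
  shows "\<exists>u. u \<noteq> 0 \<and> P u \<ge> 0 \<and> Q u < 0"
proof (rule ccontr)
  assume "\<not> ?thesis"
  hence ge: "Q u \<ge> 0" if "u \<noteq> 0" "P u \<ge> 0" for u using that by force
  have eq0: "Q u = 0" if "u \<noteq> 0" "P u = 0" for u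
    using ge[of u] ge[of "inverse u"] that by (auto simp: place_inverse[OF P] place_inverse[OF Q])
  obtain t where t: "t \<noteq> 0" "P t = 1" using place_surj[OF P] by blast
  have pos: "Q u = P u * Q t" if u: "u \<noteq> 0" "P u \<ge> 0" for u
  proof -
    have "Q (u * inverse (t ^ nat (P u))) = 0"
      using u t by (intro eq0) (auto simp: place_mult[OF P] place_inverse[OF P] place_power[OF P])
    thus ?thesis using u t by (simp add: place_mult[OF Q] place_inverse[OF Q] place_power[OF Q])
  qed
  have all: "Q u = P u * Q t" if u: "u \<noteq> 0" for u
    using pos[of u] pos[of "inverse u"] u
    by (cases "P u \<ge> 0") (auto simp: place_inverse[OF P] place_inverse[OF Q])
  obtain s where "s \<noteq> 0" "Q s = 1" using place_surj[OF Q] by blast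
  hence "P s * Q t = 1" using all by simp
  moreover have "Q t \<ge> 0" using ge t by auto
  ultimately have "Q t = 1" using zmult_eq_1_iff by auto
  hence "Q u = P u" for u
    using all[of u] place_Fq[OF P, of 0] place_Fq[OF Q, of 0] by (cases "u = 0") auto
  thus False using \<open>P \<noteq> Q\<close> by auto
qed

lemma place_separate_sign:
  assumes P: "is_place Fq P" and Q: "is_place Fq Q" and "P \<noteq> Q"
  shows "\<exists>z. z \<noteq> 0 \<and> P z > 0 \<and> Q z < 0"
proof -
  obtain u where u: "u \<noteq> 0" "P u \<ge> 0" "Q u < 0" using place_separate[OF P Q \<open>P \<noteq> Q\<close>] by blast
  obtain w where w: "w \<noteq> 0" "Q w \<ge> 0" "P w < 0" using place_separate[OF Q P] \<open>P \<noteq> Q\<close> by blast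
  show ?thesis using u w
    by (intro exI[of _ "u * inverse w"])
      (auto simp: place_mult[OF P] place_mult[OF Q] place_inverse[OF P] place_inverse[OF Q])
qed

lemma place_separate_many:
  assumes P: "is_place Fq P" and "finite S" "\<And>Q. Q \<in> S \<Longrightarrow> is_place Fq Q" "P \<notin> S"
  shows "\<exists>z. z \<noteq> 0 \<and> P z > 0 \<and> (\<forall>Q\<in>S. Q z < 0)"
  using assms(2-)
proof (induction S)
  case empty
  show ?case using place_surj[OF P, of 1] by auto
next
  case (insert Q S)
  then obtain y where y: "y \<noteq> 0" "P y > 0" "\<forall>Q\<in>S. Q y < 0" by auto
  have Q: "is_place Fq Q" using insert by auto
  show ?case
  proof (cases "Q y < 0")
    case True
    thus ?thesis using y by auto
  next
    case False
    obtain z where z: "z \<noteq> 0" "P z > 0" "Q z < 0"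
      using place_separate_sign[OF P Q] insert by auto
    \<comment> \<open>At each R in \<open>S\<close> the power z^k and \<open>y\<close> now have
      different orders, so nothing cancels: if R z < 0 then R (z^k) \<le> -k < R y, otherwise
      \<open>y\<close> dominates. At \<open>Q\<close> the power dominates because Q y \<ge> 0, and
      at \<open>P\<close> both summands have positive order.\<close>
    define k where "k = Suc (nat (\<Sum>R\<in>S. \<bar>R y\<bar>))"
    have k0: "k > 0" by (simp add: k_def)
    have Qz: "Q (z ^ k) < 0" using z k0 by (simp add: place_power[OF Q] mult_pos_neg)
    have "vge Q y (Q (z ^ k) + 1)" using False Qz by (auto simp: vge_def)
    hence 1: "z ^ k + y \<noteq> 0" "Q (z ^ k + y) < 0"
      using place_add_strict[OF Q, of "z ^ k" y] z Qz by auto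
    have "P (z ^ k) > 0" using z k0 by (simp add: place_power[OF P])
    hence "vge P (z ^ k + y) 1" using y by (intro vge_add[OF P]) (auto simp: vge_def)
    hence 2: "P (z ^ k + y) > 0" using 1 by (auto simp: vge_def)
    have 3: "R (z ^ k + y) < 0" if R: "R \<in> S" for R
    proof -
      have pl: "is_place Fq R" using insert R by auto
      have Ry: "R y < 0" using y R by auto
      have "\<bar>R y\<bar> \<le> (\<Sum>R\<in>S. \<bar>R y\<bar>)" using insert R by (intro member_le_sum) auto
      hence le: "\<bar>R y\<bar> < int k" by (simp add: k_def)
      have Rz: "R (z ^ k) = int k * R z" using z by (simp add: place_power[OF pl])
      show ?thesis
      proof (cases "R z < 0")
        case True
        have "int k * 1 \<le> int k * (- R z)" using True by (intro mult_left_mono) auto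
        hence "R (z ^ k) < R y" using le Ry Rz by linarith
        hence "vge R y (R (z ^ k) + 1)" by (auto simp: vge_def)
        thus ?thesis using place_add_strict[OF pl, of "z ^ k" y] z \<open>R (z ^ k) < R y\<close> Ry by auto
      next
        case False
        hence "vge R (z ^ k) (R y + 1)" using Ry Rz by (auto simp: vge_def intro: order_trans[of _ 0])
        thus ?thesis using place_add_strict[OF pl, of y "z ^ k"] y Ry by (simp add: add.commute)
      qed
    qed
    show ?thesis using 1 2 3 by (intro exI[of _ "z ^ k + y"]) auto
  qed
qed

text \<open>The witness is 1/(1 + z^(k+1)) for a \<open>z\<close> with a zero at P and poles
  throughout \<open>S\<close>: the power is negligible against 1 at P and dominates it on
  \<open>S\<close>.\<close>

lemma weak_approximation_one:
  assumes P: "is_place Fq P" and S: "finite S" "\<And>Q. Q \<in> S \<Longrightarrow> is_place Fq Q" "P \<notin> S"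
  shows "\<exists>w. vge P (w - 1) (int k) \<and> (\<forall>Q\<in>S. vge Q w (int k))"
proof -
  obtain z where z: "z \<noteq> 0" "P z > 0" "\<forall>Q\<in>S. Q z < 0"
    using place_separate_many[OF assms] by blast
  let ?m = "Suc k"
  let ?u = "1 + z ^ ?m"
  have Pz: "P (z ^ ?m) \<ge> int ?m"
  proof -
    have "int ?m * 1 \<le> int ?m * P z" using z by (intro mult_left_mono) auto
    thus ?thesis using z by (simp add: place_power[OF P] del: power_Suc of_nat_Suc)
  qed
  have "vge P (z ^ ?m) (P 1 + 1)" using Pz by (simp add: vge_def place_Fq[OF P])
  hence u: "?u \<noteq> 0" "P ?u = 0"
    using place_add_strict[OF P, of 1 "z ^ ?m"] place_Fq[OF P, of 1] by auto
  have "inverse ?u - 1 = - (z ^ ?m * inverse ?u)" using u by (simp add: field_simps del: power_Suc)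
  moreover have "P (z ^ ?m * inverse ?u) \<ge> int k"
    using Pz u z by (simp add: place_mult[OF P] place_inverse[OF P] del: power_Suc)
  ultimately have 1: "vge P (inverse ?u - 1) (int k)"
    by (simp add: vge_def place_uminus[OF P] del: power_Suc)
  have 2: "vge Q (inverse ?u) (int k)" if "Q \<in> S" for Q
  proof -
    have Q: "is_place Fq Q" using S that by auto
    have "int ?m * 1 \<le> int ?m * (- Q z)" using z that by (intro mult_left_mono) auto
    hence Qz: "Q (z ^ ?m) \<le> - int ?m" using z by (simp add: place_power[OF Q] del: power_Suc of_nat_Suc)
    hence "vge Q 1 (Q (z ^ ?m) + 1)" by (simp add: vge_def place_Fq[OF Q])
    hence "Q ?u = Q (z ^ ?m)"
      using place_add_strict[OF Q, of "z ^ ?m" 1] z by (simp add: add.commute del: power_Suc)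
    thus ?thesis using Qz by (simp add: vge_def place_inverse[OF Q] del: power_Suc)
  qed
  show ?thesis using 1 2 by blast
qed

lemma weak_approximation:
  fixes a :: "('K \<Rightarrow> int) \<Rightarrow> 'K"
  assumes S: "finite S" "\<And>P. P \<in> S \<Longrightarrow> is_place Fq P"
  shows "\<exists>z. \<forall>P\<in>S. vge P (z - a P) N"
proof -
  \<comment> \<open>The precision of the approximate idempotents w_Q must also make up for negative
    orders of every a_Q at every P, since the solution is the sum of the w_Q a_Q.\<close>
  define k where "k = nat (\<bar>N\<bar> + (\<Sum>P\<in>S. \<Sum>Q\<in>S. \<bar>P (a Q)\<bar>))"
  have k: "int k + P (a Q) \<ge> N" if "P \<in> S" "Q \<in> S" for P Q
  proof -
    have "\<bar>P (a Q)\<bar> \<le> (\<Sum>Q\<in>S. \<bar>P (a Q)\<bar>)" using S that by (intro member_le_sum) auto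
    also have "\<dots> \<le> (\<Sum>P\<in>S. \<Sum>Q\<in>S. \<bar>P (a Q)\<bar>)"
      using S that by (intro member_le_sum[of P S "\<lambda>P. \<Sum>Q\<in>S. \<bar>P (a Q)\<bar>"]) (auto intro: sum_nonneg)
    finally show ?thesis by (simp add: k_def)
  qed
  have "\<forall>P\<in>S. \<exists>w. vge P (w - 1) (int k) \<and> (\<forall>Q\<in>S - {P}. vge Q w (int k))"
    using S by (intro ballI weak_approximation_one) auto
  then obtain w where w: "\<And>P. P \<in> S \<Longrightarrow> vge P (w P - 1) (int k)"
    "\<And>P Q. P \<in> S \<Longrightarrow> Q \<in> S \<Longrightarrow> Q \<noteq> P \<Longrightarrow> vge Q (w P) (int k)"
    by (metis DiffI singletonD)
  have "vge P ((\<Sum>Q\<in>S. w Q * a Q) - a P) N" if P: "P \<in> S" for P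
  proof -
    have pl: "is_place Fq P" using S P by auto
    have "(\<Sum>Q\<in>S. w Q * a Q) - a P = (w P - 1) * a P + (\<Sum>Q\<in>S - {P}. w Q * a Q)"
      using S P by (simp add: sum.remove algebra_simps)
    moreover have "vge P ((w P - 1) * a P) N"
      using vge_mult[OF pl w(1)[OF P] vge_self[of P "a P"]] k[OF P P] by (rule vge_mono)
    moreover have "vge P (\<Sum>Q\<in>S - {P}. w Q * a Q) N"
    proof (rule vge_sum[OF pl])
      fix Q assume Q: "Q \<in> S - {P}"
      show "vge P (w Q * a Q) N"
        using vge_mult[OF pl w(2)[of Q P] vge_self[of P "a Q"]] k[of P Q] P Q
        by (auto intro: vge_mono)
    qed
    ultimately show ?thesis by (auto intro: vge_add[OF pl])
  qed
  thus ?thesis by blast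
qed

section \<open>Reduction modulo 1/x and residue fields\<close>

text \<open>Take a relation among the w_j over Fq[x] and divide it by x^s, where s is the highest
  exponent that occurs. The coefficients of x^s stay as constants, not all zero, and everything else
  is 1/x times an element of \<open>V\<close>, hence in \<open>N\<close>: the w_j are dependent
  modulo \<open>N\<close>.\<close>

lemma Dep_imp_not_indep_mod:
  assumes x: "x \<noteq> 0" and D: "Dep x M" and V: "lsub V" "\<And>a. a \<in> V \<Longrightarrow> inverse x * a \<in> V"
    and w: "\<And>i. i < M \<Longrightarrow> w i \<in> V" and N: "\<And>a. a \<in> V \<Longrightarrow> inverse x * a \<in> N"
  shows "\<not> indep_mod N w M"
proof
  assume ind: "indep_mod N w M"
  obtain p where p: "\<forall>j<M. poly_over Fq (p j)" "\<exists>j<M. p j \<noteq> 0" "(\<Sum>j<M. poly (p j) x * w j) = 0"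
    using D unfolding Dep_def by blast
  define Q where "Q i \<longleftrightarrow> (\<exists>j<M. coeff (p j) i \<noteq> 0)" for i
  obtain i0 where i0: "Q i0" using p(2) leading_coeff_0_iff by (metis Q_def)
  have bd: "i \<le> (\<Sum>j<M. degree (p j))" if "Q i" for i
  proof -
    obtain j where j: "j < M" "coeff (p j) i \<noteq> 0" using \<open>Q i\<close> by (auto simp: Q_def)
    hence "i \<le> degree (p j)" by (intro le_degree)
    also have "\<dots> \<le> (\<Sum>j<M. degree (p j))" using j by (intro member_le_sum) auto
    finally show ?thesis .
  qed
  define s where "s = (GREATEST i. Q i)"
  have s: "Q s" unfolding s_def using i0 bd by (rule GreatestI_nat)
  have le: "i \<le> s" if "Q i" for i unfolding s_def using that bd by (rule Greatest_le_nat)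
  let ?y = "inverse x"
  have deg: "degree (p j) \<le> s" if "j < M" for j
    using le that by (intro degree_le) (force simp: Q_def)
  \<comment> \<open>The terms of lower degree after division by x^s, with one factor 1/x taken out;
    stability of \<open>V\<close> under 1/x keeps \<open>h\<close> in \<open>V\<close>.\<close>
  define h where "h = (\<Sum>j<M. \<Sum>i<s. coeff (p j) i * (?y ^ (s - Suc i) * w j))"
  have pw: "?y ^ k * a \<in> V" if "a \<in> V" for k a
    using that by (induction k) (auto simp: V mult.assoc)
  have h: "h \<in> V" unfolding h_def
  proof (intro lsub_sum[OF V(1)])
    fix j i assume "j \<in> {..<M}"
    hence "coeff (p j) i \<in> Fq" "?y ^ (s - Suc i) * w j \<in> V" using p(1) w pw by (auto simp: poly_over_def)
    thus "coeff (p j) i * (?y ^ (s - Suc i) * w j) \<in> V" by (rule lsub_scale[OF V(1)])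
  qed
  have yx: "?y ^ s * x ^ i = ?y ^ (s - i)" if "i \<le> s" for i
    using x that by (simp add: power_diff power_inverse field_simps)
  have "?y ^ s * (poly (p j) x * w j) = coeff (p j) s * w j +
      ?y * (\<Sum>i<s. coeff (p j) i * (?y ^ (s - Suc i) * w j))" if j: "j < M" for j
  proof -
    have "?y ^ s * (poly (p j) x * w j) = (\<Sum>i\<le>s. coeff (p j) i * ((?y ^ s * x ^ i) * w j))"
      by (simp add: poly_altdef_le[OF deg[OF j]] sum_distrib_left sum_distrib_right mult_ac)
    also have "\<dots> = (\<Sum>i\<le>s. coeff (p j) i * (?y ^ (s - i) * w j))"
      by (intro sum.cong) (auto simp: yx)
    also have "\<dots> = coeff (p j) s * w j + (\<Sum>i<s. coeff (p j) i * (?y ^ (s - i) * w j))"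
      by (simp add: lessThan_Suc_atMost[symmetric] add.commute)
    also have "(\<Sum>i<s. coeff (p j) i * (?y ^ (s - i) * w j)) =
        (\<Sum>i<s. ?y * (coeff (p j) i * (?y ^ (s - Suc i) * w j)))"
    proof (intro sum.cong refl)
      fix i assume "i \<in> {..<s}"
      hence "s - i = Suc (s - Suc i)" by auto
      thus "coeff (p j) i * (?y ^ (s - i) * w j) = ?y * (coeff (p j) i * (?y ^ (s - Suc i) * w j))"
        by (simp add: mult_ac)
    qed
    finally show ?thesis by (simp add: sum_distrib_left)
  qed
  hence "(\<Sum>j<M. ?y ^ s * (poly (p j) x * w j)) = (\<Sum>j<M. coeff (p j) s * w j) + ?y * h"
    by (simp add: sum.distrib h_def sum_distrib_left)
  hence "(\<Sum>j<M. coeff (p j) s * w j) = ?y * (- h)"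
    using p(3) by (simp add: eq_neg_iff_add_eq_0 flip: sum_distrib_left)
  also have "\<dots> \<in> N" using N lsub_uminus[OF V(1) h] by blast
  finally have "\<forall>j<M. coeff (p j) s = 0"
    using indep_modD[OF ind, of "\<lambda>j. coeff (p j) s"] p(1) by (auto simp: poly_over_def)
  thus False using s by (auto simp: Q_def)
qed

text \<open>For an \<open>x\<close> of order -1, multiplication by 1/x maps the valuation ring into
  its maximal ideal, so the dependence bound for \<open>x\<close> bounds the residue dimension. This
  justifies the \<open>THE\<close> in \<open>deg_place\<close>.\<close>

lemma ex_residue_reps:
  assumes v: "is_place Fq v"
  shows "\<exists>R. rep_set {a. vge v a 0} {a. vge v a 1} R \<and> card R = q ^ deg_place Fq v"
proof -
  obtain x where x: "x \<noteq> 0" "v x = -1" using place_surj[OF v] by blast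
  obtain M where M: "Dep x M" using ex_Dep by blast
  have "\<not> indep_mod {a. vge v a 1} w M" if "\<And>i. i < M \<Longrightarrow> w i \<in> {a. vge v a 0}" for w
  proof (rule Dep_imp_not_indep_mod[OF x(1) M lsub_vge[OF v, of 0] _ that])
    fix a assume "a \<in> {a. vge v a 0}"
    hence "vge v (inverse x * a) (1 + 0)"
      by (intro vge_mult[OF v]) (auto simp: vge_def place_inverse[OF v] x)
    thus "inverse x * a \<in> {a. vge v a 1}" "inverse x * a \<in> {a. vge v a 0}"
      by (auto intro: vge_mono)
  qed auto
  then obtain d R where dR: "rep_set {a. vge v a 0} {a. vge v a 1} R" "card R = q ^ d"
    using ex_rep_set[OF lsub_vge[OF v, of 0] lsub_vge[OF v, of 1]] by blast
  hence R: "R \<subseteq> {a. vge v a 0}" "\<And>r r'. r \<in> R \<Longrightarrow> r' \<in> R \<Longrightarrow> vge v (r - r') 1 \<Longrightarrow> r = r'"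
    "\<And>a. vge v a 0 \<Longrightarrow> \<exists>r\<in>R. vge v (a - r) 1" by (auto simp: rep_set_def)
  have rel: "(a, b) \<in> res_rel v \<longleftrightarrow> vge v a 0 \<and> vge v b 0 \<and> vge v (a - b) 1" for a b
    by (auto simp: res_rel_def val_ring_def vge_def)
  have refl: "(a, a) \<in> res_rel v" if "vge v a 0" for a using that by (simp add: rel)
  have tr: "(a, c) \<in> res_rel v" if "(a, b) \<in> res_rel v" "(b, c) \<in> res_rel v" for a b c
    using that vge_add[OF v, of "a - b" 1 "b - c"] by (simp add: rel)
  have sy: "(b, a) \<in> res_rel v" if "(a, b) \<in> res_rel v" for a b
    using that vge_uminus[OF v, of "a - b" 1] by (simp add: rel)
  have "bij_betw (\<lambda>r. res_rel v `` {r}) R (val_ring v // res_rel v)"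
  proof (rule bij_betw_imageI)
    show "inj_on (\<lambda>r. res_rel v `` {r}) R"
    proof (rule inj_onI)
      fix r r' assume rr: "r \<in> R" "r' \<in> R" "res_rel v `` {r} = res_rel v `` {r'}"
      hence "(r, r') \<in> res_rel v" using refl[of r'] R(1) by auto
      thus "r = r'" using R(2) rr by (auto simp: rel)
    qed
    show "(\<lambda>r. res_rel v `` {r}) ` R = val_ring v // res_rel v"
    proof (intro equalityI subsetI)
      fix X assume "X \<in> (\<lambda>r. res_rel v `` {r}) ` R"
      thus "X \<in> val_ring v // res_rel v"
        using R(1) by (auto simp: val_ring_def vge_def intro!: quotientI)
    next
      fix X assume "X \<in> val_ring v // res_rel v"
      then obtain a where a: "a \<in> val_ring v" "X = res_rel v `` {a}" by (auto elim: quotientE)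
      hence a0: "vge v a 0" by (auto simp: val_ring_def vge_def)
      then obtain r where r: "r \<in> R" "vge v (a - r) 1" using R(3) by auto
      hence "(a, r) \<in> res_rel v" using a0 R(1) by (auto simp: rel)
      hence "X = res_rel v `` {r}" using tr sy unfolding a by blast
      thus "X \<in> (\<lambda>r. res_rel v `` {r}) ` R" using r by blast
    qed
  qed
  hence "card (val_ring v // res_rel v) = q ^ d" using dR(2) bij_betw_same_card by metis
  hence "deg_place Fq v = d" unfolding deg_place_def using q_ge_2 by (auto intro!: the_equality)
  thus ?thesis using dR by auto
qed

lemma deg_place_pos:
  assumes v: "is_place Fq v"
  shows "deg_place Fq v \<ge> 1"
proof (rule ccontr)
  assume "\<not> ?thesis"
  moreover obtain R where R: "rep_set {a. vge v a 0} {a. vge v a 1} R" "card R = q ^ deg_place Fq v"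
    using ex_residue_reps[OF v] by blast
  ultimately have "card R = 1" by (simp add: not_le)
  then obtain r where r: "R = {r}" by (rule card_1_singletonE)
  have "vge v (a - r) 1" if "vge v a 0" for a
    using R(1) r that by (auto simp: rep_set_def)
  from this[of 0] this[of 1] have "vge v (0 - r) 1" "vge v (1 - r) 1"
    using vge_Fq[OF v, of 1] by simp_all
  hence "vge v (1 - r - (0 - r)) 1" by (rule vge_diff[OF v, rotated])
  thus False by (simp add: vge_def place_Fq[OF v])
qed

subsection \<open>Poles and the degree of the field extension\<close>

text \<open>Truncated expansions in a uniformizer \<open>t\<close>: each induction step puts a new
  lowest digit \<open>s\<close> in front and shifts the old expansion to t * r.\<close>

lemma ex_power_reps:
  assumes v: "is_place Fq v"
  shows "\<exists>R. finite R \<and> card R = q ^ (e * deg_place Fq v) \<and> (\<forall>r\<in>R. vge v r 0) \<and>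
    (\<forall>r\<in>R. \<forall>r'\<in>R. vge v (r - r') (int e) \<longrightarrow> r = r')"
proof (induction e)
  case 0
  show ?case by (rule exI[of _ "{0}"]) auto
next
  case (Suc e)
  then obtain R where R: "finite R" "card R = q ^ (e * deg_place Fq v)" "\<forall>r\<in>R. vge v r 0"
    "\<forall>r\<in>R. \<forall>r'\<in>R. vge v (r - r') (int e) \<longrightarrow> r = r'" by blast
  obtain T where T: "rep_set {a. vge v a 0} {a. vge v a 1} T" "card T = q ^ deg_place Fq v"
    using ex_residue_reps[OF v] by blast
  obtain t where t: "t \<noteq> 0" "v t = 1" using place_surj[OF v] by blast
  let ?f = "\<lambda>(s, r). s + t * r"
  have tr: "vge v (t * a) 1" if "vge v a 0" for a
    using vge_mult[OF v vge_self[of v t] that] t by simp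
  have key: "s = s' \<and> r = r'"
    if "s \<in> T" "s' \<in> T" "r \<in> R" "r' \<in> R" "vge v (s + t * r - (s' + t * r')) (int (Suc e))" for s s' r r'
  proof -
    have "vge v (t * (r - r')) 1" using that R by (intro tr vge_diff[OF v]) auto
    moreover have "vge v (s + t * r - (s' + t * r')) 1" using that(5) by (rule vge_mono) simp
    ultimately have "vge v (s + t * r - (s' + t * r') - t * (r - r')) 1" by (rule vge_diff[OF v, rotated])
    hence "vge v (s - s') 1" by (simp add: algebra_simps)
    hence s: "s = s'" using T that by (auto simp: rep_set_def)
    hence "vge v (t * (r - r')) (int (Suc e))" using that(5) by (simp add: algebra_simps)
    hence "vge v (r - r') (int e)" using t by (cases "r = r'") (auto simp: vge_def place_mult[OF v])
    thus ?thesis using s R that by auto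
  qed
  have inj: "inj_on ?f (T \<times> R)"
  proof (rule inj_onI)
    fix a b assume ab: "a \<in> T \<times> R" "b \<in> T \<times> R" "?f a = ?f b"
    obtain s r s' r' where sr: "a = (s, r)" "b = (s', r')" by (cases a, cases b)
    show "a = b" using key[of s s' r r'] ab by (simp add: sr)
  qed
  have c1: "card (?f ` (T \<times> R)) = q ^ (Suc e * deg_place Fq v)"
    using card_image[OF inj] T(2) R(2) by (simp add: card_cartesian_product power_add)
  have c2: "vge v a 0" if a: "a \<in> ?f ` (T \<times> R)" for a
  proof -
    obtain s r where sr: "a = s + t * r" "s \<in> T" "r \<in> R" using a by auto
    have "vge v (t * r) 0" using tr[of r] R sr by (auto intro: vge_mono)
    moreover have "vge v s 0" using T sr by (auto simp: rep_set_def)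
    ultimately show ?thesis unfolding sr by (intro vge_add[OF v])
  qed
  have c3: "finite (?f ` (T \<times> R))" using T R by (auto simp: rep_set_def)
  have c4: "a = b" if ab: "a \<in> ?f ` (T \<times> R)" "b \<in> ?f ` (T \<times> R)" "vge v (a - b) (int (Suc e))" for a b
  proof -
    obtain s r s' r' where "a = s + t * r" "b = s' + t * r'" "s \<in> T" "r \<in> R" "s' \<in> T" "r' \<in> R"
      using ab(1,2) by auto
    thus ?thesis using key[of s s' r r'] ab(3) by simp
  qed
  show ?case
    by (intro exI[of _ "?f ` (T \<times> R)"] conjI ballI impI c3 c1 c2 c4)
qed

text \<open>\<open>V\<close> is the ring of functions regular on \<open>S\<close> and
  \<open>N\<close> consists of its multiples by 1/x. Weak approximation realizes every choice of
  residues modulo 1/x at the points of \<open>S\<close> by an element of \<open>V\<close>, so V/N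
  has at least q^(sum of pole orders times degrees) elements, while dependence over Fq[x] allows at
  most q^n.\<close>

lemma sum_poles_le:
  assumes x: "x \<noteq> 0" and D: "Dep x (Suc n)"
    and S: "finite S" "\<And>P. P \<in> S \<Longrightarrow> is_place Fq P" "\<And>P. P \<in> S \<Longrightarrow> P x < 0"
  shows "(\<Sum>P\<in>S. nat (- P x) * deg_place Fq P) \<le> n"
proof -
  define V where "V = {a. \<forall>P\<in>S. vge P a 0}"
  define N where "N = {a. \<forall>P\<in>S. vge P a (- P x)}"
  have V: "lsub V" and N: "lsub N"
    using S(2) by (auto simp: lsub_def V_def N_def intro: vge_add vge_scale)
  have xN: "inverse x * a \<in> N" if "a \<in> V" for a
    unfolding N_def
  proof (intro CollectI ballI)
    fix P assume P: "P \<in> S"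
    show "vge P (inverse x * a) (- P x)"
      using vge_mult[OF S(2)[OF P] vge_self[of P "inverse x"], of a 0] that P
      by (simp add: V_def place_inverse[OF S(2)[OF P]])
  qed
  have "N \<subseteq> V"
    using S(3) by (fastforce simp: N_def V_def vge_def)
  hence xV: "inverse x * a \<in> V" if "a \<in> V" for a using xN that by blast
  have "\<not> indep_mod N w (Suc n)" if w: "\<And>i. i < Suc n \<Longrightarrow> w i \<in> V" for w
    by (rule Dep_imp_not_indep_mod[OF x D V]) (fact xV w xN)+
  then obtain d R where R: "d < Suc n" "rep_set V N R" "card R = q ^ d"
    using ex_rep_set[OF V N] by blast
  have "\<forall>P\<in>S. \<exists>R. finite R \<and> card R = q ^ (nat (- P x) * deg_place Fq P) \<and> (\<forall>r\<in>R. vge P r 0) \<and>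
    (\<forall>r\<in>R. \<forall>r'\<in>R. vge P (r - r') (int (nat (- P x))) \<longrightarrow> r = r')"
    using ex_power_reps S(2) by blast
  then obtain T where "\<forall>P\<in>S. finite (T P) \<and> card (T P) = q ^ (nat (- P x) * deg_place Fq P) \<and>
     (\<forall>r\<in>T P. vge P r 0) \<and> (\<forall>r\<in>T P. \<forall>r'\<in>T P. vge P (r - r') (int (nat (- P x))) \<longrightarrow> r = r')"
    by metis
  hence T: "finite (T P)" "card (T P) = q ^ (nat (- P x) * deg_place Fq P)"
     "\<And>r. r \<in> T P \<Longrightarrow> vge P r 0" "\<And>r r'. r \<in> T P \<Longrightarrow> r' \<in> T P \<Longrightarrow> vge P (r - r') (- P x) \<Longrightarrow> r = r'"
     if "P \<in> S" for P using that S(3)[of P] by auto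
  \<comment> \<open>One precision for all points: the sum of the pole orders is at least each of
    them.\<close>
  define B where "B = (\<Sum>P\<in>S. - P x)"
  have B: "- P x \<le> B" if "P \<in> S" for P
    unfolding B_def using S that by (intro member_le_sum[of P S "\<lambda>P. - P x"]) (auto intro: less_imp_le)
  have "\<forall>\<phi>. \<exists>z. \<forall>P\<in>S. vge P (z - \<phi> P) B" using weak_approximation S by blast
  then obtain z where z: "\<And>\<phi> P. P \<in> S \<Longrightarrow> vge P (z \<phi> - \<phi> P) B" by metis
  hence z': "vge P (z \<phi> - \<phi> P) (- P x)" if "P \<in> S" for \<phi> P using B that by (auto intro: vge_mono)
  let ?C = "PiE S T"
  have inc: "\<phi> = \<psi>" if "\<phi> \<in> ?C" "\<psi> \<in> ?C" "z \<phi> - z \<psi> \<in> N" for \<phi> \<psi>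
  proof (rule PiE_ext[OF that(1,2)])
    fix P assume P: "P \<in> S"
    have "vge P (z \<phi> - z \<psi> - ((z \<phi> - \<phi> P) - (z \<psi> - \<psi> P))) (- P x)"
      using that(3) P by (intro vge_diff[OF S(2)[OF P], of "z \<phi> - z \<psi>"] vge_diff[OF S(2)[OF P] z' z'])
        (auto simp: N_def)
    hence "vge P (\<phi> P - \<psi> P) (- P x)" by (simp add: algebra_simps)
    thus "\<phi> P = \<psi> P" using T(4)[OF P] that P by (auto simp: PiE_def Pi_def)
  qed
  have inj: "inj_on z ?C" by (rule inj_onI) (use inc lsub_0[OF N] in auto)
  have "z ` ?C \<subseteq> V" unfolding V_def
  proof (intro subsetI CollectI ballI)
    fix a P assume a: "a \<in> z ` ?C" and P: "P \<in> S"
    then obtain \<phi> where \<phi>: "\<phi> \<in> ?C" "a = z \<phi>" by blast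
    have "vge P (z \<phi> - \<phi> P) 0" using z'[OF P, of \<phi>] S(3)[OF P] by (auto elim!: vge_mono)
    hence "vge P (z \<phi> - \<phi> P + \<phi> P) 0"
      using T(3)[OF P, of "\<phi> P"] \<phi> P by (intro vge_add[OF S(2)[OF P]]) auto
    thus "vge P a 0" using \<phi> by simp
  qed
  hence "card (z ` ?C) \<le> card R"
    using inc by (intro rep_set_card_le[OF N R(2)]) auto
  hence "card ?C \<le> q ^ d" using R(3) by (simp add: card_image[OF inj])
  moreover have "card ?C = q ^ (\<Sum>P\<in>S. nat (- P x) * deg_place Fq P)"
    using T(2) S(1) by (simp add: card_PiE power_sum)
  ultimately have "(\<Sum>P\<in>S. nat (- P x) * deg_place Fq P) \<le> d"
    using q_ge_2 by simp
  thus ?thesis using R(1) by simp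
qed

text \<open>Dividing a relation by x^s, with s at least every degree, turns polynomials in
  \<open>x\<close> into polynomials in 1/x. The monomial factor in \<open>r\<close> pads the
  reflected polynomials to the common exponent s.\<close>

lemma Dep_inverse:
  assumes "Dep x M" "x \<noteq> 0"
  shows "Dep (inverse x) M"
  unfolding Dep_def
proof
  fix u :: "nat \<Rightarrow> 'K"
  obtain p where p: "\<forall>j<M. poly_over Fq (p j)" "\<exists>j<M. p j \<noteq> 0" "(\<Sum>j<M. poly (p j) x * u j) = 0"
    using assms(1) unfolding Dep_def by blast
  define s where "s = (\<Sum>j<M. degree (p j))"
  have deg: "degree (p j) \<le> s" if "j < M" for j
    unfolding s_def using that by (intro member_le_sum) auto
  define r where "r j = monom 1 (s - degree (p j)) * reflect_poly (p j)" for j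
  have "poly (r j) (inverse x) = inverse x ^ s * poly (p j) x" if "j < M" for j
  proof -
    have "poly (r j) (inverse x) = inverse x ^ (s - degree (p j)) * (inverse x ^ degree (p j) * poly (p j) x)"
      using poly_reflect_poly_nz[of "inverse x" "p j"] assms(2) by (simp add: r_def poly_monom)
    thus ?thesis using deg[OF that] by (simp flip: power_add mult.assoc)
  qed
  hence "(\<Sum>j<M. poly (r j) (inverse x) * u j) = inverse x ^ s * (\<Sum>j<M. poly (p j) x * u j)"
    by (simp add: sum_distrib_left mult.assoc)
  hence "(\<Sum>j<M. poly (r j) (inverse x) * u j) = 0" using p(3) by simp
  moreover have "poly_over Fq (r j)" if "j < M" for j
    unfolding r_def using p(1) that
    by (intro poly_over_mult poly_over_monom) (auto simp: poly_over_def coeff_reflect_poly)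
  moreover have "\<exists>j<M. r j \<noteq> 0" using p(2) by (auto simp: r_def monom_eq_0_iff)
  ultimately show "\<exists>p. (\<forall>j<M. poly_over Fq (p j)) \<and> (\<exists>j<M. p j \<noteq> 0) \<and>
      (\<Sum>j<M. poly (p j) (inverse x) * u j) = 0" by blast
qed

text \<open>For nonconstant \<open>x\<close> this is the degree of the field extension over the rational subfield
  generated by \<open>x\<close>.\<close>

definition ext_deg :: "'K \<Rightarrow> nat" where
  "ext_deg x = (LEAST n. Dep x (Suc n))"

lemma not_Dep_0: "\<not> Dep x 0" by (simp add: Dep_def)

lemma Dep_ext_deg: "Dep x (Suc (ext_deg x))"
proof -
  obtain M where "Dep x M" using ex_Dep by blast
  then obtain n where "Dep x (Suc n)" using not_Dep_0 by (cases M) auto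
  thus ?thesis unfolding ext_deg_def by (rule LeastI)
qed

lemma not_Dep_ext_deg: "\<not> Dep x (ext_deg x)"
proof (cases "ext_deg x")
  case 0
  thus ?thesis using not_Dep_0 by simp
next
  case (Suc n)
  thus ?thesis using not_less_Least[of n "\<lambda>n. Dep x (Suc n)", folded ext_deg_def] by simp
qed

lemma ext_deg_pos: "x \<notin> Fq \<Longrightarrow> ext_deg x \<ge> 1"
proof (rule ccontr)
  assume x: "x \<notin> Fq" "\<not> 1 \<le> ext_deg x"
  hence "Dep x 1" using Dep_ext_deg[of x] by (simp add: not_le)
  then obtain p :: "nat \<Rightarrow> 'K poly" where "\<forall>j<1. poly_over Fq (p j)" "\<exists>j<1. p j \<noteq> 0"
      "(\<Sum>j<1. poly (p j) x * 1) = 0"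
    unfolding Dep_def by (elim allE[of _ "\<lambda>_. 1"]) blast
  hence "poly_over Fq (p 0)" "p 0 \<noteq> 0" "poly (p 0) x = 0" by auto
  thus False using transcendental[OF x(1)] by blast
qed

lemma ext_deg_inverse: "x \<noteq> 0 \<Longrightarrow> ext_deg (inverse x) = ext_deg x"
  using Dep_inverse[of x] Dep_inverse[of "inverse x"]
  unfolding ext_deg_def by (intro arg_cong[of _ _ Least] ext) auto

text \<open>Each pole contributes at least 1 to a sum bounded by \<open>ext_deg x\<close>, so finite
  sets of poles have bounded size.\<close>

lemma finite_poles:
  assumes "x \<notin> Fq"
  shows "finite {P. is_place Fq P \<and> P x < 0}"
proof (rule conjunct1[OF finite_if_finite_subsets_card_bdd])
  fix S assume S: "S \<subseteq> {P. is_place Fq P \<and> P x < 0}" "finite S"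
  have x: "x \<noteq> 0" using assms by auto
  have "card S = (\<Sum>P\<in>S. 1)" by simp
  also have "\<dots> \<le> (\<Sum>P\<in>S. nat (- P x) * deg_place Fq P)"
  proof (rule sum_mono)
    fix P assume "P \<in> S"
    hence "1 \<le> nat (- P x)" "1 \<le> deg_place Fq P" using S deg_place_pos by auto
    thus "1 \<le> nat (- P x) * deg_place Fq P" by simp
  qed
  also have "\<dots> \<le> ext_deg x" using S by (intro sum_poles_le[OF x Dep_ext_deg]) auto
  finally show "card S \<le> ext_deg x" .
qed

subsection \<open>Existence of poles\<close>

definition subring_over :: "'K set \<Rightarrow> bool" where
  "subring_over R \<longleftrightarrow> Fq \<subseteq> R \<and> (\<forall>a\<in>R. \<forall>b\<in>R. a + b \<in> R \<and> a * b \<in> R)"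

definition adjoin :: "'K set \<Rightarrow> 'K \<Rightarrow> 'K set" where
  "adjoin R z = {poly p z | p. \<forall>i. coeff p i \<in> R}"

lemma subring_over_0: "subring_over R \<Longrightarrow> 0 \<in> R" and subring_over_1: "subring_over R \<Longrightarrow> 1 \<in> R"
  and subring_over_add: "subring_over R \<Longrightarrow> a \<in> R \<Longrightarrow> b \<in> R \<Longrightarrow> a + b \<in> R"
  and subring_over_mult: "subring_over R \<Longrightarrow> a \<in> R \<Longrightarrow> b \<in> R \<Longrightarrow> a * b \<in> R"
  by (auto simp: subring_over_def)

lemma subring_over_lsub: "subring_over R \<Longrightarrow> lsub R"
  by (auto simp: subring_over_def lsub_def)

lemma subring_over_power: "subring_over R \<Longrightarrow> a \<in> R \<Longrightarrow> a ^ n \<in> R"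
  by (induction n) (auto intro: subring_over_1 subring_over_mult)

lemma subring_over_adjoin:
  assumes R: "subring_over R"
  shows "subring_over (adjoin R z)" "R \<subseteq> adjoin R z" "z \<in> adjoin R z"
proof -
  show sub: "R \<subseteq> adjoin R z"
  proof
    fix a assume "a \<in> R"
    thus "a \<in> adjoin R z" unfolding adjoin_def
      by (intro CollectI exI[of _ "[:a:]"]) (auto simp: coeff_pCons subring_over_0[OF R] split: nat.splits)
  qed
  show "z \<in> adjoin R z" unfolding adjoin_def
    by (intro CollectI exI[of _ "[:0, 1:]"])
      (auto simp: coeff_pCons subring_over_0[OF R] subring_over_1[OF R] split: nat.splits)
  show "subring_over (adjoin R z)" unfolding subring_over_def
  proof (intro conjI ballI)
    show "Fq \<subseteq> adjoin R z" using R sub by (auto simp: subring_over_def)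
    fix a b assume "a \<in> adjoin R z" "b \<in> adjoin R z"
    then obtain p r where pr: "a = poly p z" "b = poly r z" "\<forall>i. coeff p i \<in> R" "\<forall>i. coeff r i \<in> R"
      by (auto simp: adjoin_def)
    show "a + b \<in> adjoin R z" unfolding adjoin_def using pr
      by (intro CollectI exI[of _ "p + r"]) (auto intro: subring_over_add[OF R])
    show "a * b \<in> adjoin R z" unfolding adjoin_def using pr
      by (intro CollectI exI[of _ "p * r"])
        (auto simp: coeff_mult intro!: lsub_sum[OF subring_over_lsub[OF R]] subring_over_mult[OF R])
  qed
qed

text \<open>A subring that is maximal among those containing \<open>inverse x\<close> but not \<open>x\<close> is a valuation ring.\<close>

definition excl_ring :: "'K \<Rightarrow> 'K set \<Rightarrow> bool" where
  "excl_ring x R \<longleftrightarrow> subring_over R \<and> inverse x \<in> R \<and> x \<notin> R"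

text \<open>Zorn's lemma, started at Fq[1/x]. That ring omits \<open>x\<close>, since x = p(1/x)
  would make 1/x a root of Y p(Y) - 1 and hence algebraic.\<close>

lemma ex_maximal_excl_ring:
  assumes x: "x \<notin> Fq"
  shows "\<exists>R. excl_ring x R \<and> (\<forall>R'. excl_ring x R' \<longrightarrow> R \<subseteq> R' \<longrightarrow> R' = R)"
proof -
  have x0: "x \<noteq> 0" using x by auto
  have y: "inverse x \<notin> Fq" using x Fq_inverse[of "inverse x"] by auto
  have Fqs: "subring_over Fq" by (auto simp: subring_over_def Fq_add Fq_mult)
  let ?A = "adjoin Fq (inverse x)"
  have "x \<notin> ?A"
  proof
    assume "x \<in> ?A"
    then obtain p where p: "x = poly p (inverse x)" "\<forall>i. coeff p i \<in> Fq" by (auto simp: adjoin_def)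
    have "poly (pCons (-1) p) (inverse x) = 0" using x0 by (simp flip: p(1))
    moreover have "poly_over Fq p" using p(2) by (simp add: poly_over_def)
    hence "poly_over Fq (pCons (-1) p)" by (simp add: poly_over_pCons Fq_uminus)
    moreover have "pCons (-1) p \<noteq> 0" by simp
    ultimately show False using transcendental[OF y] by blast
  qed
  hence "?A \<in> Collect (excl_ring x)" using subring_over_adjoin[OF Fqs] by (simp add: excl_ring_def)
  moreover have "\<Union> C \<in> Collect (excl_ring x)" if C: "C \<noteq> {}" "subset.chain (Collect (excl_ring x)) C" for C
  proof -
    have mem: "excl_ring x R" if "R \<in> C" for R using C that by (auto simp: subset.chain_def)
    have "subring_over (\<Union> C)" unfolding subring_over_def
    proof (intro conjI ballI)
      obtain R where "R \<in> C" using C(1) by blast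
      thus "Fq \<subseteq> \<Union> C" using mem[of R] by (auto simp: excl_ring_def subring_over_def)
      fix a b assume "a \<in> \<Union> C" "b \<in> \<Union> C"
      then obtain R1 R2 where R: "a \<in> R1" "R1 \<in> C" "b \<in> R2" "R2 \<in> C" by auto
      then obtain R where "a \<in> R" "b \<in> R" "R \<in> C"
        using C(2) by (metis subset.chain_def subsetD subset_chain_def)
      thus "a + b \<in> \<Union> C" "a * b \<in> \<Union> C"
        using mem[of R] by (auto simp: excl_ring_def subring_over_def intro!: bexI[of _ R])
    qed
    thus ?thesis using C(1) mem by (auto simp: excl_ring_def)
  qed
  ultimately have "\<exists>R\<in>Collect (excl_ring x). \<forall>X\<in>Collect (excl_ring x). R \<subseteq> X \<longrightarrow> X = R"
    by (intro subset_Zorn_nonempty) auto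
  thus ?thesis by auto
qed

section \<open>A maximal ring excluding x is a valuation ring\<close>

context
  fixes x :: 'K and R :: "'K set"
  assumes x: "x \<notin> Fq" and R: "excl_ring x R"
    and max: "\<And>R'. excl_ring x R' \<Longrightarrow> R \<subseteq> R' \<Longrightarrow> R' = R"
begin

lemma x_nz: "x \<noteq> 0" using x by auto

lemma R_subring: "subring_over R" and inverse_x_R: "inverse x \<in> R" and x_notin_R: "x \<notin> R"
  using R by (auto simp: excl_ring_def)

lemmas R_lsub = subring_over_lsub[OF R_subring]
lemmas R_0 = subring_over_0[OF R_subring] and R_1 = subring_over_1[OF R_subring]
  and R_add = subring_over_add[OF R_subring] and R_mult = subring_over_mult[OF R_subring]
  and R_diff = lsub_diff[OF R_lsub] and R_power = subring_over_power[OF R_subring]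

lemma adjoin_imp: "z \<notin> R \<Longrightarrow> x \<in> adjoin R z"
  using max[of "adjoin R z"] subring_over_adjoin[OF R_subring, of z] inverse_x_R by (auto simp: excl_ring_def)

text \<open>So 1/x lies in every maximal ideal of R. If u = 1 - a/x had no inverse in R, maximality
  would give \<open>x\<close> in R[1/u], so x u^d is in R for some d; and x u^d = x u^(d+1) + a u^d
  lowers d down to 0, a contradiction.\<close>

lemma one_minus_unit:
  assumes a: "a \<in> R"
  shows "1 - inverse x * a \<noteq> 0" "inverse (1 - inverse x * a) \<in> R"
proof -
  define u where "u = 1 - inverse x * a"
  show u0: "1 - inverse x * a \<noteq> 0"
  proof
    assume "1 - inverse x * a = 0"
    hence "a = x" using x_nz by (simp add: field_simps)
    thus False using a x_notin_R by simp
  qed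
  have uR: "u \<in> R" unfolding u_def by (intro R_diff R_1 R_mult inverse_x_R a)
  have desc: "x * u ^ d \<in> R \<Longrightarrow> x \<in> R" for d
  proof (induction d)
    case (Suc d)
    have "x * u ^ d = x * u ^ Suc d + a * u ^ d"
      using x_nz by (simp add: u_def field_simps)
    also have "\<dots> \<in> R" by (intro R_add Suc.prems R_mult a R_power uR)
    finally show ?case by (rule Suc.IH)
  qed simp
  show "inverse (1 - inverse x * a) \<in> R"
  proof (rule ccontr)
    assume "inverse (1 - inverse x * a) \<notin> R"
    hence "x \<in> adjoin R (inverse u)" by (intro adjoin_imp) (simp add: u_def)
    then obtain p where p: "x = poly p (inverse u)" "\<forall>i. coeff p i \<in> R" by (auto simp: adjoin_def)
    have un: "u \<noteq> 0" using u0 by (simp add: u_def)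
    have "x * u ^ degree p = (\<Sum>i\<le>degree p. coeff p i * (inverse u ^ i * u ^ degree p))"
      by (subst p(1)) (simp add: poly_altdef sum_distrib_right mult.assoc)
    also have "\<dots> = (\<Sum>i\<le>degree p. coeff p i * u ^ (degree p - i))"
      using un by (intro sum.cong) (auto simp: power_diff power_inverse field_simps)
    also have "\<dots> \<in> R" using p by (intro lsub_sum[OF R_lsub] R_mult R_power uR) auto
    finally show False using desc x_notin_R by blast
  qed
qed

text \<open>Multiplying x = r(1/z) by z^m / x gives (1 - r_0/x) z^m as an R-combination of lower
  powers of z. The factor on the left is a unit, so z^m can be eliminated; times z^(n-m), this
  replaces the leading term of \<open>p\<close>.\<close>

lemma reduce_degree:
  assumes z: "z \<noteq> 0" and p: "x = poly p z" "\<And>i. coeff p i \<in> R"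
    and r: "x = poly r (inverse z)" "\<And>i. coeff r i \<in> R" and le: "degree r \<le> degree p"
  shows "\<exists>p'. x = poly p' z \<and> (\<forall>i. coeff p' i \<in> R) \<and> degree p' < degree p"
proof -
  define m where "m = degree r"
  define n where "n = degree p"
  have m0: "m > 0"
  proof (rule ccontr)
    assume "\<not> 0 < m"
    then obtain a where "r = [:a:]" using degree_eq_zeroE[of r] by (auto simp: m_def)
    thus False using r(1) r(2)[of 0] x_notin_R by simp
  qed
  define c where "c = inverse (1 - inverse x * coeff r 0)"
  have c: "c \<in> R" and cn: "1 - inverse x * coeff r 0 \<noteq> 0"
    using one_minus_unit[OF r(2)[of 0]] by (auto simp: c_def)
  define e where "e i = c * (inverse x * coeff r i)" for i
  have e: "e i \<in> R" for i unfolding e_def by (intro R_mult c inverse_x_R r)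
  have "x * z ^ m = (\<Sum>i\<le>m. coeff r i * (inverse z ^ i * z ^ m))"
    by (subst r(1)) (simp add: poly_altdef sum_distrib_right mult.assoc m_def)
  also have "\<dots> = (\<Sum>i\<le>m. coeff r i * z ^ (m - i))"
    using z by (intro sum.cong) (auto simp: power_diff power_inverse field_simps)
  also have "{..m} = insert 0 {1..m}" by auto
  finally have "x * z ^ m = coeff r 0 * z ^ m + (\<Sum>i=1..m. coeff r i * z ^ (m - i))" by simp
  hence "inverse x * (x * z ^ m) = inverse x * (coeff r 0 * z ^ m + (\<Sum>i=1..m. coeff r i * z ^ (m - i)))"
    by simp
  moreover have "inverse x * (x * z ^ m) = z ^ m" using x_nz by simp
  \<comment> \<open>Used with a = z^m, b = 1/x and c the constant coefficient of \<open>r\<close>: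
    it moves the z^m term of the right side to the left.\<close>
  moreover have "(1 - b * c) * a = b * s" if "h = b * (c * a + s)" "h = a" for a b c s h :: 'K
    using that by algebra
  ultimately have "(1 - inverse x * coeff r 0) * z ^ m = inverse x * (\<Sum>i=1..m. coeff r i * z ^ (m - i))"
    by blast
  hence "c * ((1 - inverse x * coeff r 0) * z ^ m) = c * (inverse x * (\<Sum>i=1..m. coeff r i * z ^ (m - i)))"
    by simp
  moreover have "c * (1 - inverse x * coeff r 0) = 1" using cn by (simp add: c_def)
  ultimately have zm: "z ^ m = (\<Sum>i=1..m. e i * z ^ (m - i))"
    by (simp add: e_def sum_distrib_left mult.assoc[symmetric])
  define E where "E = (\<Sum>i=1..m. monom (e i) (n - i))"
  define p' where "p' = (\<Sum>i<n. monom (coeff p i) i) + smult (coeff p n) E"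
  have "z ^ n = z ^ (n - m) * z ^ m" using le by (simp add: m_def n_def flip: power_add)
  also have "\<dots> = (\<Sum>i=1..m. e i * (z ^ (n - m) * z ^ (m - i)))"
    by (simp only: zm sum_distrib_left mult_ac)
  also have "\<dots> = (\<Sum>i=1..m. e i * z ^ (n - i))"
  proof (intro sum.cong refl)
    fix i assume "i \<in> {1..m}"
    hence "n - i = (n - m) + (m - i)" using le by (auto simp: m_def n_def)
    thus "e i * (z ^ (n - m) * z ^ (m - i)) = e i * z ^ (n - i)" by (simp add: power_add)
  qed
  also have "\<dots> = poly E z" by (simp add: E_def poly_sum poly_monom)
  finally have "poly p' z = (\<Sum>i<n. coeff p i * z ^ i) + coeff p n * z ^ n"
    by (simp add: p'_def poly_sum poly_monom)
  also have "\<dots> = poly p z" by (simp add: poly_altdef n_def lessThan_Suc_atMost[symmetric])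
  finally have 1: "x = poly p' z" using p by simp
  have 2: "coeff p' i \<in> R" for i
  proof -
    have "coeff E i \<in> R" unfolding E_def coeff_sum by (intro lsub_sum[OF R_lsub]) (auto simp: e R_0)
    moreover have "coeff (\<Sum>i<n. monom (coeff p i) i) i \<in> R"
      unfolding coeff_sum by (intro lsub_sum[OF R_lsub]) (auto simp: p R_0)
    ultimately show ?thesis unfolding p'_def by (auto intro!: R_add R_mult p)
  qed
  have n0: "n > 0" using m0 le by (simp add: m_def n_def)
  have "coeff p' i = 0" if "i \<ge> n" for i
    using that m0 n0 by (auto simp: p'_def E_def coeff_sum intro!: sum.neutral)
  hence 3: "degree p' < n" using n0
    by (intro degree_lessI) auto
  show ?thesis using 1 2 3 by (auto simp: n_def)
qed

text \<open>If neither held, \<open>x\<close> would be a polynomial over R in z and also in 1/z.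
  Reducing whichever has the larger degree lowers the sum of the degrees forever.\<close>

lemma valuation_ring: "z \<in> R \<or> inverse z \<in> R"
proof (rule ccontr)
  assume "\<not> ?thesis"
  hence zR: "z \<notin> R" "inverse z \<notin> R" by auto
  have z: "z \<noteq> 0" using zR R_0 by auto
  obtain p where p: "x = poly p z" "\<forall>i. coeff p i \<in> R"
    using adjoin_imp[OF zR(1)] unfolding adjoin_def by blast
  obtain r where r: "x = poly r (inverse z)" "\<forall>i. coeff r i \<in> R"
    using adjoin_imp[OF zR(2)] unfolding adjoin_def by blast
  from p r z show False
  proof (induction "degree p + degree r" arbitrary: p r z rule: less_induct)
    case less
    show False
    proof (cases "degree r \<le> degree p")
      case True
      obtain p' where p': "x = poly p' z" "\<forall>i. coeff p' i \<in> R" "degree p' < degree p"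
        using reduce_degree[of z p r] less.prems True by blast
      show False using less.hyps[of p' r z] p' less.prems by auto
    next
      case False
      obtain r' where r': "x = poly r' (inverse z)" "\<forall>i. coeff r' i \<in> R" "degree r' < degree r"
        using reduce_degree[of "inverse z" r p] less.prems False by auto
      show False using less.hyps[of p r' z] r' less.prems by auto
    qed
  qed
qed

section \<open>Discreteness of the valuation ring\<close>

definition runits :: "'K set" where "runits = {a \<in> R. a \<noteq> 0 \<and> inverse a \<in> R}"
definition rmax :: "'K set" where "rmax = R - runits"

lemma runits_mult: "a \<in> runits \<Longrightarrow> b \<in> runits \<Longrightarrow> a * b \<in> runits" by (auto simp: runits_def R_mult)
lemma runits_inverse: "a \<in> runits \<Longrightarrow> inverse a \<in> runits" by (auto simp: runits_def)
lemma runits_1: "1 \<in> runits" by (auto simp: runits_def R_1)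
lemma rmax_0: "0 \<in> rmax" by (auto simp: rmax_def runits_def R_0)
lemma rmax_R: "a \<in> rmax \<Longrightarrow> a \<in> R" by (auto simp: rmax_def)

lemma rmax_mult:
  assumes "a \<in> rmax" "b \<in> R"
  shows "a * b \<in> rmax"
proof -
  have False if "a * b \<in> runits"
  proof -
    have "inverse (a * b) * b \<in> R" using that assms by (intro R_mult) (auto simp: runits_def)
    moreover have "a \<noteq> 0" "b \<noteq> 0" using that by (auto simp: runits_def)
    hence "inverse (a * b) * b = inverse a" by (simp add: field_simps)
    ultimately have "inverse a \<in> R" by metis
    thus False using assms \<open>a \<noteq> 0\<close> by (auto simp: rmax_def runits_def)
  qed
  thus ?thesis using assms by (auto simp: rmax_def R_mult)
qed

lemma rmax_add:
  assumes "a \<in> rmax" "b \<in> rmax"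
  shows "a + b \<in> rmax"
proof (cases "a = 0 \<or> b = 0")
  case True
  thus ?thesis using assms by auto
next
  case False
  from valuation_ring[of "a * inverse b"] show ?thesis
  proof
    assume "a * inverse b \<in> R"
    hence "b * (a * inverse b + 1) \<in> rmax" using assms by (intro rmax_mult R_add R_1)
    moreover have "b * (a * inverse b + 1) = a + b" using False by (simp add: field_simps)
    ultimately show ?thesis by simp
  next
    assume "inverse (a * inverse b) \<in> R"
    hence "a * (inverse (a * inverse b) + 1) \<in> rmax" using assms by (intro rmax_mult R_add R_1)
    moreover have "a * (inverse (a * inverse b) + 1) = a + b" using False by (simp add: field_simps)
    ultimately show ?thesis by simp
  qed
qed

lemma runits_add:
  assumes "a \<in> runits" "b \<in> rmax" shows "a + b \<in> runits"
proof (rule ccontr)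
  assume "a + b \<notin> runits"
  hence "a + b \<in> rmax" using assms by (auto simp: rmax_def runits_def R_add)
  moreover have "- b \<in> rmax" using rmax_mult[OF assms(2) lsub_uminus[OF R_lsub R_1]] by simp
  ultimately have "a + b + (- b) \<in> rmax" by (rule rmax_add)
  thus False using assms by (auto simp: rmax_def)
qed

lemma Fq_runits: "c \<in> Fq \<Longrightarrow> c \<noteq> 0 \<Longrightarrow> c \<in> runits"
  using R_subring Fq_inverse[of c] by (auto simp: runits_def subring_over_def)

lemma rmax_sum: "(\<And>i. i \<in> J \<Longrightarrow> f i \<in> rmax) \<Longrightarrow> sum f J \<in> rmax"
  by (induction J rule: infinite_finite_induct) (auto simp: rmax_0 intro: rmax_add)

text \<open>The principal ideals of the w_i form a strictly increasing chain, all strictly above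
  that of \<open>z\<close>. In a combination with constant coefficients the last nonzero term w_j
  dominates, so the sum is w_j times a unit and cannot lie in zR. Thus the w_i are independent
  modulo zR, and \<open>Dep\<close> for 1/z forbids \<open>M\<close> of them.\<close>

lemma no_long_chain:
  assumes z: "z \<in> rmax" "z \<noteq> 0" and D: "Dep (inverse z) M"
    and w: "\<And>i. i < M \<Longrightarrow> w i \<in> R" "\<And>i. i < M \<Longrightarrow> w i \<noteq> 0"
    and wz: "\<And>i. i < M \<Longrightarrow> z * inverse (w i) \<in> rmax"
    and ww: "\<And>i j. i < j \<Longrightarrow> j < M \<Longrightarrow> w i * inverse (w j) \<in> rmax"
  shows False
proof -
  let ?N = "{z * a | a. a \<in> R}"
  have "\<not> indep_mod ?N w M"
  proof (rule Dep_imp_not_indep_mod[OF _ D R_lsub])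
    fix a assume "a \<in> R"
    thus "inverse (inverse z) * a \<in> R" "inverse (inverse z) * a \<in> ?N"
      using z R_mult[OF rmax_R[OF z(1)]] by auto
  qed (use z w in auto)
  then obtain c where c: "\<forall>i<M. c i \<in> Fq" "(\<Sum>i<M. c i * w i) \<in> ?N" "\<exists>i<M. c i \<noteq> 0"
    unfolding indep_mod_def by blast
  define Q where "Q i \<longleftrightarrow> i < M \<and> c i \<noteq> 0" for i
  define j where "j = (GREATEST i. Q i)"
  obtain i0 where i0: "Q i0" using c by (auto simp: Q_def)
  have bd: "i \<le> M" if "Q i" for i using that by (auto simp: Q_def)
  have j: "Q j" unfolding j_def using i0 bd by (rule GreatestI_nat)
  have le: "i \<le> j" if "Q i" for i unfolding j_def using that bd by (rule Greatest_le_nat)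
  have jM: "j < M" and cj: "c j \<noteq> 0" using j by (auto simp: Q_def)
  have wj: "w j \<noteq> 0" using w jM by auto
  have "(\<Sum>i<M. c i * w i) = (\<Sum>i<Suc j. c i * w i)"
    using le jM by (intro sum.mono_neutral_right) (force simp: Q_def less_Suc_eq_le)+
  also have "\<dots> = w j * (c j + (\<Sum>i<j. c i * (w i * inverse (w j))))"
    using wj by (simp add: algebra_simps sum_distrib_left)
  finally have eq: "(\<Sum>i<M. c i * w i) = w j * (c j + (\<Sum>i<j. c i * (w i * inverse (w j))))" .
  define u where "u = c j + (\<Sum>i<j. c i * (w i * inverse (w j)))"
  have "u \<in> runits" unfolding u_def
  proof (intro runits_add Fq_runits cj rmax_sum)
    show "c j \<in> Fq" using c jM by auto
    fix i assume "i \<in> {..<j}"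
    hence "(w i * inverse (w j)) * c i \<in> rmax"
      using c jM R_subring by (intro rmax_mult ww) (auto simp: subring_over_def)
    thus "c i * (w i * inverse (w j)) \<in> rmax" by (simp add: mult.commute)
  qed
  obtain a where a: "a \<in> R" "w j * u = z * a" using c(2) eq by (auto simp: u_def)
  have "z * inverse (w j) * (a * inverse u) \<in> rmax"
    using a \<open>u \<in> runits\<close> by (intro rmax_mult[OF wz[OF jM]] R_mult) (auto simp: runits_def)
  moreover have "z * inverse (w j) * (a * inverse u) = 1"
  proof -
    have "u \<noteq> 0" using \<open>u \<in> runits\<close> by (auto simp: runits_def)
    have "z * inverse (w j) * (a * inverse u) = (z * a) * inverse (w j) * inverse u" by (simp add: mult_ac)
    also have "\<dots> = (w j * u) * inverse (w j) * inverse u" by (simp only: a(2))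
    also have "\<dots> = 1" using \<open>u \<noteq> 0\<close> wj by (simp add: field_simps)
    finally show ?thesis .
  qed
  ultimately show False using runits_1 by (auto simp: rmax_def)
qed

lemma inverse_x_rmax: "inverse x \<in> rmax"
  using inverse_x_R x_notin_R by (auto simp: rmax_def runits_def)

text \<open>Without a generator, each nonzero t in the maximal ideal has a strict divisor s there,
  that is t/s is again in the ideal. Iterating from 1/x builds chains of any length.\<close>

lemma ex_generator: "\<exists>t\<in>rmax. t \<noteq> 0 \<and> (\<forall>s\<in>rmax. s * inverse t \<in> R)"
proof (rule ccontr)
  assume neg: "\<not> ?thesis"
  have step: "\<exists>s. (s \<in> rmax \<and> s \<noteq> 0) \<and> t * inverse s \<in> rmax" if t: "t \<in> rmax \<and> t \<noteq> 0" for t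
  proof -
    obtain s where s: "s \<in> rmax" "s * inverse t \<notin> R" using neg t by blast
    have s0: "s \<noteq> 0" using s R_0 by auto
    have "inverse (s * inverse t) \<in> R" using valuation_ring s by blast
    moreover have "inverse (s * inverse t) = t * inverse s" using t s0 by (simp add: field_simps)
    moreover have "inverse (t * inverse s) \<notin> R" using s(2) s0 t by (simp add: field_simps)
    ultimately have "t * inverse s \<in> R - runits" by (simp only: runits_def) auto
    thus ?thesis using s s0 by (auto simp: rmax_def)
  qed
  obtain M where M: "Dep (inverse (inverse x)) M" using ex_Dep by blast
  obtain s :: "nat \<Rightarrow> 'K" where s0: "s 0 = inverse x" and s: "\<And>n. s n \<in> rmax \<and> s n \<noteq> 0"
    and ss: "\<And>n. s n * inverse (s (Suc n)) \<in> rmax"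
  proof -
    define nxt where "nxt t = (SOME s. (s \<in> rmax \<and> s \<noteq> 0) \<and> t * inverse s \<in> rmax)" for t
    have nxt: "(nxt t \<in> rmax \<and> nxt t \<noteq> 0) \<and> t * inverse (nxt t) \<in> rmax" if "t \<in> rmax \<and> t \<noteq> 0" for t
      unfolding nxt_def using someI_ex[OF step[OF that]] .
    define s where "s n = (nxt ^^ n) (inverse x)" for n
    have "s n \<in> rmax \<and> s n \<noteq> 0" for n
      by (induction n) (use inverse_x_rmax x_nz nxt in \<open>auto simp: s_def\<close>)
    moreover have "s n * inverse (s (Suc n)) \<in> rmax" for n
      using nxt[OF \<open>s n \<in> rmax \<and> s n \<noteq> 0\<close>] by (simp add: s_def)
    ultimately show ?thesis using that[of s] by (simp add: s_def)
  qed
  have chain: "s i * inverse (s (i + Suc k)) \<in> rmax" for i k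
  proof (induction k)
    case 0
    show ?case using ss by simp
  next
    case (Suc k)
    have "s i * inverse (s (i + Suc k)) * (s (i + Suc k) * inverse (s (Suc (i + Suc k)))) \<in> rmax"
      by (rule rmax_mult[OF Suc rmax_R[OF ss]])
    moreover have "inverse (s n) * (s n * b) = b" for n b
      using s[of n] by (simp flip: mult.assoc)
    ultimately show ?case by (simp add: mult.assoc)
  qed
  have chain': "s i * inverse (s j) \<in> rmax" if "i < j" for i j
    using chain[of i "j - Suc i"] that by simp
  show False
  \<comment> \<open>The shift by one is needed because s 0 = 1/x plays the role of \<open>z\<close>,
    which must be a strict multiple of every chain member.\<close>
  proof (rule no_long_chain[OF inverse_x_rmax _ M, of "\<lambda>i. s (Suc i)"])
    show "inverse x * inverse (s (Suc i)) \<in> rmax" for i using chain'[of 0 "Suc i"] s0 by simp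
    show "s (Suc i) * inverse (s (Suc j)) \<in> rmax" if "i < j" for i j using chain' that by simp
  qed (use x_nz s rmax_R in auto)
qed

text \<open>Every nonzero element is a unit times a unique integral power of the generator
  \<open>t\<close>; the exponent is the place.\<close>

lemma ex_place_of_ring: "\<exists>P. is_place Fq P \<and> P x < 0"
proof -
  obtain t where t: "t \<in> rmax" "t \<noteq> 0" "\<And>s. s \<in> rmax \<Longrightarrow> s * inverse t \<in> R"
    using ex_generator by blast
  have tpow: "t ^ Suc n \<in> rmax" for n
    using rmax_mult[OF t(1) R_power[OF rmax_R[OF t(1)], of n]] by simp
  have pos: "\<exists>n. z * inverse (t ^ n) \<in> runits" if z: "z \<in> R" "z \<noteq> 0" for z
  proof (cases "z \<in> runits")
    case True
    thus ?thesis by (intro exI[of _ 0]) simp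
  next
    case False
    hence zI: "z \<in> rmax" using z by (simp add: rmax_def)
    obtain M where M: "Dep (inverse z) M" using ex_Dep by blast
    \<comment> \<open>If every power of \<open>t\<close> divided \<open>z\<close>, then t^M, ..., t
      would be a forbidden chain above \<open>z\<close>.\<close>
    have "\<exists>n. z * inverse (t ^ n) \<notin> R"
    proof (rule ccontr)
      assume "\<not> ?thesis"
      hence all: "z * inverse (t ^ n) \<in> R" for n by blast
      show False
      proof (rule no_long_chain[OF zI z(2) M, of "\<lambda>i. t ^ (M - i)"])
        fix i
        have "t * (z * inverse (t ^ Suc (M - i))) \<in> rmax" by (intro rmax_mult t all)
        thus "z * inverse (t ^ (M - i)) \<in> rmax" using t(2) by (simp add: field_simps)
      next
        fix i j assume ij: "i < j" "j < M"
        hence "M - i = Suc (j - Suc i) + (M - j)" by simp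
        hence "t ^ (M - i) * inverse (t ^ (M - j)) = t ^ Suc (j - Suc i)"
          using t(2) by (simp only: power_add) simp
        thus "t ^ (M - i) * inverse (t ^ (M - j)) \<in> rmax" using tpow by metis
      qed (use t R_power[OF rmax_R[OF t(1)]] in auto)
    qed
    then obtain n0 where n0: "z * inverse (t ^ n0) \<notin> R" by blast
    define n where "n = (LEAST n. z * inverse (t ^ n) \<notin> R)"
    have n: "z * inverse (t ^ n) \<notin> R" unfolding n_def by (rule LeastI[of _ n0]) (rule n0)
    then obtain m where m: "n = Suc m" using z by (cases n) auto
    have mR: "z * inverse (t ^ m) \<in> R"
      using not_less_Least[of m "\<lambda>n. z * inverse (t ^ n) \<notin> R", folded n_def] m by simp
    have "z * inverse (t ^ m) \<in> runits"
    proof (rule ccontr)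
      assume "z * inverse (t ^ m) \<notin> runits"
      hence "z * inverse (t ^ m) * inverse t \<in> R" using mR by (intro t) (auto simp: rmax_def)
      thus False using n m by (simp add: mult_ac)
    qed
    thus ?thesis by blast
  qed
  have ex: "\<exists>n. z * inverse (t powi n) \<in> runits" if z: "z \<noteq> 0" for z
  proof (cases "z \<in> R")
    case True
    then obtain n where "z * inverse (t ^ n) \<in> runits" using pos z by blast
    thus ?thesis by (intro exI[of _ "int n"]) simp
  next
    case False
    hence "inverse z \<in> R" using valuation_ring by blast
    then obtain n where "inverse z * inverse (t ^ n) \<in> runits" using pos[of "inverse z"] z by auto
    hence "inverse (inverse z * inverse (t ^ n)) \<in> runits" by (rule runits_inverse)
    thus ?thesis by (intro exI[of _ "- int n"]) (simp add: power_int_minus)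
  qed
  have powi_rmax: "t powi k \<in> rmax" if "k > 0" for k
  proof -
    have "t powi k = t ^ Suc (nat k - 1)" using that by (simp add: power_int_def)
    thus ?thesis using tpow by metis
  qed
  have powi_runits: "k = 0" if k: "t powi k \<in> runits" for k
  proof -
    have "\<not> k > 0" using powi_rmax k by (auto simp: rmax_def)
    moreover have "t powi (- k) \<in> runits" using runits_inverse[OF k] by (simp add: power_int_minus)
    hence "\<not> - k > 0" using powi_rmax[of "- k"] by (auto simp: rmax_def)
    ultimately show ?thesis by simp
  qed
  define V where "V z = (if z = 0 then 0 else THE n. z * inverse (t powi n) \<in> runits)" for z
  have uniq: "n = m" if "z * inverse (t powi n) \<in> runits" "z * inverse (t powi m) \<in> runits" for z n m
  proof -
    have "z \<noteq> 0" using that by (auto simp: runits_def)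
    have "(z * inverse (t powi m)) * inverse (z * inverse (t powi n)) \<in> runits"
      by (rule runits_mult[OF that(2) runits_inverse[OF that(1)]])
    also have "(z * inverse (t powi m)) * inverse (z * inverse (t powi n)) = t powi (n - m)"
      using \<open>z \<noteq> 0\<close> t(2) by (simp add: power_int_diff field_simps)
    finally show ?thesis using powi_runits by force
  qed
  have VI: "V z = n" if "z * inverse (t powi n) \<in> runits" for z n
  proof -
    have "z \<noteq> 0" using that by (auto simp: runits_def)
    thus ?thesis unfolding V_def using that uniq by (auto intro!: the_equality)
  qed
  have VU: "z * inverse (t powi V z) \<in> runits" if "z \<noteq> 0" for z
    using ex[OF that] VI by metis
  have Vmult: "V (a * b) = V a + V b" if "a \<noteq> 0" "b \<noteq> 0" for a b
  proof (rule VI)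
    have "(a * inverse (t powi V a)) * (b * inverse (t powi V b)) \<in> runits"
      by (rule runits_mult[OF VU[OF that(1)] VU[OF that(2)]])
    thus "a * b * inverse (t powi (V a + V b)) \<in> runits" using t(2) by (simp add: power_int_add mult_ac)
  qed
  have VR: "V a \<ge> 0" if a: "a \<in> R" "a \<noteq> 0" for a
  proof -
    obtain n where "a * inverse (t ^ n) \<in> runits" using pos[OF a] by blast
    hence "V a = int n" by (intro VI) simp
    thus ?thesis by simp
  qed
  have V1: "V u = 0" if "u \<in> runits" for u using VI[of u 0] that by simp
  \<comment> \<open>The quotient b/a or its inverse lies in R, so the summand of smaller value can
    be factored out of a + b.\<close>
  have Vadd: "V (a + b) \<ge> V a" if ab: "a \<noteq> 0" "b \<noteq> 0" "a + b \<noteq> 0" "b * inverse a \<in> R" for a b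
  proof -
    have eq: "a + b = a * (1 + b * inverse a)" using ab by (simp add: field_simps)
    have "1 + b * inverse a \<noteq> 0" using eq ab(3) by auto
    hence "V (a + b) = V a + V (1 + b * inverse a)" using ab by (subst eq) (rule Vmult)
    moreover have "V (1 + b * inverse a) \<ge> 0"
      using ab \<open>1 + b * inverse a \<noteq> 0\<close> by (intro VR R_add R_1)
    ultimately show ?thesis by simp
  qed
  have "is_place Fq V" unfolding is_place_def
  proof (intro conjI allI impI ballI)
    show "V 0 = 0" by (simp add: V_def)
    show "V (a * b) = V a + V b" if "a \<noteq> 0" "b \<noteq> 0" for a b using Vmult that .
    show "min (V a) (V b) \<le> V (a + b)" if ab: "a \<noteq> 0" "b \<noteq> 0" "a + b \<noteq> 0" for a b
    proof -
      have "inverse (b * inverse a) = a * inverse b" using ab by (simp add: field_simps)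
      hence "b * inverse a \<in> R \<or> a * inverse b \<in> R" using valuation_ring[of "b * inverse a"] by metis
      thus ?thesis using Vadd[of a b] Vadd[of b a] ab by (auto simp: add.commute min_le_iff_disj)
    qed
    show "\<exists>a. a \<noteq> 0 \<and> V a = n" for n
      using t(2) runits_1 by (intro exI[of _ "t powi n"] conjI VI) auto
    show "V c = 0" if "c \<in> Fq" "c \<noteq> 0" for c using V1 Fq_runits that by blast
  qed
  moreover have "V x < 0"
  proof -
    have "V (inverse x) \<ge> 0" using VR[OF inverse_x_R] x_nz by simp
    moreover have "V (inverse x) \<noteq> 0"
    proof
      assume "V (inverse x) = 0"
      hence "inverse x \<in> runits" using VU[of "inverse x"] x_nz by simp
      thus False using inverse_x_rmax by (simp add: rmax_def)
    qed
    moreover have "V x + V (inverse x) = 0" using Vmult[of x "inverse x"] V1[OF runits_1] x_nz by simp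
    ultimately show ?thesis by linarith
  qed
  ultimately show ?thesis by blast
qed

end

lemma ex_pole:
  assumes x: "x \<notin> Fq"
  shows "\<exists>P. is_place Fq P \<and> P x < 0"
proof -
  obtain R where "excl_ring x R" "\<forall>R'. excl_ring x R' \<longrightarrow> R \<subseteq> R' \<longrightarrow> R' = R"
    using ex_maximal_excl_ring[OF x] by blast
  thus ?thesis using ex_place_of_ring[OF x] by blast
qed

subsection \<open>Riemann-Roch spaces\<close>

lemma LL_iff: "f \<in> LL Fq A \<longleftrightarrow> (\<forall>P. is_place Fq P \<longrightarrow> vge P f (- A P))"
  by (auto simp: LL_def vge_def)

lemma lsub_LL: "lsub (LL Fq A)"
  by (auto simp: lsub_def LL_iff intro: vge_add vge_scale)

lemma LL_mono: "(\<And>P. A P \<le> B P) \<Longrightarrow> LL Fq A \<subseteq> LL Fq B"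
  unfolding LL_iff subset_iff by (meson neg_le_iff_le vge_mono)

lemma is_divisor_0: "is_divisor Fq (\<lambda>_. 0)" by (simp add: is_divisor_def)

lemma is_divisor_subset:
  assumes "finite S" "\<And>P. P \<in> S \<Longrightarrow> is_place Fq P" "\<And>P. P \<notin> S \<Longrightarrow> A P = 0"
  shows "is_divisor Fq A"
proof -
  have "{P. A P \<noteq> 0} \<subseteq> S" using assms(3) by auto
  thus ?thesis using assms by (auto simp: is_divisor_def intro: finite_subset)
qed

lemma is_divisor_add:
  assumes "is_divisor Fq A" "is_divisor Fq B"
  shows "is_divisor Fq (\<lambda>P. A P + B P)"
  using assms by (intro is_divisor_subset[of "{P. A P \<noteq> 0} \<union> {P. B P \<noteq> 0}"]) (auto simp: is_divisor_def)

lemma is_divisor_diff: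
  assumes "is_divisor Fq A" "is_divisor Fq B"
  shows "is_divisor Fq (\<lambda>P. A P - B P)"
  using assms by (intro is_divisor_subset[of "{P. A P \<noteq> 0} \<union> {P. B P \<noteq> 0}"]) (auto simp: is_divisor_def)

lemma is_divisor_scale: "is_divisor Fq A \<Longrightarrow> is_divisor Fq (\<lambda>P. k * A P)"
  by (intro is_divisor_subset[of "{P. A P \<noteq> 0}"]) (auto simp: is_divisor_def)

lemma is_divisor_max_0: "is_divisor Fq A \<Longrightarrow> is_divisor Fq (\<lambda>P. max (A P) 0)"
  by (intro is_divisor_subset[of "{P. A P \<noteq> 0}"]) (auto simp: is_divisor_def)

lemma deg_div_eq:
  assumes "finite S" "\<And>P. P \<notin> S \<Longrightarrow> A P = 0"
  shows "deg_div Fq A = (\<Sum>P\<in>S. A P * int (deg_place Fq P))"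
  unfolding deg_div_def using assms by (intro sum.mono_neutral_left) auto

lemma deg_div_0: "deg_div Fq (\<lambda>_. 0) = 0" by (simp add: deg_div_def)

lemma deg_div_add:
  assumes "is_divisor Fq A" "is_divisor Fq B"
  shows "deg_div Fq (\<lambda>P. A P + B P) = deg_div Fq A + deg_div Fq B"
proof -
  let ?S = "{P. A P \<noteq> 0} \<union> {P. B P \<noteq> 0}"
  have fin: "finite ?S" using assms by (auto simp: is_divisor_def)
  have "deg_div Fq A = (\<Sum>P\<in>?S. A P * int (deg_place Fq P))"
    "deg_div Fq B = (\<Sum>P\<in>?S. B P * int (deg_place Fq P))"
    "deg_div Fq (\<lambda>P. A P + B P) = (\<Sum>P\<in>?S. (A P + B P) * int (deg_place Fq P))"
    by (rule deg_div_eq[OF fin]; simp)+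
  thus ?thesis by (simp only: sum.distrib distrib_right)
qed

lemma deg_div_scale:
  assumes "is_divisor Fq A"
  shows "deg_div Fq (\<lambda>P. k * A P) = k * deg_div Fq A"
proof -
  let ?S = "{P. A P \<noteq> 0}"
  have fin: "finite ?S" using assms by (auto simp: is_divisor_def)
  have "deg_div Fq A = (\<Sum>P\<in>?S. A P * int (deg_place Fq P))"
    "deg_div Fq (\<lambda>P. k * A P) = (\<Sum>P\<in>?S. k * A P * int (deg_place Fq P))"
    by (rule deg_div_eq[OF fin]; simp)+
  thus ?thesis by (simp only: sum_distrib_left mult.assoc)
qed

lemma deg_div_diff:
  assumes "is_divisor Fq A" "is_divisor Fq B"
  shows "deg_div Fq (\<lambda>P. A P - B P) = deg_div Fq A - deg_div Fq B"
  using deg_div_add[OF assms(1) is_divisor_scale[OF assms(2), of "-1"]] deg_div_scale[OF assms(2), of "-1"]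
  by simp

lemma deg_div_mono:
  assumes "is_divisor Fq A" "is_divisor Fq B" "\<And>P. A P \<le> B P"
  shows "deg_div Fq A \<le> deg_div Fq B"
proof -
  let ?S = "{P. A P \<noteq> 0} \<union> {P. B P \<noteq> 0}"
  have fin: "finite ?S" using assms by (auto simp: is_divisor_def)
  have "deg_div Fq A = (\<Sum>P\<in>?S. A P * int (deg_place Fq P))"
    "deg_div Fq B = (\<Sum>P\<in>?S. B P * int (deg_place Fq P))"
    by (rule deg_div_eq[OF fin]; simp)+
  moreover have "(\<Sum>P\<in>?S. A P * int (deg_place Fq P)) \<le> (\<Sum>P\<in>?S. B P * int (deg_place Fq P))"
    using assms(3) by (intro sum_mono mult_right_mono) auto
  ultimately show ?thesis by simp
qed

text \<open>Existence of poles enters here. L(0) is the base from which all spaces of effective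
  divisors are bounded.\<close>

lemma LL_0: "LL Fq (\<lambda>_. 0) = Fq"
proof (intro equalityI subsetI)
  fix f assume f: "f \<in> LL Fq (\<lambda>_. 0)"
  show "f \<in> Fq"
  proof (rule ccontr)
    assume nf: "f \<notin> Fq"
    then obtain P where P: "is_place Fq P" "P f < 0" using ex_pole by blast
    hence "f = 0" using f by (auto simp: LL_iff vge_def)
    thus False using nf by simp
  qed
qed (auto simp: LL_iff vge_Fq)

lemma card_le_fibres:
  assumes "finite T" "\<And>f. f \<in> V \<Longrightarrow> g f \<in> T" "finite N"
    and diff: "\<And>f f'. f \<in> V \<Longrightarrow> f' \<in> V \<Longrightarrow> g f = g f' \<Longrightarrow> f - f' \<in> (N :: 'K set)"
  shows "finite V \<and> card V \<le> card N * card T"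
proof -
  have fib: "finite {f \<in> V. g f = r} \<and> card {f \<in> V. g f = r} \<le> card N" for r
  proof (cases "\<exists>f0\<in>V. g f0 = r")
    case True
    then obtain f0 where f0: "f0 \<in> V" "g f0 = r" by blast
    have sub: "{f \<in> V. g f = r} \<subseteq> (\<lambda>a. a + f0) ` N"
    proof
      fix f assume "f \<in> {f \<in> V. g f = r}"
      hence "f - f0 \<in> N" using diff[of f f0] f0 by simp
      thus "f \<in> (\<lambda>a. a + f0) ` N" by (intro image_eqI[of _ _ "f - f0"]) auto
    qed
    have "card {f \<in> V. g f = r} \<le> card ((\<lambda>a. a + f0) ` N)" using sub assms by (intro card_mono) auto
    also have "\<dots> \<le> card N" using assms by (intro card_image_le)
    finally show ?thesis using finite_subset[OF sub] assms by auto
  next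
    case False
    hence "{f \<in> V. g f = r} = {}" by auto
    thus ?thesis by (simp only: card.empty) simp
  qed
  have V: "V = (\<Union>r\<in>T. {f \<in> V. g f = r})" using assms(2) by auto
  have "finite (\<Union>r\<in>T. {f \<in> V. g f = r})" using fib assms by (intro finite_UN_I) auto
  hence "finite V" using V by simp
  have "card V \<le> (\<Sum>r\<in>T. card {f \<in> V. g f = r})"
    using card_UN_le[OF assms(1), of "\<lambda>r. {f \<in> V. g f = r}"] V by simp
  also have "\<dots> \<le> (\<Sum>r\<in>T. card N)" using fib by (intro sum_mono) auto
  finally show ?thesis using \<open>finite V\<close> by (simp add: mult.commute)
qed

text \<open>Multiplication by a \<open>u\<close> of order A Q + 1 makes the functions integral at Q;
  two of them with the same residue differ by an element of L(A).\<close>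

lemma card_LL_Suc:
  assumes Q: "is_place Fq Q" and fin: "finite (LL Fq A)"
  shows "finite (LL Fq (A(Q := A Q + 1))) \<and>
    card (LL Fq (A(Q := A Q + 1))) \<le> card (LL Fq A) * q ^ deg_place Fq Q"
proof -
  let ?B = "A(Q := A Q + 1)"
  obtain u where u: "u \<noteq> 0" "Q u = A Q + 1" using place_surj[OF Q] by blast
  obtain T where T: "rep_set {a. vge Q a 0} {a. vge Q a 1} T" "card T = q ^ deg_place Fq Q"
    using ex_residue_reps[OF Q] by blast
  have "\<exists>r\<in>T. vge Q (u * f - r) 1" if f: "f \<in> LL Fq ?B" for f
  proof -
    have "vge Q f (- ?B Q)" using f Q by (auto simp: LL_iff)
    hence "vge Q (u * f) (Q u + - ?B Q)" by (rule vge_mult[OF Q vge_self])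
    hence "u * f \<in> {a. vge Q a 0}" using u by simp
    thus ?thesis using T(1) by (auto simp: rep_set_def)
  qed
  then obtain g where g: "\<And>f. f \<in> LL Fq ?B \<Longrightarrow> g f \<in> T" "\<And>f. f \<in> LL Fq ?B \<Longrightarrow> vge Q (u * f - g f) 1"
    by metis
  have "f - f' \<in> LL Fq A" if f: "f \<in> LL Fq ?B" "f' \<in> LL Fq ?B" "g f = g f'" for f f'
    unfolding LL_iff
  proof (intro allI impI)
    fix P assume P: "is_place Fq P"
    have d: "f - f' \<in> LL Fq ?B" using lsub_diff[OF lsub_LL f(1,2)] .
    show "vge P (f - f') (- A P)"
    proof (cases "P = Q")
      case False
      thus ?thesis using d P by (auto simp: LL_iff)
    next
      case True
      have "vge Q (u * f - g f - (u * f' - g f')) 1" by (rule vge_diff[OF Q g(2)[OF f(1)] g(2)[OF f(2)]])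
      hence "vge Q (u * (f - f')) 1" using f(3) by (simp add: algebra_simps)
      hence "vge Q (f - f') (- A Q)" using u
        by (cases "f = f'") (auto simp: vge_def place_mult[OF Q])
      thus ?thesis using True by simp
    qed
  qed
  moreover have "finite T" using T by (simp add: rep_set_def)
  ultimately show ?thesis using card_le_fibres[of T "LL Fq ?B" g "LL Fq A"] g(1) fin T(2) by metis
qed

lemma card_LL_plus:
  assumes Q: "is_place Fq Q" and fin: "finite (LL Fq A)"
  shows "finite (LL Fq (A(Q := A Q + int k))) \<and>
    card (LL Fq (A(Q := A Q + int k))) \<le> card (LL Fq A) * q ^ (k * deg_place Fq Q)"
proof (induction k)
  case 0
  show ?case using fin by simp
next
  case (Suc k)
  let ?A = "A(Q := A Q + int k)"
  have eq: "?A(Q := ?A Q + 1) = A(Q := A Q + int (Suc k))" by auto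
  have "finite (LL Fq (A(Q := A Q + int (Suc k)))) \<and>
    card (LL Fq (A(Q := A Q + int (Suc k)))) \<le> card (LL Fq ?A) * q ^ deg_place Fq Q"
    using card_LL_Suc[OF Q, of ?A] Suc unfolding eq by blast
  moreover have "card (LL Fq ?A) * q ^ deg_place Fq Q \<le>
      card (LL Fq A) * q ^ (k * deg_place Fq Q) * q ^ deg_place Fq Q"
    by (intro mult_right_mono conjunct2[OF Suc]) simp
  moreover have "card (LL Fq A) * q ^ (k * deg_place Fq Q) * q ^ deg_place Fq Q =
      card (LL Fq A) * q ^ (Suc k * deg_place Fq Q)" by (simp add: power_add mult_ac)
  ultimately show ?case by linarith
qed

lemma card_LL_le:
  assumes "finite S" "\<And>P. P \<in> S \<Longrightarrow> is_place Fq P" "\<And>P. P \<notin> S \<Longrightarrow> A P = B P" "\<And>P. A P \<le> B P"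
    "finite (LL Fq A)"
  shows "finite (LL Fq B) \<and>
    card (LL Fq B) \<le> card (LL Fq A) * q ^ (\<Sum>P\<in>S. nat (B P - A P) * deg_place Fq P)"
  using assms
proof (induction S arbitrary: A)
  case empty
  hence "A = B" by auto
  thus ?case using empty by simp
next
  case (insert Q S)
  let ?A = "A(Q := A Q + int (nat (B Q - A Q)))"
  have eq: "?A = A(Q := B Q)" using insert.prems(3)[of Q] by auto
  have 1: "finite (LL Fq ?A)"
    "card (LL Fq ?A) \<le> card (LL Fq A) * q ^ (nat (B Q - A Q) * deg_place Fq Q)"
    using card_LL_plus[of Q A "nat (B Q - A Q)"] insert.prems by auto
  have 2: "finite (LL Fq B) \<and>
    card (LL Fq B) \<le> card (LL Fq ?A) * q ^ (\<Sum>P\<in>S. nat (B P - ?A P) * deg_place Fq P)"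
  proof (rule insert.IH[OF _ _ _ 1(1)])
    fix P
    show "?A P \<le> B P" unfolding eq using insert.prems(3)[of P] by simp
    show "is_place Fq P" if "P \<in> S" using insert.prems(1) that by blast
    show "?A P = B P" if "P \<notin> S" unfolding eq using insert.prems(2)[of P] that by simp
  qed
  have "(\<Sum>P\<in>S. nat (B P - ?A P) * deg_place Fq P) = (\<Sum>P\<in>S. nat (B P - A P) * deg_place Fq P)"
    using insert.hyps by (intro sum.cong) auto
  hence "card (LL Fq B) \<le> card (LL Fq ?A) * q ^ (\<Sum>P\<in>S. nat (B P - A P) * deg_place Fq P)"
    using 2 by simp
  also have "\<dots> \<le> (card (LL Fq A) * q ^ (nat (B Q - A Q) * deg_place Fq Q)) *
      q ^ (\<Sum>P\<in>S. nat (B P - A P) * deg_place Fq P)" using 1(2) by (rule mult_right_mono) simp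
  also have "\<dots> = card (LL Fq A) * q ^ (\<Sum>P\<in>insert Q S. nat (B P - A P) * deg_place Fq P)"
    using insert.hyps by (simp add: power_add mult_ac)
  finally show ?case using 2 by blast
qed

lemma finite_LL:
  assumes "is_divisor Fq A"
  shows "finite (LL Fq A)"
proof -
  have "LL Fq A \<subseteq> LL Fq (\<lambda>P. max (A P) 0)" by (rule LL_mono) simp
  moreover have "finite (LL Fq (\<lambda>P. max (A P) 0))"
    using card_LL_le[of "{P. A P \<noteq> 0}" "\<lambda>_. 0" "\<lambda>P. max (A P) 0"] assms
    by (auto simp: LL_0 is_divisor_def)
  ultimately show ?thesis by (rule finite_subset)
qed

lemma card_LL:
  assumes "is_divisor Fq A"
  shows "card (LL Fq A) = q ^ ell Fq A"
proof -
  obtain d where d: "card (LL Fq A) = q ^ d" using finite_lsub_card[OF lsub_LL finite_LL[OF assms]] .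
  thus ?thesis using fdim_eqI[OF d] by (simp add: ell_def)
qed

lemma ell_0: "ell Fq (\<lambda>_. 0) = 1"
  unfolding ell_def LL_0 by (rule fdim_eqI) simp

lemma q_power_le_iff: "q ^ a \<le> q ^ b \<longleftrightarrow> a \<le> b"
  using q_ge_2 by simp

lemma ell_mono:
  assumes "is_divisor Fq A" "is_divisor Fq B" "\<And>P. A P \<le> B P"
  shows "ell Fq A \<le> ell Fq B"
  using card_mono[OF finite_LL[OF assms(2)] LL_mono[of A B]] assms card_LL[OF assms(1)] card_LL[OF assms(2)]
  by (simp add: q_power_le_iff)

lemma ell_le_deg:
  assumes A: "is_divisor Fq A" and B: "is_divisor Fq B" and le: "\<And>P. A P \<le> B P"
  shows "int (ell Fq B) \<le> int (ell Fq A) + deg_div Fq B - deg_div Fq A"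
proof -
  let ?S = "{P. A P \<noteq> 0} \<union> {P. B P \<noteq> 0}"
  let ?e = "\<Sum>P\<in>?S. nat (B P - A P) * deg_place Fq P"
  have fin: "finite ?S" and pl: "\<And>P. P \<in> ?S \<Longrightarrow> is_place Fq P" using A B by (auto simp: is_divisor_def)
  have "card (LL Fq B) \<le> card (LL Fq A) * q ^ ?e"
    by (rule conjunct2[OF card_LL_le[OF fin pl _ le finite_LL[OF A]]]) auto
  hence "q ^ ell Fq B \<le> q ^ (ell Fq A + ?e)" by (simp add: card_LL A B power_add)
  hence le': "ell Fq B \<le> ell Fq A + ?e" by (simp only: q_power_le_iff)
  have "int ?e = (\<Sum>P\<in>?S. (B P - A P) * int (deg_place Fq P))"
    using le by (simp add: of_nat_sum)
  moreover have "deg_div Fq A = (\<Sum>P\<in>?S. A P * int (deg_place Fq P))"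
    "deg_div Fq B = (\<Sum>P\<in>?S. B P * int (deg_place Fq P))"
    by (rule deg_div_eq[OF fin]; simp)+
  ultimately have "int ?e = deg_div Fq B - deg_div Fq A"
    by (simp only: left_diff_distrib sum_subtractf)
  thus ?thesis using le' by linarith
qed

section \<open>Degrees of pole divisors and principal divisors\<close>

definition pole_div :: "'K \<Rightarrow> 'K divisor" where
  "pole_div x P = (if is_place Fq P \<and> P x < 0 then - P x else 0)"

lemma is_divisor_pole_div: "x \<notin> Fq \<Longrightarrow> is_divisor Fq (pole_div x)"
  by (rule is_divisor_subset[OF finite_poles]) (auto simp: pole_div_def)

lemma deg_pole_div_le:
  assumes x: "x \<notin> Fq"
  shows "deg_div Fq (pole_div x) \<le> int (ext_deg x)"
proof -
  let ?S = "{P. is_place Fq P \<and> P x < 0}"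
  have x0: "x \<noteq> 0" using x by auto
  have "deg_div Fq (pole_div x) = (\<Sum>P\<in>?S. pole_div x P * int (deg_place Fq P))"
    by (rule deg_div_eq[OF finite_poles[OF x]]) (auto simp: pole_div_def)
  also have "\<dots> = int (\<Sum>P\<in>?S. nat (- P x) * deg_place Fq P)"
    by (auto simp: pole_div_def intro!: sum.cong)
  also have "\<dots> \<le> int (ext_deg x)"
    unfolding of_nat_le_iff by (rule sum_poles_le[OF x0 Dep_ext_deg finite_poles[OF x]]) auto
  finally show ?thesis .
qed

text \<open>The powers of \<open>u\<close> satisfy a relation over Fq[x]; multiplying
  \<open>u\<close> by its leading coefficient gives an element integral over Fq[x], which has no
  poles where \<open>x\<close> has none.\<close>

lemma ex_integral_multiple:
  assumes x: "x \<notin> Fq"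
  shows "\<exists>p. poly_over Fq p \<and> p \<noteq> 0 \<and> (\<forall>P. is_place Fq P \<longrightarrow> vge P x 0 \<longrightarrow> vge P (poly p x * u) 0)"
proof -
  obtain M where "Dep x M" using ex_Dep by blast
  then obtain p where p: "\<forall>j<M. poly_over Fq (p j)" "\<exists>j<M. p j \<noteq> 0" "(\<Sum>j<M. poly (p j) x * u ^ j) = 0"
    unfolding Dep_def by (elim allE[of _ "\<lambda>j. u ^ j"]) blast
  define Q where "Q i \<longleftrightarrow> i < M \<and> p i \<noteq> 0" for i
  define d where "d = (GREATEST i. Q i)"
  obtain i0 where i0: "Q i0" using p by (auto simp: Q_def)
  have bd: "i \<le> M" if "Q i" for i using that by (auto simp: Q_def)
  have Qd: "Q d" unfolding d_def using i0 bd by (rule GreatestI_nat)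
  have le: "i \<le> d" if "Q i" for i unfolding d_def using that bd by (rule Greatest_le_nat)
  have dM: "d < M" and pd: "p d \<noteq> 0" using Qd by (auto simp: Q_def)
  have po: "poly_over Fq (p i)" if "i \<le> d" for i using p(1) dM that by auto
  have "(\<Sum>j<M. poly (p j) x * u ^ j) = (\<Sum>j<Suc d. poly (p j) x * u ^ j)"
    using le dM by (intro sum.mono_neutral_right) (force simp: Q_def less_Suc_eq_le)+
  hence s0: "(\<Sum>j<d. poly (p j) x * u ^ j) + poly (p d) x * u ^ d = 0" using p(3) by simp
  define a where "a = poly (p d) x"
  have a0: "a \<noteq> 0" unfolding a_def using transcendental[OF x po pd] by simp
  have d0: "d > 0"
  proof (rule ccontr)
    assume "\<not> 0 < d"
    thus False using s0 a0 by (simp add: a_def)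
  qed
  define w where "w = a * u"
  \<comment> \<open>This factor turns the relation for \<open>u\<close> into a monic one of degree d
    for w = a u.\<close>
  have "a ^ (d - 1) * ((\<Sum>j<d. poly (p j) x * u ^ j) + a * u ^ d) = 0" using s0 by (simp add: a_def)
  moreover have tm: "a ^ (d - 1) * (poly (p j) x * u ^ j) = a ^ (d - 1 - j) * poly (p j) x * w ^ j" if "j < d" for j
  proof -
    have "a ^ (d - 1) = a ^ (d - 1 - j) * a ^ j" using that by (simp flip: power_add)
    thus ?thesis by (simp add: w_def power_mult_distrib mult_ac)
  qed
  have "a ^ (d - 1) * (\<Sum>j<d. poly (p j) x * u ^ j) = (\<Sum>j<d. a ^ (d - 1 - j) * poly (p j) x * w ^ j)"
    unfolding sum_distrib_left by (intro sum.cong refl tm) simp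
  moreover have "a ^ (d - 1) * (a * u ^ d) = w ^ d"
    using d0 by (cases d) (auto simp: w_def power_mult_distrib)
  ultimately have wd: "w ^ d = - (\<Sum>j<d. a ^ (d - 1 - j) * poly (p j) x * w ^ j)"
    by (simp add: distrib_left eq_neg_iff_add_eq_0 add.commute)
  have "vge P w 0" if P: "is_place Fq P" and Px: "vge P x 0" for P
  proof (rule ccontr)
    assume "\<not> vge P w 0"
    hence w0: "w \<noteq> 0" and wn: "P w < 0" by (auto simp: vge_def)
    \<comment> \<open>At a pole of w every lower term has order at least (d - 1) P(w), whereas w^d
      has the smaller order d P(w).\<close>
    have "vge P (\<Sum>j<d. a ^ (d - 1 - j) * poly (p j) x * w ^ j) (int (d - 1) * P w)"
    proof (rule vge_sum[OF P])
      fix j assume "j \<in> {..<d}"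
      hence j: "j < d" by simp
      have "vge P (a ^ (d - 1 - j) * poly (p j) x) (0 + 0)"
        using j unfolding a_def by (intro vge_mult[OF P] vge_power[OF P] vge_poly[OF P] po Px) auto
      hence "vge P (a ^ (d - 1 - j) * poly (p j) x * w ^ j) (0 + 0 + P (w ^ j))"
        by (rule vge_mult[OF P _ vge_self])
      moreover have "int (d - 1) * P w \<le> 0 + 0 + P (w ^ j)"
        using j wn w0 by (simp add: place_power[OF P] mult_right_mono_neg)
      ultimately show "vge P (a ^ (d - 1 - j) * poly (p j) x * w ^ j) (int (d - 1) * P w)"
        by (rule vge_mono)
    qed
    hence "vge P (w ^ d) (int (d - 1) * P w)" unfolding wd by (rule vge_uminus[OF P])
    hence "int (d - 1) * P w \<le> int d * P w" using w0 by (simp add: vge_def place_power[OF P])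
    moreover have "int d * P w = int (d - 1) * P w + P w"
      using d0 by (cases d) (auto simp: algebra_simps)
    ultimately show False using wn by linarith
  qed
  thus ?thesis using po[of d] pd by (intro exI[of _ "p d"]) (auto simp: w_def a_def)
qed

text \<open>Make a maximal family independent over Fq[x] integral, giving w_j whose poles all lie
  over poles of \<open>x\<close>, and let \<open>C\<close> bound those poles. The functions x^i w_j
  with i \<le> r lie in L(rB + C) and are independent over Fq.\<close>

lemma ex_large_divisor:
  assumes x: "x \<notin> Fq"
  shows "\<exists>C. is_divisor Fq C \<and> (\<forall>P. 0 \<le> C P) \<and>
    (\<forall>r. ell Fq (\<lambda>P. int r * pole_div x P + C P) \<ge> ext_deg x * Suc r)"
proof -
  define n where "n = ext_deg x"
  obtain u where u: "\<And>p. (\<forall>j<n. poly_over Fq (p j)) \<Longrightarrow> (\<Sum>j<n. poly (p j) x * u j) = 0 \<Longrightarrow> (\<forall>j<n. p j = 0)"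
    using not_Dep_ext_deg[of x] unfolding Dep_def n_def by blast
  have "\<forall>j. \<exists>p. poly_over Fq p \<and> p \<noteq> 0 \<and> (\<forall>P. is_place Fq P \<longrightarrow> vge P x 0 \<longrightarrow> vge P (poly p x * u j) 0)"
    using ex_integral_multiple[OF x] by blast
  then obtain a where a: "\<And>j. poly_over Fq (a j)" "\<And>j. a j \<noteq> 0"
    "\<And>j P. is_place Fq P \<Longrightarrow> vge P x 0 \<Longrightarrow> vge P (poly (a j) x * u j) 0"
    by metis
  define w where "w j = poly (a j) x * u j" for j
  have x0: "x \<noteq> 0" using x by auto
  define C where "C P = (if is_place Fq P \<and> P x < 0 then (\<Sum>j<n. \<bar>P (w j)\<bar>) else 0)" for P
  have "is_divisor Fq C"
    by (rule is_divisor_subset[OF finite_poles[OF x]]) (auto simp: C_def)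
  moreover have "\<forall>P. 0 \<le> C P" by (auto simp: C_def intro: sum_nonneg)
  moreover have "ell Fq (\<lambda>P. int r * pole_div x P + C P) \<ge> n * Suc r" for r
  proof -
    let ?H = "\<lambda>P. int r * pole_div x P + C P"
    have H: "is_divisor Fq ?H"
      using is_divisor_add[OF is_divisor_scale[OF is_divisor_pole_div[OF x]] \<open>is_divisor Fq C\<close>] .
    let ?D = "PiE {..<n} (\<lambda>_. polys_lt (Suc r))"
    let ?F = "\<lambda>p. \<Sum>j<n. poly (p j) x * w j"
    have mon: "x ^ i * w j \<in> LL Fq ?H" if ij: "i \<le> r" "j < n" for i j
      unfolding LL_iff
    proof (intro allI impI)
      fix P assume P: "is_place Fq P"
      show "vge P (x ^ i * w j) (- ?H P)"
      proof (cases "P x < 0")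
        case True
        have "\<bar>P (w j)\<bar> \<le> (\<Sum>j<n. \<bar>P (w j)\<bar>)" using ij by (intro member_le_sum) auto
        moreover have "int r * P x \<le> int i * P x" using ij True by (intro mult_right_mono_neg) auto
        moreover have "- ?H P = int r * P x - (\<Sum>j<n. \<bar>P (w j)\<bar>)"
          using True P by (simp add: C_def pole_div_def)
        moreover have "P (x ^ i) = int i * P x" using x0 by (simp add: place_power[OF P])
        ultimately have "- ?H P \<le> P (x ^ i) + P (w j)" by linarith
        thus ?thesis by (rule vge_mono[OF vge_mult[OF P vge_self vge_self]])
      next
        case False
        hence "vge P x 0" by (simp add: vge_def)
        hence "vge P (x ^ i * w j) (0 + 0)"
          using a(3)[OF P, of j] by (intro vge_mult[OF P] vge_power[OF P]) (auto simp: w_def)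
        thus ?thesis using False by (simp add: C_def pole_div_def)
      qed
    qed
    have "?F ` ?D \<subseteq> LL Fq ?H"
    proof (intro subsetI, elim imageE)
      fix f p assume f: "f = ?F p" and p: "p \<in> ?D"
      have "poly (p j) x * w j \<in> LL Fq ?H" if j: "j < n" for j
      proof -
        have pj: "poly_over Fq (p j)" "\<And>i. i \<ge> Suc r \<Longrightarrow> coeff (p j) i = 0"
          using p j by (auto simp: polys_lt_def PiE_def Pi_def)
        have "degree (p j) \<le> r" using pj(2) by (intro degree_le) auto
        hence "poly (p j) x * w j = (\<Sum>i\<le>r. coeff (p j) i * (x ^ i * w j))"
          by (simp add: poly_altdef_le sum_distrib_right mult.assoc)
        also have "\<dots> \<in> LL Fq ?H"
        proof (rule lsub_sum[OF lsub_LL])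
          fix i assume "i \<in> {..r}"
          thus "coeff (p j) i * (x ^ i * w j) \<in> LL Fq ?H"
            using mon[of i j] j pj(1) by (intro lsub_scale[OF lsub_LL, of "coeff (p j) i"]) (auto simp: poly_over_def)
        qed
        finally show ?thesis .
      qed
      thus "f \<in> LL Fq ?H" unfolding f by (intro lsub_sum[OF lsub_LL]) auto
    qed
    moreover have "inj_on ?F ?D"
    proof (rule inj_onI)
      fix p p' assume pp: "p \<in> ?D" "p' \<in> ?D" "?F p = ?F p'"
      have "(\<Sum>j<n. poly ((p j - p' j) * a j) x * u j) = ?F p - ?F p'"
        by (simp add: w_def algebra_simps sum_subtractf)
      hence "(\<Sum>j<n. poly ((p j - p' j) * a j) x * u j) = 0" using pp(3) by simp
      moreover have "\<forall>j<n. poly_over Fq ((p j - p' j) * a j)"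
        using pp a by (auto simp: polys_lt_def PiE_def Pi_def intro!: poly_over_mult poly_over_diff)
      ultimately have "\<forall>j<n. (p j - p' j) * a j = 0" using u[of "\<lambda>j. (p j - p' j) * a j"] by blast
      hence "\<forall>j<n. p j = p' j" using a(2) by simp
      thus "p = p'" using pp by (intro PiE_ext[of p "{..<n}" "\<lambda>_. polys_lt (Suc r)" p']) auto
    qed
    ultimately have "card ?D \<le> card (LL Fq ?H)" using card_inj_on_le finite_LL[OF H] by blast
    moreover have "card ?D = q ^ (n * Suc r)"
      using card_polys_lt[of "Suc r"] by (simp add: card_PiE power_mult[symmetric] mult.commute del: power_Suc mult_Suc_right)
    ultimately show ?thesis using card_LL[OF H] by (simp only: q_power_le_iff)
  qed
  ultimately show ?thesis unfolding n_def by blast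
qed

text \<open>With d = \<open>ext_deg x\<close>, the bounds d(r + 1) \<le> ell(rB + C) \<le> 1 + r deg
  B + deg C hold for every r. If deg B \<le> d - 1, they give d + r \<le> 1 + deg C, which fails
  once r > deg C.\<close>

lemma deg_pole_div:
  assumes x: "x \<notin> Fq"
  shows "deg_div Fq (pole_div x) = int (ext_deg x)"
proof (rule antisym[OF deg_pole_div_le[OF x]], rule ccontr)
  assume "\<not> int (ext_deg x) \<le> deg_div Fq (pole_div x)"
  hence lt: "deg_div Fq (pole_div x) \<le> int (ext_deg x) - 1" by simp
  obtain C where C: "is_divisor Fq C" "\<forall>P. 0 \<le> C P"
    "\<forall>r. ell Fq (\<lambda>P. int r * pole_div x P + C P) \<ge> ext_deg x * Suc r"
    using ex_large_divisor[OF x] by blast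
  define r where "r = Suc (nat (deg_div Fq C))"
  let ?B = "pole_div x"
  let ?H = "\<lambda>P. int r * pole_div x P + C P"
  note B = is_divisor_pole_div[OF x]
  have H: "is_divisor Fq ?H" using is_divisor_add[OF is_divisor_scale[OF B] C(1)] .
  have "int (ell Fq ?H) \<le> 1 + deg_div Fq ?H"
    using ell_le_deg[OF is_divisor_0 H] C(2) by (simp add: ell_0 deg_div_0 pole_div_def)
  also have "deg_div Fq ?H = int r * deg_div Fq ?B + deg_div Fq C"
    by (simp add: deg_div_add[OF is_divisor_scale[OF B] C(1)] deg_div_scale[OF B])
  also have "int r * deg_div Fq ?B \<le> int r * (int (ext_deg x) - 1)" using lt by (intro mult_left_mono) auto
  finally have "int (ell Fq ?H) \<le> 1 + (int r * (int (ext_deg x) - 1) + deg_div Fq C)" by simp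
  moreover have "int (ext_deg x * Suc r) \<le> int (ell Fq ?H)" using C(3) by (simp only: of_nat_le_iff)
  moreover have "ext_deg x \<ge> 1" using ext_deg_pos[OF x] .
  moreover have "deg_div Fq C < int r" by (simp add: r_def)
  ultimately show False by (simp add: algebra_simps)
qed

definition principal :: "'K \<Rightarrow> 'K divisor" where
  "principal z P = (if is_place Fq P then P z else 0)"

text \<open>Zeros of \<open>z\<close> are poles of 1/z, and both pole divisors have degree
  \<open>ext_deg z\<close>.\<close>

lemma principal_divisor:
  assumes z: "z \<noteq> 0"
  shows "is_divisor Fq (principal z)" "deg_div Fq (principal z) = 0"
proof -
  have "is_divisor Fq (principal z) \<and> deg_div Fq (principal z) = 0"
  proof (cases "z \<in> Fq")
    case True
    hence "principal z = (\<lambda>_. 0)" by (auto simp: principal_def place_Fq)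
    thus ?thesis by (simp add: is_divisor_0 deg_div_0)
  next
    case False
    hence y: "inverse z \<notin> Fq" using Fq_inverse[of "inverse z"] by auto
    have eq: "principal z = (\<lambda>P. pole_div (inverse z) P - pole_div z P)"
      by (auto simp: principal_def pole_div_def place_inverse)
    show ?thesis unfolding eq
      using is_divisor_diff deg_div_diff is_divisor_pole_div[OF False] is_divisor_pole_div[OF y]
      by (simp add: deg_pole_div[OF False] deg_pole_div[OF y] ext_deg_inverse[OF z])
  qed
  thus "is_divisor Fq (principal z)" "deg_div Fq (principal z) = 0" by auto
qed

lemma LL_deg_nonneg:
  assumes A: "is_divisor Fq A" and f: "f \<in> LL Fq A" "f \<noteq> 0"
  shows "deg_div Fq A \<ge> 0"
proof -
  have "0 \<le> A P + principal f P" for P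
  proof (cases "is_place Fq P")
    case True
    thus ?thesis using f by (auto simp: LL_iff vge_def principal_def)
  next
    case False
    hence "A P = 0" using A by (auto simp: is_divisor_def)
    thus ?thesis using False by (simp add: principal_def)
  qed
  hence "deg_div Fq (\<lambda>_. 0) \<le> deg_div Fq (\<lambda>P. A P + principal f P)"
    using A principal_divisor[OF f(2)] by (intro deg_div_mono is_divisor_0 is_divisor_add)
  thus ?thesis using A principal_divisor[OF f(2)] by (simp add: deg_div_add deg_div_0)
qed

lemma ell_pos_iff:
  assumes "is_divisor Fq A"
  shows "ell Fq A \<ge> 1 \<longleftrightarrow> (\<exists>f\<in>LL Fq A. f \<noteq> 0)"
proof
  assume "ell Fq A \<ge> 1"
  hence "q ^ 1 \<le> card (LL Fq A)" by (simp only: card_LL[OF assms] q_power_le_iff)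
  hence "2 \<le> card (LL Fq A)" using q_ge_2 by simp
  moreover have "card (LL Fq A) \<le> 1" if "LL Fq A \<subseteq> {0}"
    using card_mono[OF _ that] by simp
  ultimately show "\<exists>f\<in>LL Fq A. f \<noteq> 0" by force
next
  assume "\<exists>f\<in>LL Fq A. f \<noteq> 0"
  then obtain f where f: "f \<in> LL Fq A" "f \<noteq> 0" by blast
  hence "card {0, f} \<le> card (LL Fq A)"
    using lsub_0[OF lsub_LL] by (intro card_mono finite_LL[OF assms]) auto
  hence "card (LL Fq A) \<ge> 2" using f by simp
  thus "ell Fq A \<ge> 1" using card_LL[OF assms] by (cases "ell Fq A") auto
qed

lemma ell_eq_0: "is_divisor Fq A \<Longrightarrow> deg_div Fq A < 0 \<Longrightarrow> ell Fq A = 0"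
  using LL_deg_nonneg[of A] ell_pos_iff[of A] by force

lemma ex_nonconstant: "\<exists>x. x \<notin> Fq"
proof -
  obtain x where x: "\<not> algebraic_over Fq x" using ff by (auto simp: function_field_def)
  have "x \<notin> Fq"
  proof
    assume "x \<in> Fq"
    hence "poly_over Fq [:- x, 1:]" by (simp add: poly_over_pCons Fq_uminus)
    thus False using x by (auto simp: algebraic_over_def intro!: exI[of _ "[:- x, 1:]"])
  qed
  thus ?thesis by blast
qed

section \<open>Riemann's inequality and finiteness of the genus\<close>

text \<open>The quantity deg - ell is monotone in the divisor, does not increase on passing from D
  to an effective A1 that differs from it by a principal divisor as below, and is at most deg C on H
  = rB + C. It therefore suffices to place some A1 - (z) below H, with A1 the positive part of A;
  \<open>C\<close> depends only on the fixed \<open>x\<close>, so the bound is uniform.\<close>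

lemma riemann_inequality: "\<exists>\<gamma>. \<forall>A. is_divisor Fq A \<longrightarrow> deg_div Fq A - int (ell Fq A) \<le> \<gamma>"
proof -
  obtain x where x: "x \<notin> Fq" using ex_nonconstant by blast
  obtain C where C: "is_divisor Fq C" "\<forall>P. 0 \<le> C P"
    "\<forall>r. ell Fq (\<lambda>P. int r * pole_div x P + C P) \<ge> ext_deg x * Suc r"
    using ex_large_divisor[OF x] by blast
  note B = is_divisor_pole_div[OF x]
  have n1: "ext_deg x \<ge> 1" using ext_deg_pos[OF x] .
  have "deg_div Fq A - int (ell Fq A) \<le> deg_div Fq C" if A: "is_divisor Fq A" for A
  proof -
    define A1 where "A1 P = max (A P) 0" for P
    have A1: "is_divisor Fq A1" unfolding A1_def using is_divisor_max_0[OF A] .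
    \<comment> \<open>With r = deg A1, passing from H to H - A1 costs at most r dimensions, and at
      least d(r + 1) - r \<ge> 1 remain, where d = \<open>ext_deg x\<close>. A nonzero
      \<open>z\<close> there satisfies A1 - (z) \<le> H.\<close>
    define r where "r = nat (deg_div Fq A1)"
    have "0 \<le> deg_div Fq A1" using deg_div_mono[OF is_divisor_0 A1] by (simp add: deg_div_0 A1_def)
    hence r: "int r = deg_div Fq A1" by (simp add: r_def)
    define H where "H P = int r * pole_div x P + C P" for P
    have H: "is_divisor Fq H" unfolding H_def using is_divisor_add[OF is_divisor_scale[OF B] C(1)] .
    have degH: "deg_div Fq H = int r * int (ext_deg x) + deg_div Fq C"
      unfolding H_def
      by (simp add: deg_div_add[OF is_divisor_scale[OF B] C(1)] deg_div_scale[OF B] deg_pole_div[OF x])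
    have "ext_deg x * Suc r \<le> ell Fq H" using C(3) unfolding H_def by blast
    hence ellH: "int (ext_deg x) * int r + int (ext_deg x) \<le> int (ell Fq H)"
      by (simp only: of_nat_le_iff[symmetric, where 'a = int] of_nat_mult of_nat_Suc distrib_left mult_1_right)
    have HA: "is_divisor Fq (\<lambda>P. H P - A1 P)" using is_divisor_diff[OF H A1] .
    have "int (ell Fq H) \<le> int (ell Fq (\<lambda>P. H P - A1 P)) + deg_div Fq H - deg_div Fq (\<lambda>P. H P - A1 P)"
      by (rule ell_le_deg[OF HA H]) (simp add: A1_def)
    hence "int (ell Fq H) \<le> int (ell Fq (\<lambda>P. H P - A1 P)) + int r"
      by (simp add: deg_div_diff[OF H A1] r)
    moreover have "int r \<le> int (ext_deg x) * int r" using n1 by (cases "r = 0") auto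
    ultimately have "ell Fq (\<lambda>P. H P - A1 P) \<ge> 1" using ellH n1 by linarith
    then obtain z where z: "z \<in> LL Fq (\<lambda>P. H P - A1 P)" "z \<noteq> 0" using ell_pos_iff[OF HA] by blast
    define D where "D P = A1 P - principal z P" for P
    note pz = principal_divisor[OF z(2)]
    have D: "is_divisor Fq D" unfolding D_def using is_divisor_diff[OF A1 pz(1)] .
    have degD: "deg_div Fq D = deg_div Fq A1" unfolding D_def using deg_div_diff[OF A1 pz(1)] pz(2) by simp
    have "D P \<le> H P" for P
    proof (cases "is_place Fq P")
      case True
      hence "vge P z (- (H P - A1 P))" using z(1) by (simp add: LL_iff)
      thus ?thesis using z(2) True by (simp add: vge_def D_def principal_def)
    next
      case False
      hence "D P = 0" "H P = 0" using D H by (auto simp: is_divisor_def)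
      thus ?thesis by simp
    qed
    hence 1: "int (ell Fq H) \<le> int (ell Fq D) + deg_div Fq H - deg_div Fq D" by (rule ell_le_deg[OF D H])
    have "(\<lambda>g. inverse z * g) ` LL Fq D \<subseteq> LL Fq A1"
    proof (intro subsetI, elim imageE)
      fix f g assume f: "f = inverse z * g" and g: "g \<in> LL Fq D"
      show "f \<in> LL Fq A1" unfolding LL_iff
      proof (intro allI impI)
        fix P assume P: "is_place Fq P"
        have "vge P g (- D P)" using g P by (simp add: LL_iff)
        hence "vge P f (P (inverse z) + - D P)" unfolding f by (rule vge_mult[OF P vge_self])
        thus "vge P f (- A1 P)" using P by (simp add: D_def principal_def place_inverse[OF P])
      qed
    qed
    moreover have "inj_on (\<lambda>g. inverse z * g) (LL Fq D)" using z(2) by (auto simp: inj_on_def)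
    ultimately have "card (LL Fq D) \<le> card (LL Fq A1)" using card_inj_on_le finite_LL[OF A1] by blast
    hence 2: "ell Fq D \<le> ell Fq A1" by (simp only: card_LL[OF D] card_LL[OF A1] q_power_le_iff)
    have 3: "int (ell Fq A1) \<le> int (ell Fq A) + deg_div Fq A1 - deg_div Fq A"
      by (rule ell_le_deg[OF A A1]) (simp add: A1_def)
    show ?thesis using 1 2 3 degD degH ellH by (simp add: mult.commute)
  qed
  thus ?thesis by blast
qed

lemma riemann_genus:
  assumes "is_divisor Fq A"
  shows "deg_div Fq A + 1 - genus Fq \<le> int (ell Fq A)"
proof -
  obtain \<gamma> where \<gamma>: "\<And>A. is_divisor Fq A \<Longrightarrow> deg_div Fq A - int (ell Fq A) \<le> \<gamma>"
    using riemann_inequality by blast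
  have "bdd_above ((\<lambda>A. deg_div Fq A - int (ell Fq A) + 1) ` {A. is_divisor Fq A})"
    using \<gamma> by (intro bdd_aboveI[of _ "\<gamma> + 1"]) auto
  hence "deg_div Fq A - int (ell Fq A) + 1 \<le> genus Fq"
    unfolding genus_def using assms by (intro cSUP_upper) auto
  thus ?thesis by simp
qed

lemma ex_ell_ge: "\<exists>A. is_divisor Fq A \<and> ell Fq A \<ge> i"
proof -
  obtain x where x: "x \<notin> Fq" using ex_nonconstant by blast
  obtain C where C: "is_divisor Fq C"
    "\<forall>r. ell Fq (\<lambda>P. int r * pole_div x P + C P) \<ge> ext_deg x * Suc r"
    using ex_large_divisor[OF x] by blast
  have "i \<le> ext_deg x * Suc i" using ext_deg_pos[OF x] by (cases "ext_deg x") auto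
  also have "\<dots> \<le> ell Fq (\<lambda>P. int i * pole_div x P + C P)" using C by blast
  finally show ?thesis
    using is_divisor_add[OF is_divisor_scale[OF is_divisor_pole_div[OF x]] C(1)] by blast
qed

subsection \<open>Gonality, evaluation codes and the bound\<close>

definition point_sum :: "('K \<Rightarrow> int) set \<Rightarrow> 'K divisor" where
  "point_sum T P = (if P \<in> T then 1 else 0)"

lemma is_divisor_point_sum:
  "finite T \<Longrightarrow> (\<And>P. P \<in> T \<Longrightarrow> rational_place Fq P) \<Longrightarrow> is_divisor Fq (point_sum T)"
  by (rule is_divisor_subset[of T]) (auto simp: point_sum_def rational_place_def)

lemma deg_div_point_sum:
  assumes "finite T" "\<And>P. P \<in> T \<Longrightarrow> rational_place Fq P"
  shows "deg_div Fq (point_sum T) = int (card T)"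
proof -
  have "deg_div Fq (point_sum T) = (\<Sum>P\<in>T. point_sum T P * int (deg_place Fq P))"
    by (rule deg_div_eq[OF assms(1)]) (simp add: point_sum_def)
  also have "\<dots> = (\<Sum>P\<in>T. 1)"
    using assms(2) by (intro sum.cong) (auto simp: point_sum_def rational_place_def)
  finally show ?thesis by simp
qed

text \<open>Removing deg A + 1 copies of a rational point reaches degree -1, where the space is
  zero, and costs at most one dimension per copy.\<close>

lemma ell_le_deg_Suc:
  assumes Q: "rational_place Fq Q" and A: "is_divisor Fq A" and deg: "deg_div Fq A \<ge> -1"
  shows "int (ell Fq A) \<le> deg_div Fq A + 1"
proof -
  let ?k = "deg_div Fq A + 1"
  let ?E = "\<lambda>P. ?k * point_sum {Q} P"
  have E: "is_divisor Fq ?E" using Q by (intro is_divisor_scale is_divisor_point_sum) auto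
  have degE: "deg_div Fq ?E = ?k"
    using Q deg_div_scale[OF is_divisor_point_sum[of "{Q}"], of ?k] deg_div_point_sum[of "{Q}"] by simp
  let ?B = "\<lambda>P. A P - ?E P"
  have B: "is_divisor Fq ?B" by (rule is_divisor_diff[OF A E])
  have degB: "deg_div Fq ?B = -1" using deg_div_diff[OF A E] degE by simp
  hence "ell Fq ?B = 0" using ell_eq_0[OF B] by simp
  moreover have "int (ell Fq A) \<le> int (ell Fq ?B) + deg_div Fq A - deg_div Fq ?B"
    by (rule ell_le_deg[OF B A]) (use deg in \<open>simp add: point_sum_def\<close>)
  ultimately show ?thesis using degB by simp
qed

text \<open>The infimum is a lower bound because i \<ge> 1 forces a nonzero function, so all degrees
  in question are nonnegative.\<close>

lemma gonality_le:
  assumes "i \<ge> 1" "is_divisor Fq A" "ell Fq A \<ge> i"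
  shows "gonality Fq i \<le> deg_div Fq A"
  unfolding gonality_def
proof (rule cINF_lower)
  show "bdd_below (deg_div Fq ` {A. is_divisor Fq A \<and> i \<le> ell Fq A})"
  proof (rule bdd_belowI)
    fix d assume "d \<in> deg_div Fq ` {A. is_divisor Fq A \<and> i \<le> ell Fq A}"
    then obtain A where A: "is_divisor Fq A" "i \<le> ell Fq A" "d = deg_div Fq A" by blast
    hence "ell Fq A \<ge> 1" using assms(1) by simp
    then obtain f where "f \<in> LL Fq A" "f \<noteq> 0" using ell_pos_iff[OF A(1)] by blast
    thus "0 \<le> d" using LL_deg_nonneg[OF A(1)] A(3) by blast
  qed
qed (use assms in auto)

text \<open>Bounds the set whose supremum defines \<open>ell_tilde\<close>. Over the integers, an
  infimum below a + 1 yields a divisor of degree at most a.\<close>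

lemma gonality_le_imp:
  assumes Q: "rational_place Fq Q" and i: "i \<ge> 1" and le: "gonality Fq i \<le> a"
  shows "int i \<le> a + 1"
proof -
  let ?X = "deg_div Fq ` {A. is_divisor Fq A \<and> i \<le> ell Fq A}"
  have ne: "?X \<noteq> {}" using ex_ell_ge[of i] by auto
  have lt: "Inf ?X < a + 1" using le by (simp add: gonality_def)
  obtain d where "d \<in> ?X" "d < a + 1" using cInf_lessD[OF ne lt] by blast
  then obtain A where A: "is_divisor Fq A" "i \<le> ell Fq A" "deg_div Fq A < a + 1" by blast
  have "ell Fq A \<ge> 1" using A i by simp
  then obtain f where "f \<in> LL Fq A" "f \<noteq> 0" using ell_pos_iff[OF A(1)] by blast
  hence "deg_div Fq A \<ge> 0" using LL_deg_nonneg[OF A(1)] by blast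
  hence "int (ell Fq A) \<le> deg_div Fq A + 1" by (intro ell_le_deg_Suc[OF Q A(1)]) simp
  thus ?thesis using A by linarith
qed

lemma ell_le_ell_tilde:
  assumes Q: "rational_place Fq Q" and A: "is_divisor Fq A" and deg: "deg_div Fq A \<ge> -1"
  shows "ell Fq A \<le> ell_tilde Fq (deg_div Fq A)"
proof (cases "deg_div Fq A = -1 \<or> ell Fq A = 0")
  case True
  thus ?thesis using ell_eq_0[OF A] by auto
next
  case False
  let ?a = "deg_div Fq A"
  have "ell Fq A \<le> Sup {i. i \<ge> 1 \<and> gonality Fq i \<le> ?a}"
  proof (rule cSup_upper)
    show "ell Fq A \<in> {i. i \<ge> 1 \<and> gonality Fq i \<le> ?a}"
      using False gonality_le[OF _ A, of "ell Fq A"] by simp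
    show "bdd_above {i. i \<ge> 1 \<and> gonality Fq i \<le> ?a}"
    proof (rule bdd_aboveI)
      fix i assume "i \<in> {i. i \<ge> 1 \<and> gonality Fq i \<le> ?a}"
      hence "int i \<le> ?a + 1" using gonality_le_imp[OF Q] by blast
      thus "i \<le> nat (?a + 1)" by linarith
    qed
  qed
  thus ?thesis using False by (simp add: ell_tilde_def)
qed

section \<open>Evaluation at rational points\<close>

lemma eval_at_unique:
  assumes P: "is_place Fq P" and c: "c \<in> Fq" "vge P (f - c) 1" "c' \<in> Fq" "vge P (f - c') 1"
  shows "c = c'"
proof -
  have "vge P (f - c - (f - c')) 1" by (rule vge_diff[OF P c(2,4)])
  hence "vge P (c' - c) 1" by simp
  thus ?thesis using place_Fq[OF P Fq_diff[OF c(3,1)]] by (auto simp: vge_def)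
qed

text \<open>The \<open>q\<close> constants are pairwise incongruent modulo the maximal ideal, and a
  rational place has only \<open>q\<close> residue classes, so each class contains exactly one
  constant.\<close>

lemma eval_at_props:
  assumes P: "rational_place Fq P" and f: "vge P f 0"
  shows "eval_at Fq P f \<in> Fq" "vge P (f - eval_at Fq P f) 1"
proof -
  have pl: "is_place Fq P" and deg: "deg_place Fq P = 1" using P by (auto simp: rational_place_def)
  obtain R where R: "rep_set {a. vge P a 0} {a. vge P a 1} R" "card R = q"
    using ex_residue_reps[OF pl] deg by auto
  have "\<forall>c\<in>Fq. \<exists>r\<in>R. vge P (c - r) 1" using R(1) vge_Fq[OF pl] by (auto simp: rep_set_def)
  then obtain h where h: "\<And>c. c \<in> Fq \<Longrightarrow> h c \<in> R" "\<And>c. c \<in> Fq \<Longrightarrow> vge P (c - h c) 1" by metis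
  have inj: "inj_on h Fq"
  proof (rule inj_onI)
    fix c c' assume cc: "c \<in> Fq" "c' \<in> Fq" "h c = h c'"
    have "vge P (h c - c) 1" "vge P (h c - c') 1"
      using vge_uminus[OF pl h(2)[OF cc(1)]] vge_uminus[OF pl h(2)[OF cc(2)]] cc(3) by simp_all
    thus "c = c'" using eval_at_unique[OF pl] cc by blast
  qed
  have "h ` Fq = R"
    using h(1) R inj by (intro card_subset_eq) (auto simp: card_image rep_set_def)
  moreover obtain r where r: "r \<in> R" "vge P (f - r) 1" using R(1) f by (auto simp: rep_set_def)
  ultimately obtain c where c: "c \<in> Fq" "r = h c" by blast
  have "vge P (f - r - (c - h c)) 1" by (rule vge_diff[OF pl r(2) h(2)[OF c(1)]])
  hence c1: "c \<in> Fq \<and> vge P (f - c) 1" using c by simp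
  have eq: "eval_at Fq P f = (THE c. c \<in> Fq \<and> vge P (f - c) 1)"
    by (simp add: eval_at_def vge_def int_one_le_iff_zero_less)
  have "eval_at Fq P f \<in> Fq \<and> vge P (f - eval_at Fq P f) 1"
    unfolding eq by (rule theI[of _ c]) (use c1 eval_at_unique[OF pl] in blast)+
  thus "eval_at Fq P f \<in> Fq" "vge P (f - eval_at Fq P f) 1" by auto
qed

lemma eval_at_eq_iff:
  assumes P: "rational_place Fq P" and f: "vge P f 0" and g: "vge P g 0"
  shows "eval_at Fq P f = eval_at Fq P g \<longleftrightarrow> vge P (f - g) 1"
proof -
  have pl: "is_place Fq P" using P by (simp add: rational_place_def)
  note ef = eval_at_props[OF P f] and eg = eval_at_props[OF P g]
  show ?thesis
  proof
    assume "eval_at Fq P f = eval_at Fq P g"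
    thus "vge P (f - g) 1" using vge_diff[OF pl ef(2) eg(2)] by simp
  next
    assume "vge P (f - g) 1"
    hence "vge P (f - g + (g - eval_at Fq P g)) 1" using eg(2) by (rule vge_add[OF pl])
    hence "vge P (f - eval_at Fq P g) 1" by simp
    thus "eval_at Fq P f = eval_at Fq P g" using eval_at_unique[OF pl ef eg(1)] by blast
  qed
qed

lemma eval_at_0:
  assumes P: "rational_place Fq P"
  shows "eval_at Fq P 0 = 0"
  using eval_at_unique[of P "eval_at Fq P 0" 0 0] eval_at_props[OF P, of 0] P
  by (simp add: rational_place_def)

text \<open>Rank-nullity by counting: all fibres are translates of \<open>N\<close>. The criterion
  \<open>iff\<close> replaces linearity of \<open>g\<close>, so linearity of evaluation never has to
  be proved.\<close>

lemma card_eq_fibres: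
  assumes V: "lsub V" "finite V" and N: "N \<subseteq> V"
    and iff: "\<And>f f'. f \<in> V \<Longrightarrow> f' \<in> V \<Longrightarrow> g f = g f' \<longleftrightarrow> f - f' \<in> N"
  shows "card V = card (g ` V) * card N"
proof -
  have fib: "card {f \<in> V. g f = r} = card N" if r: "r \<in> g ` V" for r
  proof -
    obtain f0 where f0: "f0 \<in> V" "r = g f0" using r by blast
    have "{f \<in> V. g f = r} = (\<lambda>a. a + f0) ` N"
    proof (intro equalityI subsetI)
      fix f assume "f \<in> {f \<in> V. g f = r}"
      hence "f - f0 \<in> N" using iff[of f f0] f0 by simp
      thus "f \<in> (\<lambda>a. a + f0) ` N" by (intro image_eqI[of _ _ "f - f0"]) auto
    next
      fix f assume "f \<in> (\<lambda>a. a + f0) ` N"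
      then obtain a where a: "a \<in> N" "f = a + f0" by blast
      hence "f \<in> V" using N f0 by (auto intro: lsub_add[OF V(1)])
      thus "f \<in> {f \<in> V. g f = r}" using iff[of f f0] f0 a by simp
    qed
    thus ?thesis by (simp add: card_image)
  qed
  have "card V = (\<Sum>f\<in>V. 1)" by simp
  also have "\<dots> = (\<Sum>r\<in>g ` V. \<Sum>f\<in>{f \<in> V. g f = r}. 1)" by (rule sum.image_gen[OF V(2)])
  also have "\<dots> = (\<Sum>r\<in>g ` V. card N)" using fib by (intro sum.cong) auto
  finally show ?thesis by simp
qed

section \<open>Past and future subcodes as evaluation images\<close>

context
  fixes qs :: "('K \<Rightarrow> int) list" and G :: "'K divisor"
  assumes rat: "\<And>P. P \<in> set qs \<Longrightarrow> rational_place Fq P"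
    and divG: "is_divisor Fq G" and supp: "\<And>P. P \<in> set qs \<Longrightarrow> G P = 0"
begin

lemma LL_G_vge: "f \<in> LL Fq G \<Longrightarrow> P \<in> set qs \<Longrightarrow> vge P f 0"
  using rat supp by (fastforce simp: LL_iff rational_place_def)

lemma LL_vanishing:
  assumes T: "T \<subseteq> set qs"
  shows "LL Fq (\<lambda>P. G P - point_sum T P) = {f \<in> LL Fq G. \<forall>P\<in>T. eval_at Fq P f = 0}"
proof (intro equalityI subsetI)
  fix f assume f: "f \<in> LL Fq (\<lambda>P. G P - point_sum T P)"
  have "LL Fq (\<lambda>P. G P - point_sum T P) \<subseteq> LL Fq G" by (rule LL_mono) (simp add: point_sum_def)
  hence fG: "f \<in> LL Fq G" using f by blast
  have "eval_at Fq P f = 0" if P: "P \<in> T" for P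
  proof -
    have Pq: "P \<in> set qs" using P T by blast
    have "vge P (f - 0) 1" using f P rat[OF Pq] supp[OF Pq] by (auto simp: LL_iff rational_place_def point_sum_def)
    thus ?thesis
      using eval_at_eq_iff[OF rat[OF Pq] LL_G_vge[OF fG Pq], of 0] eval_at_0[OF rat[OF Pq]] by simp
  qed
  thus "f \<in> {f \<in> LL Fq G. \<forall>P\<in>T. eval_at Fq P f = 0}" using fG by blast
next
  fix f assume f: "f \<in> {f \<in> LL Fq G. \<forall>P\<in>T. eval_at Fq P f = 0}"
  show "f \<in> LL Fq (\<lambda>P. G P - point_sum T P)" unfolding LL_iff
  proof (intro allI impI)
    fix P assume P: "is_place Fq P"
    show "vge P f (- (G P - point_sum T P))"
    proof (cases "P \<in> T")
      case True
      hence Pq: "P \<in> set qs" using T by blast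
      have "vge P (f - 0) 1"
        using eval_at_eq_iff[OF rat[OF Pq] LL_G_vge[OF _ Pq], of f 0] eval_at_0[OF rat[OF Pq]] f True by simp
      thus ?thesis using True supp[OF Pq] by (simp add: point_sum_def)
    next
      case False
      thus ?thesis using f P by (simp add: LL_iff point_sum_def)
    qed
  qed
qed

lemma is_divisor_G_minus: "T \<subseteq> set qs \<Longrightarrow> is_divisor Fq (\<lambda>P. G P - point_sum T P)"
  using rat by (intro is_divisor_diff divG is_divisor_point_sum) (auto intro: finite_subset)

lemma deg_G_minus: "T \<subseteq> set qs \<Longrightarrow> deg_div Fq (\<lambda>P. G P - point_sum T P) = deg_div Fq G - int (card T)"
  using rat deg_div_diff[OF divG is_divisor_point_sum[of T]] deg_div_point_sum[of T] finite_subset[of T "set qs"]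
  by (simp add: subset_iff)

text \<open>Evaluating at \<open>xs\<close> on functions that vanish on \<open>T\<close> has as
  kernel those vanishing on both. The code itself and its past and future subcodes are
  instances.\<close>

lemma fdim_eval_image:
  assumes xs: "set xs \<subseteq> set qs" and T: "T \<subseteq> set qs"
  shows "fdim Fq ((\<lambda>f. map (\<lambda>P. eval_at Fq P f) xs) ` LL Fq (\<lambda>P. G P - point_sum T P)) +
    ell Fq (\<lambda>P. G P - point_sum (T \<union> set xs) P) = ell Fq (\<lambda>P. G P - point_sum T P)"
proof -
  let ?V = "LL Fq (\<lambda>P. G P - point_sum T P)"
  let ?N = "LL Fq (\<lambda>P. G P - point_sum (T \<union> set xs) P)"
  let ?g = "\<lambda>f. map (\<lambda>P. eval_at Fq P f) xs"
  have TX: "T \<union> set xs \<subseteq> set qs" using xs T by blast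
  have V: "?V = {f \<in> LL Fq G. \<forall>P\<in>T. eval_at Fq P f = 0}" by (rule LL_vanishing[OF T])
  have N: "?N = {f \<in> ?V. \<forall>P\<in>set xs. eval_at Fq P f = 0}" unfolding V LL_vanishing[OF TX] by auto
  have "?g f = ?g f' \<longleftrightarrow> f - f' \<in> ?N" if f: "f \<in> ?V" "f' \<in> ?V" for f f'
  proof -
    have d: "f - f' \<in> ?V" by (rule lsub_diff[OF lsub_LL f])
    have "eval_at Fq P f = eval_at Fq P f' \<longleftrightarrow> eval_at Fq P (f - f') = 0" if P: "P \<in> set xs" for P
    proof -
      have Pq: "P \<in> set qs" using P xs by blast
      have *: "vge P f 0" "vge P f' 0" "vge P (f - f') 0" using f d LL_G_vge[OF _ Pq] unfolding V by auto
      show ?thesis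
        using eval_at_eq_iff[OF rat[OF Pq] *(1,2)] eval_at_eq_iff[OF rat[OF Pq] *(3), of 0]
          eval_at_0[OF rat[OF Pq]] by simp
    qed
    thus ?thesis using d unfolding N by auto
  qed
  hence "card ?V = card (?g ` ?V) * card ?N"
    using N by (intro card_eq_fibres lsub_LL finite_LL is_divisor_G_minus[OF T]) auto
  hence eq: "q ^ ell Fq (\<lambda>P. G P - point_sum T P) =
      card (?g ` ?V) * q ^ ell Fq (\<lambda>P. G P - point_sum (T \<union> set xs) P)" (is "q ^ ?a = _ * q ^ ?b")
    by (simp add: card_LL is_divisor_G_minus[OF T] is_divisor_G_minus[OF TX])
  have le: "?b \<le> ?a"
    by (rule ell_mono[OF is_divisor_G_minus[OF TX] is_divisor_G_minus[OF T]]) (simp add: point_sum_def)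
  have "card (?g ` ?V) * q ^ ?b = q ^ (?a - ?b) * q ^ ?b" using le eq by (simp flip: power_add)
  hence "card (?g ` ?V) = q ^ (?a - ?b)" using q_ge_2 by auto
  hence "fdim Fq (?g ` ?V) = ?a - ?b" by (rule fdim_eqI)
  thus ?thesis using le by simp
qed

lemma G_minus_empty: "(\<lambda>P. G P - point_sum {} P) = G" by (simp add: point_sum_def)

lemma AG_code_image: "AG_code Fq qs G = (\<lambda>f. map (\<lambda>P. eval_at Fq P f) qs) ` LL Fq G"
  by (auto simp: AG_code_def)

lemma fdim_AG_code:
  "fdim Fq (AG_code Fq qs G) + ell Fq (\<lambda>P. G P - point_sum (set qs) P) = ell Fq G"
  using fdim_eval_image[of qs "{}"] by (simp add: G_minus_empty AG_code_image)

lemma past_AG_code: "past (AG_code Fq qs G) i =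
  (\<lambda>f. map (\<lambda>P. eval_at Fq P f) (take i qs)) ` LL Fq (\<lambda>P. G P - point_sum (set (drop i qs)) P)"
proof (intro equalityI subsetI)
  fix c assume "c \<in> past (AG_code Fq qs G) i"
  thus "c \<in> (\<lambda>f. map (\<lambda>P. eval_at Fq P f) (take i qs)) ` LL Fq (\<lambda>P. G P - point_sum (set (drop i qs)) P)"
    unfolding LL_vanishing[OF set_drop_subset] by (auto simp: past_def AG_code_def take_map drop_map)
next
  fix c assume "c \<in> (\<lambda>f. map (\<lambda>P. eval_at Fq P f) (take i qs)) ` LL Fq (\<lambda>P. G P - point_sum (set (drop i qs)) P)"
  then obtain f where f: "c = map (\<lambda>P. eval_at Fq P f) (take i qs)" "f \<in> LL Fq G"
    "\<forall>P\<in>set (drop i qs). eval_at Fq P f = 0"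
    unfolding LL_vanishing[OF set_drop_subset] by blast
  thus "c \<in> past (AG_code Fq qs G) i" unfolding past_def AG_code_def
    by (intro CollectI exI[of _ "map (\<lambda>P. eval_at Fq P f) qs"]) (auto simp: take_map drop_map)
qed

lemma future_AG_code: "future (AG_code Fq qs G) i =
  (\<lambda>f. map (\<lambda>P. eval_at Fq P f) (drop i qs)) ` LL Fq (\<lambda>P. G P - point_sum (set (take i qs)) P)"
proof (intro equalityI subsetI)
  fix c assume "c \<in> future (AG_code Fq qs G) i"
  thus "c \<in> (\<lambda>f. map (\<lambda>P. eval_at Fq P f) (drop i qs)) ` LL Fq (\<lambda>P. G P - point_sum (set (take i qs)) P)"
    unfolding LL_vanishing[OF set_take_subset] by (auto simp: future_def AG_code_def take_map drop_map)
next
  fix c assume "c \<in> (\<lambda>f. map (\<lambda>P. eval_at Fq P f) (drop i qs)) ` LL Fq (\<lambda>P. G P - point_sum (set (take i qs)) P)"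
  then obtain f where f: "c = map (\<lambda>P. eval_at Fq P f) (drop i qs)" "f \<in> LL Fq G"
    "\<forall>P\<in>set (take i qs). eval_at Fq P f = 0"
    unfolding LL_vanishing[OF set_take_subset] by blast
  thus "c \<in> future (AG_code Fq qs G) i" unfolding future_def AG_code_def
    by (intro CollectI exI[of _ "map (\<lambda>P. eval_at Fq P f) qs"]) (auto simp: take_map drop_map)
qed

lemma deg_G_less:
  assumes "distinct qs" and hk: "2 * fdim Fq (AG_code Fq qs G) \<le> length qs"
    and hn: "int (length qs) > 2 * genus Fq"
  shows "qs \<noteq> []" "deg_div Fq G < int (length qs)"
proof -
  \<comment> \<open>The zero divisor shows g \<ge> 0, so n > 2g provides a point, hence a rational
    place.\<close>
  have "1 - genus Fq \<le> 1" using riemann_genus[OF is_divisor_0] by (simp add: deg_div_0 ell_0)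
  thus ne: "qs \<noteq> []" using hn by auto
  show "deg_div Fq G < int (length qs)"
  proof (rule ccontr)
    assume ge: "\<not> ?thesis"
    have Q: "rational_place Fq (hd qs)" using ne rat by simp
    let ?A = "\<lambda>P. G P - point_sum (set qs) P"
    have degA: "deg_div Fq ?A = deg_div Fq G - int (length qs)"
      using deg_G_minus[of "set qs"] distinct_card[OF assms(1)] by simp
    have "int (ell Fq ?A) \<le> deg_div Fq ?A + 1"
      using ge degA by (intro ell_le_deg_Suc[OF Q is_divisor_G_minus]) auto
    moreover have "deg_div Fq G + 1 - genus Fq \<le> int (ell Fq G)" by (rule riemann_genus[OF divG])
    moreover have "int (ell Fq G) = int (fdim Fq (AG_code Fq qs G)) + int (ell Fq ?A)"
      by (simp flip: fdim_AG_code)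
    ultimately show False using hk hn degA by linarith
  qed
qed

lemma Delta_AG_code_le_RR:
  assumes dist: "distinct qs" and ne: "qs \<noteq> []" and m: "deg_div Fq G < int (length qs)"
    and hm: "2 * deg_div Fq G - int (length qs) \<ge> -1"
  shows "Delta Fq (length qs) (AG_code Fq qs G) \<le> RR Fq (2 * deg_div Fq G - int (length qs))"
proof -
  let ?n = "length qs"
  define N where "N = 2 * deg_div Fq G - int ?n"
  define X where "X = {ell_tilde Fq a + ell_tilde Fq b | a b. a \<ge> -1 \<and> b \<ge> -1 \<and> a + b = N}"
  have "X \<subseteq> (\<lambda>a. ell_tilde Fq a + ell_tilde Fq (N - a)) ` {-1..N + 1}"
  proof
    fix t assume "t \<in> X"
    then obtain a b where ab: "t = ell_tilde Fq a + ell_tilde Fq b" "a \<ge> -1" "b \<ge> -1" "a + b = N"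
      by (auto simp: X_def)
    hence "b = N - a" "a \<in> {-1..N + 1}" by auto
    thus "t \<in> (\<lambda>a. ell_tilde Fq a + ell_tilde Fq (N - a)) ` {-1..N + 1}" using ab(1) by blast
  qed
  hence fin: "finite X" by (rule finite_subset) simp
  have "ell_tilde Fq (-1) + ell_tilde Fq (N + 1) \<in> X"
    unfolding X_def using hm by (intro CollectI exI[of _ "-1"] exI[of _ "N + 1"]) (auto simp: N_def)
  hence "X \<noteq> {}" by blast
  hence "RR Fq N \<in> X" unfolding RR_def X_def[symmetric] using fin by (rule Min_in[rotated])
  then obtain a b where ab: "RR Fq N = ell_tilde Fq a + ell_tilde Fq b" "a \<ge> -1" "b \<ge> -1" "a + b = N"
    by (auto simp: X_def)
  \<comment> \<open>Removing i points then leaves degree b, and removing the other n - i leaves m -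
    n + i = N - b = a. Since m < n, the bound b \<le> N + 1 gives i \<ge> 0 and b \<ge> -1 gives i
    \<le> n.\<close>
  define i where "i = nat (deg_div Fq G - b)"
  have i: "int i = deg_div Fq G - b" "i \<le> ?n" using ab m by (auto simp: i_def N_def)
  have Q: "rational_place Fq (hd qs)" using ne rat by simp
  let ?D = "set (drop i qs)" and ?T = "set (take i qs)"
  have sub: "?D \<subseteq> set qs" "?T \<subseteq> set qs" by (auto dest: in_set_dropD in_set_takeD)
  have "?T \<union> ?D = set qs" by (simp flip: set_append)
  hence un: "?T \<union> ?D = set qs" "?D \<union> ?T = set qs" by (simp_all add: Un_commute)
  have "ell Fq (\<lambda>P. G P - point_sum (set qs) P) = 0"
    using m deg_G_minus[of "set qs"] distinct_card[OF dist]
    by (intro ell_eq_0 is_divisor_G_minus) auto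
  hence dims: "fdim Fq (past (AG_code Fq qs G) i) = ell Fq (\<lambda>P. G P - point_sum ?D P)"
    "fdim Fq (future (AG_code Fq qs G) i) = ell Fq (\<lambda>P. G P - point_sum ?T P)"
    using fdim_eval_image[OF sub(2,1)] fdim_eval_image[OF sub]
    by (simp_all only: un past_AG_code future_AG_code add_0_right)
  have cards: "card ?D = ?n - i" "card ?T = i" using dist i by (simp_all add: distinct_card)
  have degs: "deg_div Fq (\<lambda>P. G P - point_sum ?D P) = a" "deg_div Fq (\<lambda>P. G P - point_sum ?T P) = b"
    using deg_G_minus[OF sub(1)] deg_G_minus[OF sub(2)] i ab(4) by (simp_all add: cards of_nat_diff N_def)
  have "ell Fq (\<lambda>P. G P - point_sum ?D P) \<le> ell_tilde Fq a"
    using ell_le_ell_tilde[OF Q is_divisor_G_minus[OF sub(1)]] degs ab by simp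
  moreover have "ell Fq (\<lambda>P. G P - point_sum ?T P) \<le> ell_tilde Fq b"
    using ell_le_ell_tilde[OF Q is_divisor_G_minus[OF sub(2)]] degs ab by simp
  moreover have "Delta Fq ?n (AG_code Fq qs G) \<le>
      fdim Fq (past (AG_code Fq qs G) i) + fdim Fq (future (AG_code Fq qs G) i)"
    unfolding Delta_def using i(2) by (intro Min_le) auto
  ultimately show ?thesis unfolding N_def[symmetric] using ab(1) dims by linarith
qed

end

section \<open>Reordering the points and the conclusion\<close>

text \<open>Permuting coordinates amounts to reordering the points, so a bound for an arbitrary list
  covers the whole class.\<close>

lemma permute_AG_code:
  assumes "bij_betw \<sigma> {..<length ps} {..<length ps}"
  shows "permute_code (length ps) \<sigma> (AG_code Fq ps G) = AG_code Fq (map (\<lambda>j. ps ! \<sigma> j) [0..<length ps]) G"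
proof -
  have "map (\<lambda>j. map (\<lambda>P. eval_at Fq P f) ps ! \<sigma> j) [0..<length ps] =
      map (\<lambda>P. eval_at Fq P f) (map (\<lambda>j. ps ! \<sigma> j) [0..<length ps])" for f
    using bij_betwE[OF assms] by simp
  thus ?thesis by (auto simp: permute_code_def AG_code_def) metis
qed

lemma permuted_list:
  assumes "bij_betw \<sigma> {..<length ps} {..<length ps}"
  shows "set (map (\<lambda>j. ps ! \<sigma> j) [0..<length ps]) = set ps"
    "distinct ps \<Longrightarrow> distinct (map (\<lambda>j. ps ! \<sigma> j) [0..<length ps])"
proof -
  have im: "\<sigma> ` {..<length ps} = {..<length ps}" and inj: "inj_on \<sigma> {..<length ps}"
    using assms by (auto simp: bij_betw_def)
  have "set (map (\<lambda>j. ps ! \<sigma> j) [0..<length ps]) = (!) ps ` (\<sigma> ` {..<length ps})"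
    by (simp add: image_image atLeast0LessThan)
  thus "set (map (\<lambda>j. ps ! \<sigma> j) [0..<length ps]) = set ps" unfolding im by (auto simp: set_conv_nth)
  show "distinct (map (\<lambda>j. ps ! \<sigma> j) [0..<length ps])" if "distinct ps"
  proof -
    have "\<sigma> j < length ps" if "j < length ps" for j using bij_betwE[OF assms] that by simp
    thus ?thesis using that inj by (auto simp: distinct_map inj_on_def nth_eq_iff_index_eq)
  qed
qed

end

theorem theorem3p4:
  fixes Fq :: "'K::field set" and ps :: "('K \<Rightarrow> int) list" and G :: "'K divisor"
  assumes ff: "function_field Fq"
    and dist: "distinct ps"
    and rat: "\<forall>P\<in>set ps. rational_place Fq P"
    and divG: "is_divisor Fq G"
    and supp: "\<forall>P\<in>set ps. G P = 0"
    and hk: "2 * fdim Fq (AG_code Fq ps G) \<le> length ps"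
    and hn: "int (length ps) > 2 * genus Fq"
    and hm: "2 * deg_div Fq G - int (length ps) \<ge> -1"
  shows "Delta_perm Fq (length ps) (AG_code Fq ps G)
           \<le> RR Fq (2 * deg_div Fq G - int (length ps))
       \<and> sc_perm Fq (length ps) (AG_code Fq ps G)
           \<ge> int (wC Fq (length ps) (AG_code Fq ps G)) - int (RR Fq (2 * deg_div Fq G - int (length ps)))"
proof -
  interpret curve Fq by unfold_locales (fact ff)
  let ?n = "length ps" and ?C = "AG_code Fq ps G"
  let ?R = "RR Fq (2 * deg_div Fq G - int ?n)"
  have ne: "ps \<noteq> []" and m: "deg_div Fq G < int ?n"
    using deg_G_less[of ps G] assms by auto
  have bounds: "Delta Fq ?n C' \<le> ?R \<and> fdim Fq C' = fdim Fq ?C" if C': "C' \<in> perm_class ?n ?C" for C'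
  proof -
    obtain \<sigma> where \<sigma>: "bij_betw \<sigma> {..<?n} {..<?n}" "C' = permute_code ?n \<sigma> ?C"
      using C' by (auto simp: perm_class_def)
    define qs where "qs = map (\<lambda>j. ps ! \<sigma> j) [0..<?n]"
    have C'_eq: "C' = AG_code Fq qs G" using \<sigma> by (simp add: permute_AG_code qs_def)
    have qs: "set qs = set ps" "distinct qs" "length qs = ?n"
      using permuted_list[OF \<sigma>(1)] dist by (auto simp: qs_def)
    have "qs \<noteq> []" using qs ne by auto
    hence "Delta Fq (length qs) (AG_code Fq qs G) \<le> RR Fq (2 * deg_div Fq G - int (length qs))"
      using qs rat supp divG m hm by (intro Delta_AG_code_le_RR) auto
    moreover have "fdim Fq (AG_code Fq qs G) + ell Fq (\<lambda>P. G P - point_sum (set qs) P) = ell Fq G"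
      using qs rat supp divG by (intro fdim_AG_code) auto
    moreover have "fdim Fq ?C + ell Fq (\<lambda>P. G P - point_sum (set ps) P) = ell Fq G"
      using rat supp divG by (intro fdim_AG_code) auto
    ultimately show ?thesis using qs C'_eq by simp
  qed
  have "bij_betw id {..<?n} {..<?n}" by simp
  hence pc: "perm_class ?n ?C \<noteq> {}" unfolding perm_class_def by blast
  have "Delta Fq ?n ` perm_class ?n ?C \<subseteq> {..?R}" using bounds by auto
  hence "finite (Delta Fq ?n ` perm_class ?n ?C)" by (rule finite_subset) simp
  hence "Delta_perm Fq ?n ?C \<le> ?R" unfolding Delta_perm_def using pc bounds by (subst Max_le_iff) auto
  moreover have sc: "int (fdim Fq ?C) - int ?R \<le> state_complexity Fq ?n C'"
    "state_complexity Fq ?n C' \<le> int (fdim Fq ?C)" if "C' \<in> perm_class ?n ?C" for C'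
    using bounds[OF that] by (auto simp: state_complexity_def)
  have "state_complexity Fq ?n ` perm_class ?n ?C \<subseteq> {int (fdim Fq ?C) - int ?R..int (fdim Fq ?C)}"
    using sc by auto
  hence "finite (state_complexity Fq ?n ` perm_class ?n ?C)" by (rule finite_subset) simp
  hence "int (fdim Fq ?C) - int ?R \<le> sc_perm Fq ?n ?C"
    unfolding sc_perm_def using pc sc by (subst Min_ge_iff) auto
  \<comment> \<open>\<open>wC\<close> is at most the dimension of the code.\<close>
  hence "int (wC Fq ?n ?C) - int ?R \<le> sc_perm Fq ?n ?C" by (simp add: wC_def)
  ultimately show ?thesis by blast
qed

end
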